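(* Let $f:\mathbb{R}\to\mathbb{C}$ belong to $C_0(\mathbb{R})$ and be locally absolutely continuous on $\mathbb{R}\setminus\{0\}$. Put $f_0(t)=\sup_{|s|\ge |t|}|f(s)|$. **a)** Let $f'$ be bounded almost everywhere outside any neighborhood of zero, and put $f_1(t)=\operatorname{ess\,sup}_{|s|\ge |t|}|f'(s)|$ for $|t|>0$. If $$A_0=\int_1^\infty \frac{f_0(t)}{t}\,dt<\infty,\qquad A_1=\int_0^1 f_1(t)\ln\frac{2}{t}\,dt<\infty,$$ and $$A_{01}=\int_1^\infty\left(\int_t^\infty f_0(s)f_1(s)\,ds\right)^{1/2}\frac{dt}{t}<\infty,$$ then $f\in A(\mathbb{R})$ and $\|f\|_A\le c\,(A_0+A_1+A_{01})$, where $c$ is an absolute constant. **b)** Let $f'$ be not bounded near infinity, put $f_\infty(t)=\operatorname{ess\,sup}_{0<|s|\le|t|}|f'(s)|$, and let $f(t)=0$ when $|t|\le 2\pi$, with $f_\infty(4\pi)>0$. If there exists $\delta\in(0,1)$ such that $$A_\delta^{1+\delta}:=\sup_{t\ge 2\pi} t\,f_0^{\delta}(t)\,f_\infty(t+2\pi)<\infty$$ (which defines $A_\delta\ge 0$), then $f\in A(\mathbb{R})$ and $$\|f\|_A\le \gamma(\delta)\,A_\delta\left(1+A_\delta^{1/\delta}\,(f_\infty(4\pi))^{-1/\delta}\right),$$ where $\gamma(\delta)$ is a positive quantity depending only on $\delta$.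
   Context: $C_0(\mathbb{R})$ is the space of continuous functions $f$ on $\mathbb{R}$ with $f(t)\to0$ as $|t|\to\infty$. One writes $f\in A(\mathbb{R})$ if there is $g\in L_1(\mathbb{R})$ with $f(y)=\int_{\mathbb{R}}g(x)e^{ixy}\,dx$ for all $y\in\mathbb{R}$, and then $\|f\|_A=\|g\|_{L_1(\mathbb{R})}$. The derivative $f'$ exists almost everywhere; "not bounded near infinity" is understood in the essential (almost everywhere) sense. *)

theory Defs
  imports "HOL-Analysis.Analysis" "HOL-Probability.Essential_Supremum"
begin

definition C0 :: "(real \<Rightarrow> complex) set" where
  "C0 = {f. continuous_on UNIV f \<and> (f \<longlongrightarrow> 0) at_infinity}"

text \<open>The usual \<open>\<epsilon>\<close>-\<open>\<delta>\<close> condition over finite families of non-overlapping closed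
  intervals contained in \<open>S\<close>; for \<open>K = {a..b}\<close> one has \<open>Inf K = a\<close> and \<open>Sup K = b\<close>.\<close>
definition absolutely_continuous_on :: "real set \<Rightarrow> (real \<Rightarrow> complex) \<Rightarrow> bool" where
  "absolutely_continuous_on S f \<longleftrightarrow>
     (\<forall>\<epsilon>>0. \<exists>\<delta>>0. \<forall>d t. d division_of t \<and> t \<subseteq> S \<and> (\<Sum>K\<in>d. Sup K - Inf K) < \<delta>
        \<longrightarrow> (\<Sum>K\<in>d. norm (f (Sup K) - f (Inf K))) < \<epsilon>)"

definition locally_absolutely_continuous_on :: "real set \<Rightarrow> (real \<Rightarrow> complex) \<Rightarrow> bool" where
  "locally_absolutely_continuous_on U f \<longleftrightarrow>
     (\<forall>a b. {a..b} \<subseteq> U \<longrightarrow> absolutely_continuous_on {a..b} f)"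

definition is_fourier_integral :: "(real \<Rightarrow> complex) \<Rightarrow> (real \<Rightarrow> complex) \<Rightarrow> bool" where
  "is_fourier_integral f g \<longleftrightarrow>
     integrable lebesgue g \<and>
     (\<forall>y. f y = (LINT x|lebesgue. g x * exp (\<i> * complex_of_real (x * y))))"

definition wiener_algebra :: "(real \<Rightarrow> complex) set" where
  "wiener_algebra = {f. \<exists>g. is_fourier_integral f g}"

text \<open>The value is well defined on \<open>wiener_algebra\<close>, since \<open>g\<close> is determined by \<open>f\<close>
  up to a null set.\<close>
definition wiener_norm :: "(real \<Rightarrow> complex) \<Rightarrow> real" where
  "wiener_norm f = (THE N. \<exists>g. is_fourier_integral f g \<and> N = (LINT x|lebesgue. norm (g x)))"

text \<open>At the points of the null set where \<open>f\<close> is not differentiable, \<open>vector_derivative\<close>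
  has an unspecified value; this affects neither essential suprema nor
  almost-everywhere statements, as \<open>lebesgue\<close> is complete.\<close>
abbreviation deriv_norm :: "(real \<Rightarrow> complex) \<Rightarrow> real \<Rightarrow> real" where
  "deriv_norm f s \<equiv> norm (vector_derivative f (at s))"

definition f_zero :: "(real \<Rightarrow> complex) \<Rightarrow> real \<Rightarrow> real" where
  "f_zero f t = (SUP s\<in>{s. \<bar>t\<bar> \<le> \<bar>s\<bar>}. norm (f s))"

definition f_one :: "(real \<Rightarrow> complex) \<Rightarrow> real \<Rightarrow> ennreal" where
  "f_one f t = esssup (restrict_space lebesgue {s. \<bar>t\<bar> \<le> \<bar>s\<bar>}) (\<lambda>s. ennreal (deriv_norm f s))"

definition f_infty :: "(real \<Rightarrow> complex) \<Rightarrow> real \<Rightarrow> ennreal" where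
  "f_infty f t =
     esssup (restrict_space lebesgue {s. 0 < \<bar>s\<bar> \<and> \<bar>s\<bar> \<le> \<bar>t\<bar>}) (\<lambda>s. ennreal (deriv_norm f s))"

definition deriv_bounded_away_from_zero :: "(real \<Rightarrow> complex) \<Rightarrow> bool" where
  "deriv_bounded_away_from_zero f \<longleftrightarrow>
     (\<forall>\<epsilon>>0. \<exists>M. AE s in lebesgue. \<epsilon> \<le> \<bar>s\<bar> \<longrightarrow> deriv_norm f s \<le> M)"

definition deriv_bounded_near_infinity :: "(real \<Rightarrow> complex) \<Rightarrow> bool" where
  "deriv_bounded_near_infinity f \<longleftrightarrow>
     (\<exists>R M. AE s in lebesgue. R \<le> \<bar>s\<bar> \<longrightarrow> deriv_norm f s \<le> M)"

definition ennreal_sqrt :: "ennreal \<Rightarrow> ennreal" where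
  "ennreal_sqrt x = (if x = \<infinity> then \<infinity> else ennreal (sqrt (enn2real x)))"

definition A_0 :: "(real \<Rightarrow> complex) \<Rightarrow> ennreal" where
  "A_0 f = (\<integral>\<^sup>+t\<in>{1..}. ennreal (f_zero f t / t) \<partial>lebesgue)"

definition A_1 :: "(real \<Rightarrow> complex) \<Rightarrow> ennreal" where
  "A_1 f = (\<integral>\<^sup>+t\<in>{0<..1}. f_one f t * ennreal (ln (2 / t)) \<partial>lebesgue)"

definition A_01 :: "(real \<Rightarrow> complex) \<Rightarrow> ennreal" where
  "A_01 f = (\<integral>\<^sup>+t\<in>{1..}.
     ennreal_sqrt (\<integral>\<^sup>+s\<in>{t..}. ennreal (f_zero f s) * f_one f s \<partial>lebesgue) * ennreal (1 / t)
     \<partial>lebesgue)"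

definition A_sup :: "real \<Rightarrow> (real \<Rightarrow> complex) \<Rightarrow> ennreal" where
  "A_sup \<delta> f = (SUP t\<in>{2 * pi..}. ennreal (t * f_zero f t powr \<delta>) * f_infty f (t + 2 * pi))"

text \<open>The number with \<open>A_delta \<delta> f powr (1 + \<delta>) = A_sup \<delta> f\<close>; meaningful only if
  \<open>A_sup \<delta> f\<close> is finite.\<close>
definition A_delta :: "real \<Rightarrow> (real \<Rightarrow> complex) \<Rightarrow> real" where
  "A_delta \<delta> f = enn2real (A_sup \<delta> f) powr (1 / (1 + \<delta>))"

end

theory Submission
  imports Defs "HOL-Probability.Levy"
begin

text \<open>The engine is Bernstein's inequality: a continuous integrable \<open>u\<close> whose \<open>L\<^sup>2\<close> modulus of
  continuity is \<open>O(h powr \<alpha>)\<close> with \<open>\<alpha> > 1/2\<close> has an integrable Fourier transform. One splits the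
  frequencies into dyadic bands and, on each band, uses Cauchy--Schwarz and the Plancherel
  inequality for the difference \<open>u (t + h) - u t\<close> with \<open>h\<close> the reciprocal of the frequency.
  In part a) it is applied to pieces of \<open>f\<close> supported in \<open>T \<le> \<bar>t\<bar> \<le> 4 T\<close>, \<open>T\<close> a power of \<open>2\<close>: a piece
  bounded by \<open>B\<close> with Lipschitz constant \<open>K\<close> costs \<open>sqrt (T K B) + B\<close>. For \<open>T \<ge> 1\<close> the pieces are cut from
  \<open>f\<close> itself and the costs sum up to \<open>A_01\<close> and \<open>A_0\<close>; for \<open>T < 1\<close> they are cut from \<open>f - f 0\<close>, and the
  logarithm in \<open>A_1\<close> pays for the summation over the scales. In part b) the bounds
  \<open>2 f_0\<close> and \<open>h f_\<infinity>\<close> for \<open>\<bar>f (t + h) - f t\<bar>\<close> interpolate to \<open>O((h / t) powr (1 / (1 + \<delta>)))\<close>, so that the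
  inequality applies to \<open>f\<close> directly. That bounds on \<open>f'\<close> control increments of \<open>f\<close> needs the
  almost everywhere differentiability of absolutely continuous functions, proved by Vitali coverings.\<close>

section \<open>Absolutely continuous functions are differentiable almost everywhere\<close>

text \<open>\<open>vector_derivative\<close> is unspecified where \<open>f\<close> is not
  differentiable, so an almost everywhere bound on \<open>deriv_norm\<close> says something about
  \<open>f\<close> only once differentiability almost everywhere is known. The exponent 1/2 is the
  price of Cauchy--Schwarz: at frequency \<open>x\<close> a band has length of order
  \<open>x\<close>, and the difference with step \<open>1/x\<close> has L2 norm of order
  \<open>x powr (- \<alpha>)\<close>, so the band costs \<open>x powr (1/2 - \<alpha>)\<close>. In
  part b) the exponent is \<open>1 / (1 + \<delta>)\<close>, above 1/2 because
  \<open>\<delta> < 1\<close>. In part a) the cost \<open>sqrt (T K B)\<close> results from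
  separating low and high frequencies at \<open>K / B\<close>, and the extra \<open>B\<close> from
  the slope of the cutoff. Near zero \<open>f\<close> need not be small and \<open>f_one\<close> may
  be unbounded, but \<open>f - f 0\<close> at scale \<open>T\<close> is bounded by the sum of
  \<open>t * f_one f t\<close> over dyadic \<open>t\<close> of order at most \<open>T\<close>;
  summing these tails over the scales counts the \<open>i\<close>-th dyadic point about
  \<open>i\<close> times, which is the logarithm. Norm bounds are carried by
  \<open>wiener_le\<close>, which provides a density; its uniqueness enters only when
  \<open>wiener_norm\<close> is evaluated.\<close>

abbreviation incr :: "(real \<Rightarrow> 'a::real_normed_vector) \<Rightarrow> real set \<Rightarrow> 'a" where
  "incr g K \<equiv> g (Sup K) - g (Inf K)"

abbreviation \<mu> :: "real set \<Rightarrow> real" where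
  "\<mu> \<equiv> measure lebesgue"

section \<open>Divisions of an interval and sums of increments\<close>

lemma sum_division_interval:
  fixes g :: "real \<Rightarrow> 'a::real_normed_vector"
  assumes "q division_of {a..b}" "a \<le> b"
  shows "(\<Sum>K\<in>q. incr g K) = g b - g a"
proof -
  have fin: "\<And>K. K \<in> q \<Longrightarrow> K \<noteq> {} \<and> (\<exists>u v. K = cbox u v)"
    using assms by (auto simp: division_of_def)
  let ?p = "(\<lambda>K. (Inf K, K)) ` q"
  have "?p tagged_division_of {a..b}"
  proof (rule tagged_division_ofI)
    show "finite ?p" using assms by auto
    fix x K assume "(x,K) \<in> ?p"
    then have K: "K \<in> q" "x = Inf K" by auto
    then obtain u v where uv: "K = {u..v}" "u \<le> v" using fin[of K] by force
    show "x \<in> K" using uv K by auto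
    show "K \<subseteq> {a..b}" using K assms by (auto simp: division_of_def)
    show "\<exists>a b. K = cbox a b" using uv by auto
    fix x' K' assume "(x', K') \<in> ?p" "(x,K) \<noteq> (x',K')"
    then have "K' \<in> q" "K \<noteq> K'" using K by auto
    then show "interior K \<inter> interior K' = {}"
      using K assms by (auto simp: division_of_def)
  next
    have "{K. \<exists>x. (x, K) \<in> ?p} = q" by auto
    then show "\<Union>{K. \<exists>x. (x, K) \<in> ?p} = {a..b}"
      using division_ofD(6)[OF assms(1)] by simp
  qed
  from additive_tagged_division_1[OF assms(2) this, of g]
  show ?thesis by (subst (asm) sum.reindex) (auto simp: inj_on_def)
qed

text \<open>\<open>r\<close> consists of the gaps that \<open>e\<close> leaves in \<open>d\<close>:
  inside each \<open>K\<close> of \<open>d\<close> the members of \<open>e\<close> are completed to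
  a division of \<open>K\<close>, and only the added intervals are kept. Disjointness of
  \<open>d\<close>, stronger than disjointness of interiors, keeps the families belonging to
  different \<open>K\<close> apart. The identity holds for all \<open>g\<close> at once because one
  \<open>r\<close> has to serve both for lengths (\<open>g\<close> the identity) and for the
  increments of the function studied.\<close>

lemma division_difference:
  assumes d: "d division_of \<Union>d" and disj: "pairwise disjnt d"
    and e: "e division_of \<Union>e" and sub: "\<And>L. L \<in> e \<Longrightarrow> \<exists>K\<in>d. L \<subseteq> K"
  obtains r where "r division_of \<Union>r" "\<Union>r \<subseteq> \<Union>d"
    "\<And>g::real \<Rightarrow> real. (\<Sum>K\<in>r. incr g K) =
       (\<Sum>K\<in>d. incr g K) - (\<Sum>K\<in>e. incr g K)"
proof -
  define eK where "eK K = {L\<in>e. L \<subseteq> K}" for K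
  have dK: "\<exists>u v. K = {u..v} \<and> u \<le> v" if Kd: "K \<in> d" for K
  proof -
    obtain u v where "K = cbox u v" "K \<noteq> {}" using division_ofD(3,4)[OF d Kd] by blast
    then show ?thesis by (intro exI[of _ u] exI[of _ v]) auto
  qed
  have "\<exists>q. eK K \<subseteq> q \<and> q division_of K" if Kd: "K \<in> d" for K
  proof -
    obtain u v where uv: "K = cbox u v" using dK[OF Kd] by (metis cbox_interval)
    have "eK K division_of \<Union>(eK K)" by (rule division_of_subset[OF e]) (auto simp: eK_def)
    moreover have "\<Union>(eK K) \<subseteq> cbox u v" by (auto simp: eK_def uv)
    ultimately show ?thesis using partial_division_extend_interval uv by metis
  qed
  then obtain q where q: "\<And>K. K \<in> d \<Longrightarrow> eK K \<subseteq> q K" "\<And>K. K \<in> d \<Longrightarrow> q K division_of K"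
    by metis
  define r where "r = (\<Union>K\<in>d. q K - eK K)"
  have find: "finite d" and fine: "finite e" using d e by auto
  have finq: "finite (q K)" if "K \<in> d" for K using q(2)[OF that] by auto
  have qsub: "L \<subseteq> K" "L \<noteq> {}" if "K \<in> d" "L \<in> q K" for K L
    using division_ofD(2,3)[OF q(2)[OF that(1)] that(2)] by auto
  have qdisj: "q K \<inter> q K' = {}" if "K \<in> d" "K' \<in> d" "K \<noteq> K'" for K K'
  proof -
    have "K \<inter> K' = {}" using disj that by (auto simp: pairwise_def disjnt_def)
    then show ?thesis using qsub that by blast
  qed
  have r1: "r division_of \<Union>r"
  proof (rule division_ofI)
    show "finite r" using find finq by (auto simp: r_def)
    show "\<And>K. K \<in> r \<Longrightarrow> K \<subseteq> \<Union> r" by auto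
    fix K assume "K \<in> r"
    then obtain I where I: "I \<in> d" "K \<in> q I" by (auto simp: r_def)
    show "K \<noteq> {}" "\<exists>a b. K = cbox a b"
      using division_ofD(3,4)[OF q(2)[OF I(1)] I(2)] by auto
    fix K' assume K': "K' \<in> r" "K \<noteq> K'"
    then obtain I' where I': "I' \<in> d" "K' \<in> q I'" by (auto simp: r_def)
    show "interior K \<inter> interior K' = {}"
    proof (cases "I = I'")
      case True
      then show ?thesis using division_ofD(5)[OF q(2)[OF I(1)] I(2) _ K'(2)] I' by auto
    next
      case False
      then have "I \<inter> I' = {}" using disj I I' by (auto simp: pairwise_def disjnt_def)
      then have "K \<inter> K' = {}" using qsub[OF I] qsub[OF I'] by auto
      then show ?thesis using interior_subset by blast
    qed
  qed auto
  have r2: "\<Union>r \<subseteq> \<Union>d"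
    using qsub by (fastforce simp: r_def)
  have r3: "(\<Sum>K\<in>r. incr g K) =
       (\<Sum>K\<in>d. incr g K) - (\<Sum>K\<in>e. incr g K)" for g :: "real \<Rightarrow> real"
  proof -
    let ?D = "\<lambda>K. incr g K"
    have "(\<Sum>K\<in>r. ?D K) = (\<Sum>K\<in>d. \<Sum>L\<in>q K - eK K. ?D L)"
      unfolding r_def by (rule sum.UNION_disjoint) (use find finq qdisj in auto)
    also have "\<dots> = (\<Sum>K\<in>d. (\<Sum>L\<in>q K. ?D L) - (\<Sum>L\<in>eK K. ?D L))"
      by (intro sum.cong refl sum_diff) (use finq q in auto)
    also have "\<dots> = (\<Sum>K\<in>d. ?D K - (\<Sum>L\<in>eK K. ?D L))"
    proof (intro sum.cong refl)
      fix K assume K: "K \<in> d"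
      obtain u v where uv: "K = {u..v}" "u \<le> v" using dK[OF K] by auto
      show "(\<Sum>L\<in>q K. ?D L) - (\<Sum>L\<in>eK K. ?D L) = ?D K - (\<Sum>L\<in>eK K. ?D L)"
        using sum_division_interval[of "q K" u v g] q(2)[OF K] uv by simp
    qed
    also have "\<dots> = (\<Sum>K\<in>d. ?D K) - (\<Sum>K\<in>d. \<Sum>L\<in>eK K. ?D L)"
      by (rule sum_subtractf)
    also have "(\<Sum>K\<in>d. \<Sum>L\<in>eK K. ?D L) = (\<Sum>L\<in>(\<Union>K\<in>d. eK K). ?D L)"
    proof (rule sum.UNION_disjoint[symmetric])
      show "\<forall>i\<in>d. \<forall>j\<in>d. i \<noteq> j \<longrightarrow> eK i \<inter> eK j = {}" using qdisj q(1) by blast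
      show "\<forall>i\<in>d. finite (eK i)" using q(1) finq finite_subset by blast
    qed (use find in auto)
    also have "(\<Union>K\<in>d. eK K) = e" using sub by (auto simp: eK_def)
    finally show ?thesis .
  qed
  show thesis by (rule that[OF r1 r2 r3])
qed

text \<open>Derivates are taken over intervals containing the point in their interior: this makes the
  set a \<open>G\<^sub>\<delta>\<close> for every \<open>g\<close>, and continuity of \<open>g\<close> recovers the usual difference quotients.\<close>
definition steep :: "(real \<Rightarrow> real) \<Rightarrow> real \<Rightarrow> real set" where
  "steep g q = {x. \<forall>\<epsilon>>0. \<exists>u v. u < x \<and> x < v \<and> v - u < \<epsilon> \<and> q * (v - u) < g v - g u}"

lemma steep_borel [measurable]: "steep g q \<in> sets borel"
proof -
  define U where "U n = {x. \<exists>u v. u < x \<and> x < v \<and> v - u < inverse (real (Suc n)) \<and> q * (v - u) < g v - g u}" for n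
  have "x \<in> steep g q" if x: "x \<in> (\<Inter>n. U n)" for x
    unfolding steep_def
  proof (clarsimp)
    fix \<epsilon> :: real assume "\<epsilon> > 0"
    then obtain n where "inverse (real (Suc n)) < \<epsilon>" using reals_Archimedean by blast
    moreover have "x \<in> U n" using x by blast
    ultimately show "\<exists>u<x. \<exists>v>x. v - u < \<epsilon> \<and> q * (v - u) < g v - g u"
      unfolding U_def by (blast intro: less_trans)
  qed
  moreover have "x \<in> U n" if "x \<in> steep g q" for x n
    using that by (simp add: steep_def U_def)
  ultimately have "steep g q = (\<Inter>n. U n)" by blast
  moreover have "open (U n)" for n unfolding U_def
    by (intro open_Collect_ex open_Collect_conj open_Collect_less open_Collect_const continuous_intros)
  ultimately show ?thesis by auto
qed

text \<open>The short intervals of slope above \<open>q\<close> around points of \<open>E\<close>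
  that lie inside a member of \<open>\<W>\<close> cover \<open>E\<close> in the sense of Vitali; the
  countable disjoint subfamily is cut down to a finite one by continuity of measure from above. The
  open sets \<open>\<W>\<close> confine the intervals to a prescribed region.\<close>

lemma steep_Vitali:
  assumes E: "E \<in> lmeasurable" "E \<subseteq> steep g q" "E \<subseteq> \<Union>\<W>" "\<And>W. W \<in> \<W> \<Longrightarrow> open W" and "\<eta> > 0"
  obtains d where "d division_of \<Union>d" "pairwise disjnt d" "\<And>K. K \<in> d \<Longrightarrow> \<exists>W\<in>\<W>. K \<subseteq> W"
    "\<And>K. K \<in> d \<Longrightarrow> Inf K < Sup K \<and> q * (Sup K - Inf K) < incr g K"
    "\<mu> (E - \<Union>d) < \<eta>"
proof -
  define I where "I = {(u,v). u < v \<and> (\<exists>W\<in>\<W>. {u..v} \<subseteq> W) \<and> q * (v - u) < g v - g u}"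
  \<comment> \<open>The covering theorem is about balls, so an interval is recorded by its endpoints
    and turned into a ball by midpoint and half-length.\<close>
  define c where "c = (\<lambda>(u,v). (u+v)/2 :: real)"
  define \<rho> where "\<rho> = (\<lambda>(u,v). (v-u)/2 :: real)"
  have cb: "cball (c i) (\<rho> i) = {fst i..snd i}" for i
    by (auto simp: c_def \<rho>_def cball_eq_atLeastAtMost split: prod.split) (auto simp: field_simps)
  have "\<exists>i. i \<in> I \<and> x \<in> cball (c i) (\<rho> i) \<and> \<rho> i < \<epsilon>" if "x \<in> E" "\<epsilon> > 0" for x \<epsilon>
  proof -
    obtain W where W: "W \<in> \<W>" "x \<in> W" using \<open>x \<in> E\<close> E(3) by blast
    then obtain s where s: "s > 0" "ball x s \<subseteq> W" using E(4) openE by blast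
    have "x \<in> steep g q" "min s \<epsilon> > 0" using that E s by auto
    then obtain u v where uv: "u < x" "x < v" "v - u < min s \<epsilon>" "q * (v - u) < g v - g u"
      unfolding steep_def by blast
    have "{u..v} \<subseteq> ball x s" using uv by (auto simp: dist_real_def)
    then have "(u,v) \<in> I" using uv s W(1) by (auto simp: I_def)
    moreover have "x \<in> cball (c (u,v)) (\<rho> (u,v))" using uv unfolding cb by auto
    moreover have "\<rho> (u,v) < \<epsilon>" using uv by (auto simp: \<rho>_def)
    ultimately show ?thesis by blast
  qed
  note cov = this
  have pos: "\<And>i. i \<in> I \<Longrightarrow> 0 < \<rho> i" by (auto simp: I_def \<rho>_def)
  obtain C where C: "countable C" "C \<subseteq> I"
     "pairwise (\<lambda>i j. disjnt (cball (c i) (\<rho> i)) (cball (c j) (\<rho> j))) C"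
     "negligible(E - (\<Union>i \<in> C. cball (c i) (\<rho> i)))"
    by (rule Vitali_covering_theorem_cballs[OF pos cov])
  define Cn where "Cn n = {i\<in>C. to_nat_on C i < n}" for n
  define D where "D n = (\<lambda>i. {fst i..snd i}) ` Cn n" for n
  have finC: "finite (Cn n)" for n
  proof -
    have "finite (to_nat_on C ` Cn n)" by (rule finite_subset[of _ "{..<n}"]) (auto simp: Cn_def)
    moreover have "inj_on (to_nat_on C) (Cn n)"
      using inj_on_to_nat_on[OF C(1)] by (rule inj_on_subset) (auto simp: Cn_def)
    ultimately show ?thesis using finite_imageD by blast
  qed
  have Em: "E \<in> sets lebesgue" using E by auto
  have UD: "\<Union>(D n) \<in> sets lebesgue" for n
    unfolding D_def using finC by (intro sets.finite_Union) auto
  have lim: "(\<lambda>n. emeasure lebesgue (E - \<Union>(D n))) \<longlonglongrightarrow> emeasure lebesgue (\<Inter>n. E - \<Union>(D n))"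
  proof (rule Lim_emeasure_decseq)
    show "range (\<lambda>n. E - \<Union>(D n)) \<subseteq> sets lebesgue" using Em UD by auto
    show "decseq (\<lambda>n. E - \<Union>(D n))"
      by (auto simp: decseq_def D_def Cn_def)
    fix n show "emeasure lebesgue (E - \<Union>(D n)) \<noteq> \<infinity>"
      using fmeasurable_Diff[OF E(1) UD[of n]] by (auto simp: fmeasurable_def)
  qed
  have "(\<Inter>n. E - \<Union>(D n)) \<subseteq> E - (\<Union>i \<in> C. cball (c i) (\<rho> i))"
  proof
    fix x assume x: "x \<in> (\<Inter>n. E - \<Union>(D n))"
    have "x \<notin> cball (c i) (\<rho> i)" if "i \<in> C" for i
    proof -
      have "i \<in> Cn (Suc (to_nat_on C i))" using that by (auto simp: Cn_def)
      moreover have "x \<notin> \<Union>(D (Suc (to_nat_on C i)))" using x by blast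
      ultimately show ?thesis unfolding D_def cb by blast
    qed
    then show "x \<in> E - (\<Union>i \<in> C. cball (c i) (\<rho> i))" using x by auto
  qed
  then have "negligible (\<Inter>n. E - \<Union>(D n))" using C(4) negligible_subset by blast
  then have "emeasure lebesgue (\<Inter>n. E - \<Union>(D n)) = 0"
    using negligible_iff_emeasure0 negligible_imp_sets by blast
  with lim have "(\<lambda>n. emeasure lebesgue (E - \<Union>(D n))) \<longlonglongrightarrow> 0" by simp
  then have "\<forall>\<^sub>F n in sequentially. emeasure lebesgue (E - \<Union>(D n)) < ennreal \<eta>"
    by (rule order_tendstoD) (use \<open>\<eta> > 0\<close> in auto)
  then obtain n where n: "emeasure lebesgue (E - \<Union>(D n)) < ennreal \<eta>"
    by (meson eventually_sequentially order_refl)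
  have CI: "fst i < snd i" "\<exists>W\<in>\<W>. {fst i..snd i} \<subseteq> W" "q * (snd i - fst i) < g (snd i) - g (fst i)"
    if "i \<in> Cn n" for i
    using that C(2) by (auto simp: Cn_def I_def subset_iff split_beta)
  have pw: "pairwise disjnt (D n)"
  proof (rule pairwiseI)
    fix K L assume "K \<in> D n" "L \<in> D n" and ne: "K \<noteq> L"
    then obtain i j where ij: "i \<in> C" "j \<in> C" "K = {fst i..snd i}" "L = {fst j..snd j}"
      by (auto simp: D_def Cn_def)
    with ne have "i \<noteq> j" by auto
    with C(3) ij show "disjnt K L" unfolding cb pairwise_def by blast
  qed
  show thesis
  proof
    show "pairwise disjnt (D n)" by fact
    show "D n division_of \<Union>(D n)"
    proof (rule division_ofI)
      show "finite (D n)" using finC by (auto simp: D_def)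
      fix K assume K: "K \<in> D n"
      then show "K \<noteq> {}" "\<exists>a b. K = cbox a b" using CI by (auto simp: D_def less_imp_le)
      show "K \<subseteq> \<Union> (D n)" using K by auto
      fix K' assume "K' \<in> D n" "K \<noteq> K'"
      then have "K \<inter> K' = {}" using pw K by (auto simp: pairwise_def disjnt_def)
      then show "interior K \<inter> interior K' = {}" using interior_subset by blast
    qed auto
    show "\<exists>W\<in>\<W>. K \<subseteq> W" if "K \<in> D n" for K using that CI(2) by (auto simp: D_def)
    show "Inf K < Sup K \<and> q * (Sup K - Inf K) < incr g K" if "K \<in> D n" for K
      using that CI by (auto simp: D_def less_imp_le)
    have "E - \<Union>(D n) \<in> lmeasurable" using E(1) UD by (rule fmeasurable_Diff)
    then show "\<mu> (E - \<Union>(D n)) < \<eta>"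
      using n by (simp add: emeasure_eq_measure2 \<open>\<eta> > 0\<close> ennreal_less_iff)
  qed
qed

lemma division_length:
  assumes "d division_of \<Union>d"
  shows "\<Union>d \<in> lmeasurable" "\<mu> (\<Union>d) = (\<Sum>K\<in>d. Sup K - Inf K :: real)"
proof -
  have K: "\<exists>u v. K = cbox u v \<and> u \<le> v" if Kd: "K \<in> d" for K
  proof -
    obtain u v where "K = cbox u v" "K \<noteq> {}" using division_ofD(3,4)[OF assms Kd] by blast
    then show ?thesis by (intro exI[of _ u] exI[of _ v]) auto
  qed
  have fin: "finite d" using assms by auto
  have lm: "K \<in> lmeasurable" if "K \<in> d" for K using K[OF that] by force
  show "\<Union>d \<in> lmeasurable" using fin lm by (intro fmeasurable.finite_Union) auto
  have "pairwise (\<lambda>S T. negligible (S \<inter> T)) d"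
  proof (rule pairwiseI)
    fix S T assume ST: "S \<in> d" "T \<in> d" "S \<noteq> T"
    have "convex (S \<inter> T)" using K[OF ST(1)] K[OF ST(2)] by (auto intro: convex_Int)
    moreover have "interior (S \<inter> T) = {}" using division_ofD(5)[OF assms ST] by simp
    ultimately show "negligible (S \<inter> T)" using negligible_convex_interior by blast
  qed
  then have "\<mu> (\<Union>d) = (\<Sum>K\<in>d. \<mu> K)"
    using fin lm by (intro measure_negligible_finite_Union) auto
  also have "\<dots> = (\<Sum>K\<in>d. Sup K - Inf K)"
  proof (rule sum.cong)
    fix L assume "L \<in> d"
    from K[OF this] show "\<mu> L = Sup L - Inf L" by auto
  qed simp
  finally show "\<mu> (\<Union>d) = (\<Sum>K\<in>d. Sup K - Inf K)" .
qed

abbreviation real_ac_on :: "real set \<Rightarrow> (real \<Rightarrow> real) \<Rightarrow> bool" where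
  "real_ac_on S g \<equiv> absolutely_continuous_on S (\<lambda>x. complex_of_real (g x))"

lemma absolutely_continuous_on_dominated:
  assumes "absolutely_continuous_on S f" "\<And>s t. norm (h s - h t) \<le> norm (f s - f t)"
  shows "absolutely_continuous_on S h"
proof -
  have "(\<Sum>K\<in>d. norm (incr h K)) \<le> (\<Sum>K\<in>d. norm (incr f K))" for d
    by (rule sum_mono) (rule assms(2))
  then show ?thesis
    using assms(1) unfolding absolutely_continuous_on_def by (meson le_less_trans)
qed

lemma real_ac_onE:
  assumes "real_ac_on S g" "\<epsilon> > 0"
  obtains \<delta> where "\<delta> > 0"
    "\<And>d. d division_of \<Union>d \<Longrightarrow> \<Union>d \<subseteq> S \<Longrightarrow> (\<Sum>K\<in>d. Sup K - Inf K) < \<delta> \<Longrightarrow>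
       \<bar>\<Sum>K\<in>d. incr g K\<bar> < \<epsilon>"
proof -
  obtain \<delta> where \<delta>: "\<delta> > 0" "\<And>d t. d division_of t \<and> t \<subseteq> S \<and> (\<Sum>K\<in>d. Sup K - Inf K) < \<delta>
        \<longrightarrow> (\<Sum>K\<in>d. norm (complex_of_real (g (Sup K)) - complex_of_real (g (Inf K)))) < \<epsilon>"
    using assms unfolding absolutely_continuous_on_def by meson
  show thesis
  proof (rule that[OF \<delta>(1)])
    fix d assume "d division_of \<Union>d" "\<Union>d \<subseteq> S" "(\<Sum>K\<in>d. Sup K - Inf K) < \<delta>"
    then have "(\<Sum>K\<in>d. \<bar>incr g K\<bar>) < \<epsilon>"
      using \<delta>(2)[of d "\<Union>d"] by (simp flip: of_real_diff)
    then show "\<bar>\<Sum>K\<in>d. incr g K\<bar> < \<epsilon>"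
      using sum_abs[of "\<lambda>K. incr g K" d] by linarith
  qed
qed

text \<open>If the part of the set in a small ball had measure m > 0, intervals of slope above n >
  2/m would cover more than half of it, so their increments would add up to more than 1, which
  absolute continuity forbids for short families. The small ball keeps the families short, and
  negligibility is a local property.\<close>

lemma steep_infinite_negligible:
  assumes ac: "real_ac_on {a..b} g"
  shows "negligible ({a<..<b} \<inter> (\<Inter>n::nat. steep g (real n)))" (is "negligible ?E")
proof -
  obtain \<delta> where \<delta>: "\<delta> > 0"
    "\<And>d. d division_of \<Union>d \<Longrightarrow> \<Union>d \<subseteq> {a..b} \<Longrightarrow> (\<Sum>K\<in>d. Sup K - Inf K) < \<delta> \<Longrightarrow>
       \<bar>\<Sum>K\<in>d. incr g K\<bar> < 1"
    using real_ac_onE[OF ac zero_less_one] by blast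
  \<comment> \<open>Non-overlapping intervals inside a ball of radius \<open>\<delta>/4\<close> have
    total length at most \<open>\<delta>/2\<close>, whatever their number.\<close>
  have neg: "negligible (?E \<inter> ball c (\<delta>/4))" (is "negligible ?F") for c
  proof (rule ccontr)
    assume nn: "\<not> negligible ?F"
    define F where "F = ?F"
    have Flm: "F \<in> lmeasurable"
    proof (rule bounded_set_imp_lmeasurable)
      show "bounded F" unfolding F_def by (rule bounded_Int) (auto intro!: bounded_Int)
      show "F \<in> sets lebesgue" unfolding F_def by (intro sets_completionI_sets) measurable
    qed
    define m where "m = \<mu> F"
    have m: "m > 0"
      using nn Flm negligible_iff_measure0[OF Flm] unfolding m_def F_def
      by (metis less_eq_real_def measure_nonneg)
    obtain n :: nat where n: "real n > 2 / m" using reals_Archimedean2 by blast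
    have *: "F \<subseteq> steep g n" "F \<subseteq> \<Union>{{a<..<b} \<inter> ball c (\<delta>/4)}" by (auto simp: F_def)
    obtain d where d: "d division_of \<Union>d"
        "\<And>K. K \<in> d \<Longrightarrow> \<exists>W\<in>{{a<..<b} \<inter> ball c (\<delta>/4)}. K \<subseteq> W"
        "\<And>K. K \<in> d \<Longrightarrow> Inf K < Sup K \<and> real n * (Sup K - Inf K) < incr g K"
        "\<mu> (F - \<Union>d) < m / 2"
      by (rule steep_Vitali[OF Flm *, of "m/2"]) (use m in auto)
    have sub: "\<Union>d \<subseteq> {a<..<b} \<inter> ball c (\<delta>/4)" using d(2) by fast
    have "\<mu> (\<Union>d) \<le> \<mu> (ball c (\<delta>/4))"
      by (rule measure_mono_fmeasurable) (use sub division_length(1)[OF d(1)] in auto)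
    also have "ball c (\<delta>/4) = {c - \<delta>/4<..<c+\<delta>/4}" by (rule ball_eq_greaterThanLessThan)
    also have "\<mu> \<dots> = \<delta>/2" using \<delta>(1) by simp
    finally have len: "(\<Sum>K\<in>d. Sup K - Inf K) < \<delta>"
      using \<delta>(1) division_length(2)[OF d(1)] by simp
    have "\<Union>d \<subseteq> {a..b}" using sub by (auto simp: subset_iff)
    from \<delta>(2)[OF d(1) this len] have 1: "(\<Sum>K\<in>d. incr g K) < 1" by linarith
    have "real n * (\<Sum>K\<in>d. Sup K - Inf K) \<le> (\<Sum>K\<in>d. incr g K)"
      unfolding sum_distrib_left by (rule sum_mono) (use d(3) less_imp_le in blast)
    then have 2: "real n * \<mu> (\<Union>d) < 1"
      using 1 division_length(2)[OF d(1)] by simp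
    have "m \<le> \<mu> (F - \<Union>d) + \<mu> (\<Union>d)"
    proof -
      have "m \<le> \<mu> ((F - \<Union>d) \<union> \<Union>d)"
        unfolding m_def using Flm division_length(1)[OF d(1)]
        by (intro measure_mono_fmeasurable fmeasurable.Un fmeasurable_Diff) auto
      also have "\<dots> \<le> \<mu> (F - \<Union>d) + \<mu> (\<Union>d)"
        by (rule measure_Un_le) (use Flm division_length(1)[OF d(1)] in \<open>auto intro!: sets.Diff\<close>)
      finally show ?thesis .
    qed
    then have "\<mu> (\<Union>d) > m / 2" using d(4) by linarith
    then have "real n * \<mu> (\<Union>d) \<ge> (2/m) * (m/2)"
      using n m by (intro mult_mono) auto
    with 2 m show False by simp
  qed
  show ?thesis
  proof (subst locally_negligible_alt, intro ballI)
    fix x assume x: "x \<in> ?E"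
    show "\<exists>U. openin (top_of_set ?E) U \<and> x \<in> U \<and> negligible U"
      using x neg[of x] \<delta>(1)
      by (intro exI[of _ "?E \<inter> ball x (\<delta>/4)"]) auto
  qed
qed

text \<open>Cover the set by intervals of slope \<open>< p\<close>, and then inside these by intervals of slope
  \<open>> q\<close>. The gaps between the two Vitali families are short, so by absolute continuity the
  increments over the families almost agree, which forces both to have small total length.\<close>
lemma steep_cross_negligible:
  assumes ac: "real_ac_on {a..b} g" and pq: "p < q"
  shows "negligible ({a<..<b} \<inter> steep g q \<inter> steep (\<lambda>x. - g x) (- p))"
proof (rule ccontr)
  define E where "E = {a<..<b} \<inter> steep g q \<inter> steep (\<lambda>x. - g x) (- p)"
  assume "\<not> negligible ({a<..<b} \<inter> steep g q \<inter> steep (\<lambda>x. - g x) (- p))"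
  then have nn: "\<not> negligible E" by (simp add: E_def)
  have Elm: "E \<in> lmeasurable"
  proof (rule bounded_set_imp_lmeasurable)
    show "bounded E" unfolding E_def by (auto intro!: bounded_Int)
    show "E \<in> sets lebesgue" unfolding E_def by (intro sets_completionI_sets) measurable
  qed
  define m where "m = \<mu> E"
  have m: "m > 0"
    using nn Elm negligible_iff_measure0[OF Elm] unfolding m_def
    by (metis less_eq_real_def measure_nonneg)
  \<comment> \<open>The contradiction at the end reads 3/4 < 1/4 + 1/4 in units of
    \<open>(q - p) * m\<close>: the total length \<open>J\<close> of the second family exceeds
    \<open>3 * m / 4\<close>, one quarter is \<open>\<eta>\<close>, and the other bounds
    \<open>2 * \<bar>p\<bar> * \<sigma>\<close>.\<close>
  define \<eta> where "\<eta> = (q - p) * m / 4"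
  have "\<eta> > 0" using m pq by (simp add: \<eta>_def)
  from real_ac_onE[OF ac this] obtain \<delta> where \<delta>: "\<delta> > 0"
    "\<And>d. d division_of \<Union>d \<Longrightarrow> \<Union>d \<subseteq> {a..b} \<Longrightarrow> (\<Sum>K\<in>d. Sup K - Inf K) < \<delta> \<Longrightarrow>
       \<bar>\<Sum>K\<in>d. incr g K\<bar> < \<eta>" by blast
  \<comment> \<open>The three bounds serve, in order, to make the gaps \<open>r\<close> short enough
    for \<open>\<delta>\<close>, to make \<open>J\<close> exceed \<open>3 * m / 4\<close>, and to
    control \<open>p\<close> times the length of the gaps; \<open>+ 1\<close> allows
    \<open>p = 0\<close>.\<close>
  define \<sigma> where "\<sigma> = min (\<delta>/2) (min (m/8) ((q-p) * m / (8 * (\<bar>p\<bar> + 1))))"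
  have \<sigma>: "\<sigma> > 0" "2 * \<sigma> \<le> \<delta>" "\<sigma> \<le> m/8" "\<bar>p\<bar> * \<sigma> \<le> (q-p) * m / 8"
  proof -
    show "\<sigma> > 0" "2 * \<sigma> \<le> \<delta>" "\<sigma> \<le> m/8" using \<delta>(1) m pq unfolding \<sigma>_def by (simp, linarith, linarith)
    then have "\<bar>p\<bar> * \<sigma> \<le> (\<bar>p\<bar> + 1) * \<sigma>" by simp
    also have "\<dots> \<le> (\<bar>p\<bar> + 1) * ((q-p) * m / (8 * (\<bar>p\<bar> + 1)))"
      by (intro mult_left_mono) (auto simp: \<sigma>_def)
    also have "\<dots> = (q-p) * m / 8" by (simp add: field_simps)
    finally show "\<bar>p\<bar> * \<sigma> \<le> (q-p) * m / 8" .
  qed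
  have "E \<in> sets lebesgue" using Elm by auto
  from sets_lebesgue_outer_open[OF this \<sigma>(1)] obtain T where T: "open T" "E \<subseteq> T"
    "T - E \<in> lmeasurable" "emeasure lebesgue (T - E) < ennreal \<sigma>" by blast
  have TE: "\<mu> (T - E) < \<sigma>"
    using T(3,4) \<sigma>(1) by (simp add: emeasure_eq_measure2 ennreal_less_iff)
  have *: "E \<subseteq> steep (\<lambda>x. - g x) (- p)" "E \<subseteq> \<Union>{T \<inter> {a<..<b}}" using T by (auto simp: E_def)
  obtain d where d: "d division_of \<Union>d" "pairwise disjnt d"
      "\<And>K. K \<in> d \<Longrightarrow> \<exists>W\<in>{T \<inter> {a<..<b}}. K \<subseteq> W"
      "\<And>K. K \<in> d \<Longrightarrow> Inf K < Sup K \<and> (-p) * (Sup K - Inf K) < (- g (Sup K)) - (- g (Inf K))"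
      "\<mu> (E - \<Union>d) < \<sigma>"
    by (rule steep_Vitali[OF Elm *, of \<sigma>]) (use T \<sigma> in auto)
  have dsub: "\<Union>d \<subseteq> T \<inter> {a<..<b}" using d(3) by fast
  \<comment> \<open>The second covering needs open sets to live in, so only the interiors of the
    intervals in \<open>d\<close> are used; the discarded endpoints form a negligible set.\<close>
  define E' where "E' = E \<inter> \<Union>(interior ` d)"
  have E'lm: "E' \<in> lmeasurable" unfolding E'_def
  proof (rule fmeasurable_Int_fmeasurable[OF Elm])
    have "open (\<Union>(interior ` d))" by auto
    then show "\<Union>(interior ` d) \<in> sets lebesgue" by (intro sets_completionI_sets) simp
  qed
  have **: "E' \<subseteq> steep g q" "E' \<subseteq> \<Union>(interior ` d)" by (auto simp: E'_def E_def)
  obtain e where e: "e division_of \<Union>e"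
      "\<And>K. K \<in> e \<Longrightarrow> \<exists>W\<in>interior ` d. K \<subseteq> W"
      "\<And>K. K \<in> e \<Longrightarrow> Inf K < Sup K \<and> q * (Sup K - Inf K) < incr g K"
      "\<mu> (E' - \<Union>e) < \<sigma>"
    by (rule steep_Vitali[OF E'lm **, of \<sigma>]) (use \<sigma> in auto)
  have "\<exists>K\<in>d. L \<subseteq> K" if "L \<in> e" for L
    using e(2)[OF that] interior_subset by blast
  from division_difference[OF d(1,2) e(1) this] obtain r where r: "r division_of \<Union>r" "\<Union>r \<subseteq> \<Union>d"
    "\<And>g::real \<Rightarrow> real. (\<Sum>K\<in>r. incr g K) =
       (\<Sum>K\<in>d. incr g K) - (\<Sum>K\<in>e. incr g K)" by blast
  note dm = division_length[OF d(1)] and em = division_length[OF e(1)]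
  define I where "I = \<mu> (\<Union>d)"
  define J where "J = \<mu> (\<Union>e)"
  have neg: "negligible (E \<inter> \<Union>d - E')"
  proof (rule negligible_subset)
    show "negligible (\<Union>K\<in>d. K - interior K)"
    proof (rule negligible_Union)
      show "finite ((\<lambda>K. K - interior K) ` d)" using d by auto
      fix L assume "L \<in> (\<lambda>K. K - interior K) ` d"
      then obtain K where K: "K \<in> d" "L = K - interior K" by auto
      then obtain u v where "K = cbox u v" using division_ofD(4)[OF d(1)] by blast
      then show "negligible L" using K negligible_frontier_interval[of u v] by (simp only: interior_cbox)
    qed
  qed (auto simp: E'_def)
  have em': "\<Union>e \<in> lmeasurable" "\<Union>d \<in> lmeasurable" using em dm by auto
  have meas: "E \<inter> \<Union>d - E' \<in> lmeasurable" "E' - \<Union>e \<in> lmeasurable" "E - \<Union>d \<in> lmeasurable"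
      "E \<inter> \<Union>d \<in> lmeasurable"
    using Elm E'lm em' by (auto intro!: fmeasurable_Diff fmeasurable.Int)
  note meas = meas T(3) em' Elm E'lm meas[THEN fmeasurableD] T(3)[THEN fmeasurableD]
    em'[THEN fmeasurableD] Elm[THEN fmeasurableD] E'lm[THEN fmeasurableD]
  have m0: "\<mu> (E \<inter> \<Union>d - E') = 0" using neg negligible_imp_measure0 by blast
  have subadd: "\<mu> X \<le> \<mu> A + \<mu> B"
    if "X \<subseteq> A \<union> B" "X \<in> sets lebesgue" "A \<in> lmeasurable" "B \<in> lmeasurable" for X A B
  proof -
    have "\<mu> X \<le> \<mu> (A \<union> B)"
      by (rule measure_mono_fmeasurable) (use that in \<open>auto intro: fmeasurable.Un\<close>)
    also have "\<dots> \<le> \<mu> A + \<mu> B"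
      by (rule measure_Un_le) (use that in auto)
    finally show ?thesis .
  qed
  have EI: "\<mu> (E \<inter> \<Union>d) \<le> \<sigma> + J"
  proof -
    have "\<mu> (E \<inter> \<Union>d) \<le> \<mu> (E \<inter> \<Union>d - E') + \<mu> E'"
      by (rule subadd) (use meas in auto)
    also have "\<mu> E' \<le> \<mu> (E' - \<Union>e) + J"
      unfolding J_def by (rule subadd) (use meas in auto)
    finally show ?thesis using m0 e(4) by linarith
  qed
  have 1: "I < 2 * \<sigma> + J"
  proof -
    have "I \<le> \<mu> (T - E) + \<mu> (E \<inter> \<Union>d)"
      unfolding I_def by (rule subadd) (use meas dsub in auto)
    then show "I < 2 * \<sigma> + J" using EI TE by linarith
  qed
  have 2: "m < 2 * \<sigma> + J"
  proof -
    have "m \<le> \<mu> (E - \<Union>d) + \<mu> (E \<inter> \<Union>d)"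
      unfolding m_def by (rule subadd) (use meas in auto)
    then show ?thesis using EI d(5) by linarith
  qed
  have len: "(\<Sum>K\<in>r. Sup K - Inf K) = I - J"
    using r(3)[of "\<lambda>x. x"] dm em by (simp add: I_def J_def)
  have IJ: "J \<le> I" using len division_length(2)[OF r(1)] measure_nonneg[of lebesgue "\<Union>r"] by simp
  have "{a<..<b} \<subseteq> {a..b}" by auto
  then have "\<Union>r \<subseteq> {a..b}" using r(2) dsub by blast
  moreover have "(\<Sum>K\<in>r. Sup K - Inf K) < \<delta>" using len 1 \<sigma> by linarith
  ultimately have "\<bar>\<Sum>K\<in>r. incr g K\<bar> < \<eta>" using \<delta>(2)[OF r(1)] by blast
  then have 3: "(\<Sum>K\<in>e. incr g K) - (\<Sum>K\<in>d. incr g K) < \<eta>"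
    unfolding r(3)[of g] by linarith
  have "(\<Sum>K\<in>d. incr g K) \<le> (\<Sum>K\<in>d. p * (Sup K - Inf K))"
    by (rule sum_mono) (use d(4) in fastforce)
  then have 4: "(\<Sum>K\<in>d. incr g K) \<le> p * I"
    by (simp add: I_def dm sum_distrib_left)
  have "(\<Sum>K\<in>e. q * (Sup K - Inf K)) \<le> (\<Sum>K\<in>e. incr g K)"
    by (rule sum_mono) (use e(3) less_imp_le in blast)
  then have 5: "q * J \<le> (\<Sum>K\<in>e. incr g K)"
    by (simp add: J_def em sum_distrib_left)
  have "p * (I - J) \<le> \<bar>p\<bar> * (I - J)" using IJ by (intro mult_right_mono) auto
  also have "\<dots> \<le> \<bar>p\<bar> * (2 * \<sigma>)" using 1 by (intro mult_left_mono) auto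
  finally have "p * (I - J) \<le> \<bar>p\<bar> * (2 * \<sigma>)" .
  then have 6: "(q - p) * J < \<eta> + 2 * (\<bar>p\<bar> * \<sigma>)"
    using 3 4 5 by (simp add: algebra_simps)
  have "(q - p) * (3 * m / 4) \<le> (q - p) * J"
    using pq 2 \<sigma>(3) by (intro mult_left_mono) auto
  with 6 \<sigma>(4) have "(q - p) * (3 * m / 4) < (q-p) * m / 4 + (q-p) * m / 4"
    unfolding \<eta>_def by linarith
  moreover have "(q - p) * m > 0" using pq m by simp
  moreover have "(q - p) * (3 * m / 4) = 3/4 * ((q - p) * m)" by simp
  ultimately show False by linarith
qed

section \<open>Derivates and the derivative at a point\<close>

lemma not_steepD:
  assumes "x \<notin> steep g q"
  obtains \<epsilon> where "\<epsilon> > 0" "\<And>u v. u < x \<Longrightarrow> x < v \<Longrightarrow> v - u < \<epsilon> \<Longrightarrow> g v - g u \<le> q * (v - u)"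
proof -
  from assms obtain \<epsilon> where "\<epsilon> > 0" "\<not> (\<exists>u v. u < x \<and> x < v \<and> v - u < \<epsilon> \<and> q * (v - u) < g v - g u)"
    unfolding steep_def by blast
  then show thesis using that[of \<epsilon>] not_less by blast
qed

lemma steep_antimono:
  assumes "p \<le> q" "x \<in> steep g q" shows "x \<in> steep g p"
  unfolding steep_def
proof clarsimp
  fix \<epsilon> :: real assume "\<epsilon> > 0"
  with assms(2) obtain u v where uv: "u < x" "x < v" "v - u < \<epsilon>" "q * (v - u) < g v - g u"
    unfolding steep_def by blast
  have "p * (v - u) \<le> q * (v - u)" using uv assms(1) by (intro mult_right_mono) auto
  with uv show "\<exists>u<x. \<exists>v>x. v - u < \<epsilon> \<and> p * (v - u) < g v - g u"
    by (meson le_less_trans)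
qed

text \<open>The two failures bound the slope over short intervals around \<open>x\<close> from above
  by \<open>q\<close> and from below by \<open>p\<close>; a symmetric interval meets both.\<close>

lemma steep_both_false:
  assumes "x \<notin> steep g q" "x \<notin> steep (\<lambda>x. - g x) (- p)" "q < p"
  shows False
proof -
  obtain \<epsilon>1 where 1: "\<epsilon>1 > 0" "\<And>u v. u < x \<Longrightarrow> x < v \<Longrightarrow> v - u < \<epsilon>1 \<Longrightarrow> g v - g u \<le> q * (v - u)"
    using not_steepD[OF assms(1)] by blast
  obtain \<epsilon>2 where 2: "\<epsilon>2 > 0" "\<And>u v. u < x \<Longrightarrow> x < v \<Longrightarrow> v - u < \<epsilon>2 \<Longrightarrow> - g v - - g u \<le> - p * (v - u)"
    using not_steepD[OF assms(2)] by blast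
  define h where "h = min \<epsilon>1 \<epsilon>2 / 3"
  have h: "h > 0" "2 * h < \<epsilon>1" "2 * h < \<epsilon>2" using 1 2 by (auto simp: h_def)
  have "g (x+h) - g (x-h) \<le> q * (2 * h)" using 1(2)[of "x-h" "x+h"] h by auto
  moreover have "p * (2 * h) \<le> g (x+h) - g (x-h)" using 2(2)[of "x-h" "x+h"] h by auto
  moreover have "q * (2*h) < p * (2*h)" using h assms(3) by simp
  ultimately show False by linarith
qed

text \<open>\<open>Q\<close> is the upper derivate at \<open>x\<close>. The bounds
  \<open>fin\<close> make it finite, and \<open>cross\<close> excludes a lower derivate below it;
  rational thresholds suffice because two rationals fit between any smaller number and
  \<open>Q\<close>, and they keep the exceptional set a countable union. Continuity turns intervals
  with \<open>x\<close> inside into intervals with an endpoint at \<open>x\<close>.\<close>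

lemma has_vector_derivative_of_not_steep:
  fixes g :: "real \<Rightarrow> real"
  assumes cont: "continuous_on UNIV g"
    and fin: "x \<notin> steep g (real N)" "x \<notin> steep (\<lambda>x. - g x) (real M)"
    and cross: "\<And>p q. p \<in> \<rat> \<Longrightarrow> q \<in> \<rat> \<Longrightarrow> p < q \<Longrightarrow> x \<notin> steep g q \<inter> steep (\<lambda>x. - g x) (- p)"
  shows "\<exists>Q. (g has_vector_derivative Q) (at x)"
proof -
  define S where "S = {q. x \<notin> steep g q}"
  define Q where "Q = Inf S"
  have S_ne: "real N \<in> S" using fin by (simp add: S_def)
  have S_bdd: "bdd_below S"
  proof (rule bdd_belowI[of _ "- real M"])
    fix q assume "q \<in> S"
    then show "- real M \<le> q"
      using steep_both_false[of x g q "- real M"] fin by (force simp: S_def)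
  qed
  have up: "x \<notin> steep g q" if "Q < q" for q
  proof -
    have "S \<noteq> {}" using S_ne by auto
    from cInf_less_iff[OF this S_bdd] that obtain q' where "q' \<in> S" "q' < q" by (auto simp: Q_def)
    then show ?thesis using steep_antimono[of q' q x g] by (auto simp: S_def)
  qed
  have lo: "x \<notin> steep (\<lambda>x. - g x) (- p)" if pQ: "p < Q" for p
  proof
    assume st: "x \<in> steep (\<lambda>x. - g x) (- p)"
    obtain p' where p': "p' \<in> \<rat>" "p < p'" "p' < Q" using Rats_dense_in_real[OF pQ] by auto
    obtain q' where q': "q' \<in> \<rat>" "p' < q'" "q' < Q" using Rats_dense_in_real[OF p'(3)] by auto
    have "q' \<notin> S" using q' cInf_lower[OF _ S_bdd, of q'] unfolding Q_def by linarith
    then have "x \<in> steep g q'" by (simp add: S_def)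
    moreover have "x \<in> steep (\<lambda>x. - g x) (- p')" using st p' by (intro steep_antimono[of "-p'" "-p"]) auto
    ultimately show False using cross[OF p'(1) q'(1)] q' by blast
  qed
  have "(g has_vector_derivative Q) (at x)"
    unfolding has_vector_derivative_def has_derivative_at_alt
  proof (intro conjI allI impI)
    show "bounded_linear (\<lambda>y. y *\<^sub>R Q)" by (rule bounded_linear_scaleR_left)
    fix e :: real assume e: "e > 0"
    obtain \<epsilon>1 where 1: "\<epsilon>1 > 0" "\<And>u v. u < x \<Longrightarrow> x < v \<Longrightarrow> v - u < \<epsilon>1 \<Longrightarrow> g v - g u \<le> (Q+e) * (v - u)"
      using not_steepD[OF up[of "Q+e"]] e by auto
    obtain \<epsilon>2 where 2: "\<epsilon>2 > 0" "\<And>u v. u < x \<Longrightarrow> x < v \<Longrightarrow> v - u < \<epsilon>2 \<Longrightarrow> - g v - - g u \<le> - (Q-e) * (v - u)"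
      using not_steepD[OF lo[of "Q-e"]] e by auto
    define d where "d = min \<epsilon>1 \<epsilon>2"
    have d: "d > 0" using 1 2 by (simp add: d_def)
    have bd: "\<bar>g v - g u - (v - u) * Q\<bar> \<le> e * (v - u)" if "u < x" "x < v" "v - u < d" for u v
      using 1(2)[of u v] 2(2)[of u v] that unfolding d_def by (auto simp: abs_le_iff algebra_simps)
    \<comment> \<open>The interval between \<open>x\<close> and \<open>y\<close> has
      \<open>x\<close> as an endpoint. It is widened by \<open>s\<close> on both sides, so that
      \<open>bd\<close> applies, and \<open>s\<close> tends to 0; \<open>max\<close> and
      \<open>min\<close> cover both positions of \<open>y\<close>.\<close>
    have lim: "\<bar>g (max x y) - g (min x y) - (max x y - min x y) * Q\<bar> \<le> e * (max x y - min x y)"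
      if "\<bar>y - x\<bar> < d" for y
    proof (rule tendsto_le[OF trivial_limit_at_right_real])
      have c: "isCont g z" for z using cont by (simp add: continuous_on_eq_continuous_at)
      have s0: "((\<lambda>s. s) \<longlongrightarrow> 0) (at_right (0::real))" by (rule tendsto_ident_at)
      have "((\<lambda>s. max x y + s) \<longlongrightarrow> max x y + 0) (at_right 0)" "((\<lambda>s. min x y - s) \<longlongrightarrow> min x y - 0) (at_right 0)"
        by (intro tendsto_intros s0)+
      then have l: "((\<lambda>s. max x y + s) \<longlongrightarrow> max x y) (at_right 0)" "((\<lambda>s. min x y - s) \<longlongrightarrow> min x y) (at_right 0)"
        by simp_all
      show "((\<lambda>s. e * ((max x y + s) - (min x y - s))) \<longlongrightarrow> e * (max x y - min x y)) (at_right 0)"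
        by (intro tendsto_intros l)
      show "((\<lambda>s. \<bar>g (max x y + s) - g (min x y - s) - ((max x y + s) - (min x y - s)) * Q\<bar>)
          \<longlongrightarrow> \<bar>g (max x y) - g (min x y) - (max x y - min x y) * Q\<bar>) (at_right 0)"
        by (intro tendsto_intros l isCont_tendsto_compose[OF c])
      have "\<forall>\<^sub>F s in at_right 0. s \<in> {0<..<(d - \<bar>y - x\<bar>) / 2}"
        using that by (intro eventually_at_right_real) simp
      then show "\<forall>\<^sub>F s in at_right 0. \<bar>g (max x y + s) - g (min x y - s) - ((max x y + s) - (min x y - s)) * Q\<bar>
          \<le> e * ((max x y + s) - (min x y - s))"
        by eventually_elim (intro bd, auto simp: max_def min_def abs_if field_simps split: if_splits)
    qed
    show "\<exists>d>0. \<forall>y. norm (y - x) < d \<longrightarrow> norm (g y - g x - (y - x) *\<^sub>R Q) \<le> e * norm (y - x)"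
    proof (intro exI conjI allI impI)
      fix y assume "norm (y - x) < d"
      with lim[of y] show "norm (g y - g x - (y - x) *\<^sub>R Q) \<le> e * norm (y - x)"
        by (cases "x \<le> y") (auto simp: max_def min_def abs_if algebra_simps split: if_splits)
    qed (rule d)
  qed
  then show ?thesis by blast
qed

lemma real_ac_differentiable_ae:
  fixes g :: "real \<Rightarrow> real"
  assumes ac: "real_ac_on {a..b} g" and cont: "continuous_on UNIV g"
  obtains N where "negligible N" "\<And>x. x \<in> {a<..<b} - N \<Longrightarrow> \<exists>Q. (g has_vector_derivative Q) (at x)"
proof -
  have ac': "real_ac_on {a..b} (\<lambda>x. - g x)"
    by (rule absolutely_continuous_on_dominated[OF ac]) (simp flip: of_real_diff)
  define N1 where "N1 = {a<..<b} \<inter> (\<Inter>n::nat. steep g (real n))"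
  define N2 where "N2 = {a<..<b} \<inter> (\<Inter>n::nat. steep (\<lambda>x. - g x) (real n))"
  define X where "X = (\<lambda>(p,q). {a<..<b} \<inter> steep g q \<inter> steep (\<lambda>x. - g x) (- p))"
  define N3 where "N3 = \<Union>(X ` {(p,q). p \<in> \<rat> \<and> q \<in> \<rat> \<and> p < q})"
  have "negligible N3" unfolding N3_def
  proof (rule negligible_countable_Union)
    have "countable {(p,q). p \<in> \<rat> \<and> q \<in> \<rat> \<and> p < (q::real)}"
      by (rule countable_subset[of _ "\<rat> \<times> \<rat>"]) (auto intro: countable_rat)
    then show "countable (X ` {(p,q). p \<in> \<rat> \<and> q \<in> \<rat> \<and> p < q})" by simp
    fix S assume "S \<in> X ` {(p,q). p \<in> \<rat> \<and> q \<in> \<rat> \<and> p < q}"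
    then show "negligible S" using steep_cross_negligible[OF ac] by (auto simp: X_def)
  qed
  moreover have "negligible N1" "negligible N2"
    using steep_infinite_negligible[OF ac] steep_infinite_negligible[OF ac'] by (auto simp: N1_def N2_def)
  ultimately have neg: "negligible (N1 \<union> N2 \<union> N3)" by simp
  show thesis
  proof (rule that[OF neg])
    fix x assume x: "x \<in> {a<..<b} - (N1 \<union> N2 \<union> N3)"
    then obtain n m where "x \<notin> steep g (real n)" "x \<notin> steep (\<lambda>x. - g x) (real m)"
      by (auto simp: N1_def N2_def)
    then show "\<exists>Q. (g has_vector_derivative Q) (at x)"
      by (rule has_vector_derivative_of_not_steep[OF cont])
        (use x in \<open>auto simp: N3_def X_def\<close>)
  qed
qed

lemma absolutely_continuous_on_differentiable_ae:
  assumes ac: "absolutely_continuous_on {a..b} f" and cont: "continuous_on UNIV f"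
  obtains N where "negligible N" "\<And>x. x \<in> {a<..<b} - N \<Longrightarrow> f differentiable (at x)"
proof -
  have acR: "real_ac_on {a..b} (\<lambda>x. Re (f x))" and acI: "real_ac_on {a..b} (\<lambda>x. Im (f x))"
    using abs_Re_le_cmod[of "f _ - f _"] abs_Im_le_cmod[of "f _ - f _"]
    by (auto intro!: absolutely_continuous_on_dominated[OF ac] simp flip: of_real_diff)
  obtain N1 where N1: "negligible N1" "\<And>x. x \<in> {a<..<b} - N1 \<Longrightarrow> \<exists>Q. ((\<lambda>x. Re (f x)) has_vector_derivative Q) (at x)"
    by (rule real_ac_differentiable_ae[OF acR continuous_on_Re[OF cont]]) blast
  obtain N2 where N2: "negligible N2" "\<And>x. x \<in> {a<..<b} - N2 \<Longrightarrow> \<exists>Q. ((\<lambda>x. Im (f x)) has_vector_derivative Q) (at x)"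
    by (rule real_ac_differentiable_ae[OF acI continuous_on_Im[OF cont]]) blast
  show thesis
  proof (rule that[of "N1 \<union> N2"])
    show "negligible (N1 \<union> N2)" using N1 N2 by simp
    fix x assume x: "x \<in> {a<..<b} - (N1 \<union> N2)"
    obtain P where P: "((\<lambda>x. Re (f x)) has_vector_derivative P) (at x)" using N1 x by blast
    obtain Q where Q: "((\<lambda>x. Im (f x)) has_vector_derivative Q) (at x)" using N2 x by blast
    have "((\<lambda>x. complex_of_real (Re (f x)) + \<i> * complex_of_real (Im (f x))) has_vector_derivative
             (of_real P + \<i> * of_real Q)) (at x)"
      by (intro has_vector_derivative_add has_vector_derivative_mult_right has_vector_derivative_of_real P[unfolded has_real_derivative_iff_has_vector_derivative[symmetric]] Q[unfolded has_real_derivative_iff_has_vector_derivative[symmetric]])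
    then have "(f has_vector_derivative (of_real P + \<i> * of_real Q)) (at x)"
      by (simp flip: complex_eq)
    then show "f differentiable (at x)" by (rule differentiableI_vector)
  qed
qed

text \<open>A mean value inequality with an exceptional null set \<open>N\<close>, proved by a gauge
  instead of integrating the derivative. At a tag outside \<open>N\<close> the derivative bounds the
  increment by \<open>M + \<epsilon>\<close> times the length; intervals tagged in \<open>N\<close>
  are trapped in an open set of measure below \<open>\<delta>\<close>, so absolute continuity makes
  their increments sum to less than \<open>e / 2\<close>.\<close>

lemma absolutely_continuous_on_increment_bound:
  assumes ac: "absolutely_continuous_on {a..b} f" and cont: "continuous_on UNIV f"
    and ae: "AE s in lebesgue. s \<in> {a<..<b} \<longrightarrow> norm (vector_derivative f (at s)) \<le> M"
    and ab: "a \<le> b" and M: "M \<ge> 0"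
  shows "norm (f b - f a) \<le> M * (b - a)"
proof (rule field_le_epsilon)
  fix e :: real assume e: "e > 0"
  obtain N1 where N1: "negligible N1" "\<And>x. x \<in> {a<..<b} - N1 \<Longrightarrow> f differentiable (at x)"
    by (rule absolutely_continuous_on_differentiable_ae[OF ac cont]) blast
  obtain N2 where N2: "N2 \<in> null_sets lebesgue" "{s \<in> space lebesgue. \<not> (s \<in> {a<..<b} \<longrightarrow> norm (vector_derivative f (at s)) \<le> M)} \<subseteq> N2"
    using ae by (auto elim!: AE_E2 simp: eventually_ae_filter)
  \<comment> \<open>The derivative is controlled only in the open interval, so the endpoints are
    counted as exceptional.\<close>
  define N where "N = N1 \<union> N2 \<union> {a,b}"
  have negN: "negligible N"
    using N1 N2 by (auto simp: N_def negligible_iff_null_sets)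
  have good: "(f has_vector_derivative vector_derivative f (at x)) (at x)" "norm (vector_derivative f (at x)) \<le> M"
    if "x \<in> {a..b} - N" for x
  proof -
    have "x \<in> {a<..<b}" "x \<notin> N1" "x \<notin> N2" using that by (auto simp: N_def)
    then show "(f has_vector_derivative vector_derivative f (at x)) (at x)" "norm (vector_derivative f (at x)) \<le> M"
      using N1(2)[of x] N2(2) by (auto simp: vector_derivative_works)
  qed
  define \<epsilon> where "\<epsilon> = e / (2 * (b - a + 1))"
  have \<epsilon>: "\<epsilon> > 0" "\<epsilon> * (b - a) \<le> e / 2"
    using e ab by (auto simp: \<epsilon>_def field_simps)
  obtain \<delta> where \<delta>: "\<delta> > 0" "\<And>d t. d division_of t \<and> t \<subseteq> {a..b} \<and> (\<Sum>K\<in>d. Sup K - Inf K) < \<delta>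
        \<Longrightarrow> (\<Sum>K\<in>d. norm (incr f K)) < e / 2"
    using ac e unfolding absolutely_continuous_on_def by (metis half_gt_zero)
  obtain U where U: "open U" "N \<subseteq> U" "U - N \<in> lmeasurable" "emeasure lebesgue (U - N) < ennreal \<delta>"
    using sets_lebesgue_outer_open[OF negligible_imp_sets[OF negN] \<delta>(1)] by blast
  have Ulm: "U \<in> lmeasurable" "\<mu> U < \<delta>"
  proof -
    have Neq: "N \<in> lmeasurable" "\<mu> N = 0"
      using negN negligible_imp_measurable negligible_imp_measure0 by blast+
    have Ueq: "U = (U - N) \<union> N" using U by auto
    show "U \<in> lmeasurable" by (subst Ueq) (intro fmeasurable.Un U Neq)
    have "\<mu> U \<le> \<mu> (U - N) + \<mu> N"
      by (subst Ueq, rule measure_Un_le) (use U Neq in auto)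
    also have "\<dots> < \<delta>" using U(3,4) \<delta>(1) Neq by (simp add: emeasure_eq_measure2 ennreal_less_iff)
    finally show "\<mu> U < \<delta>" .
  qed
  have "\<exists>\<rho>>0. if x \<in> N then ball x \<rho> \<subseteq> U
      else x \<in> {a..b} \<longrightarrow> (\<forall>y. norm (y - x) < \<rho> \<longrightarrow> norm (f y - f x - (y - x) *\<^sub>R vector_derivative f (at x)) \<le> \<epsilon> * norm (y - x))" for x
  proof (cases "x \<in> N")
    case True
    then show ?thesis using U openE by (metis subsetD)
  next
    case False
    show ?thesis
    proof (cases "x \<in> {a..b}")
      case True
      from good(1)[of x] False True \<epsilon>(1) show ?thesis
        unfolding has_vector_derivative_def has_derivative_at_alt by simp
    qed (use False in \<open>auto intro: exI[of _ 1]\<close>)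
  qed
  then obtain \<rho> where \<rho>: "\<And>x. \<rho> x > 0" "\<And>x. if x \<in> N then ball x (\<rho> x) \<subseteq> U
      else x \<in> {a..b} \<longrightarrow> (\<forall>y. norm (y - x) < \<rho> x \<longrightarrow> norm (f y - f x - (y - x) *\<^sub>R vector_derivative f (at x)) \<le> \<epsilon> * norm (y - x))"
    by metis
  have "gauge (\<lambda>x. ball x (\<rho> x))" using \<rho>(1) by (rule gauge_ball_dependent[rule_format])
  then obtain p where p: "p tagged_division_of {a..b}" "(\<lambda>x. ball x (\<rho> x)) fine p"
    using fine_division_exists_real by blast
  have pK: "\<exists>u v. K = {u..v} \<and> u \<le> x \<and> x \<le> v \<and> {u..v} \<subseteq> ball x (\<rho> x) \<and> {u..v} \<subseteq> {a..b}" if xK: "(x,K) \<in> p" for x K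
  proof -
    obtain u v where "K = cbox u v" using tagged_division_ofD(4)[OF p(1) xK] by blast
    then show ?thesis
      using tagged_division_ofD(2,3)[OF p(1) xK] p(2) xK
      by (intro exI[of _ u] exI[of _ v]) (auto simp: fine_def)
  qed
  have finp: "finite p" using p(1) by blast
  define p1 where "p1 = {(x,K) \<in> p. x \<in> N}"
  define p2 where "p2 = {(x,K) \<in> p. x \<notin> N}"
  have pun: "p = p1 \<union> p2" "p1 \<inter> p2 = {}" by (auto simp: p1_def p2_def)
  have fin12: "finite p1" "finite p2" using finp pun by auto
  have "f b - f a = (\<Sum>(x,K)\<in>p. incr f K)"
    by (rule additive_tagged_division_1[OF ab p(1), symmetric])
  also have "\<dots> = (\<Sum>(x,K)\<in>p1. incr f K) + (\<Sum>(x,K)\<in>p2. incr f K)"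
    using pun fin12 by (simp add: sum.union_disjoint)
  finally have eq: "f b - f a = (\<Sum>(x,K)\<in>p1. incr f K) + (\<Sum>(x,K)\<in>p2. incr f K)" .
  have *: "norm (\<Sum>(x,K)\<in>P. incr f K) \<le> (\<Sum>(x,K)\<in>P. norm (incr f K))"
    for P :: "(real \<times> real set) set"
    unfolding case_prod_unfold by (rule norm_sum)
  have split: "norm (f b - f a) \<le> (\<Sum>(x,K)\<in>p1. norm (incr f K)) + (\<Sum>(x,K)\<in>p2. norm (incr f K))"
    unfolding eq by (rule order_trans[OF norm_triangle_ineq add_mono[OF * *]])
  have p1p: "p1 tagged_partial_division_of {a..b}"
    using p(1) tagged_partial_division_subset[of p "{a..b}" p1] by (auto simp: p1_def tagged_division_of_def)
  have p1d: "snd ` p1 division_of \<Union>(snd ` p1)" by (rule partial_division_of_tagged_division[OF p1p])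
  have sum1: "(\<Sum>(x,K)\<in>p1. norm (incr f K)) = (\<Sum>K\<in>snd ` p1. norm (incr f K))"
  proof -
    \<comment> \<open>Passing from tagged intervals to intervals requires a summand that is 0 on
      every box with empty interior; \<open>Sup\<close> and \<open>Inf\<close> of the empty box are
      unspecified, so that value is overridden.\<close>
    let ?D = "\<lambda>K. if K = {} then 0 else norm (incr f K)"
    have ne: "K \<noteq> {}" if "(x,K) \<in> p1" for x K
      using tagged_partial_division_ofD(2)[OF p1p that] by blast
    have "(\<Sum>(x,K)\<in>p1. norm (incr f K)) = (\<Sum>(x,K)\<in>p1. ?D K)"
      by (rule sum.cong) (use ne in auto)
    also have "\<dots> = (\<Sum>K\<in>snd ` p1. ?D K)"
      by (rule sum.over_tagged_division_lemma[OF tagged_partial_division_of_Union_self[OF p1p]])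
        (auto simp: not_less dest: antisym)
    also have "\<dots> = (\<Sum>K\<in>snd ` p1. norm (incr f K))"
      by (rule sum.cong) (use ne in auto)
    finally show ?thesis .
  qed
  have sub1: "\<Union>(snd ` p1) \<subseteq> U" "\<Union>(snd ` p1) \<subseteq> {a..b}"
  proof -
    have "K \<subseteq> U \<and> K \<subseteq> {a..b}" if "(x,K) \<in> p1" for x K
    proof -
      have "(x,K) \<in> p" "x \<in> N" using that by (auto simp: p1_def)
      then show ?thesis using pK[of x K] \<rho>(2)[of x] by auto
    qed
    then show "\<Union>(snd ` p1) \<subseteq> U" "\<Union>(snd ` p1) \<subseteq> {a..b}" by fastforce+
  qed
  have "(\<Sum>K\<in>snd ` p1. Sup K - Inf K) < \<delta>"
  proof -
    have "(\<Sum>K\<in>snd ` p1. Sup K - Inf K) = \<mu> (\<Union>(snd ` p1))"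
      using division_length(2)[OF p1d] by simp
    also have "\<dots> \<le> \<mu> U"
      using division_length(1)[OF p1d] sub1 Ulm by (intro measure_mono_fmeasurable) auto
    finally show ?thesis using Ulm by linarith
  qed
  with \<delta>(2) p1d sub1 sum1 have b1: "(\<Sum>(x,K)\<in>p1. norm (incr f K)) < e / 2" by metis
  have "(\<Sum>(x,K)\<in>p2. norm (incr f K)) \<le> (\<Sum>(x,K)\<in>p2. (M + \<epsilon>) * (Sup K - Inf K))"
  proof (rule sum_mono, clarify)
    fix x K assume "(x,K) \<in> p2"
    then have xK: "(x,K) \<in> p" "x \<notin> N" by (auto simp: p2_def)
    then obtain u v where uv: "K = {u..v}" "u \<le> x" "x \<le> v" "{u..v} \<subseteq> ball x (\<rho> x)" "{u..v} \<subseteq> {a..b}"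
      using pK by blast
    have xab: "x \<in> {a..b}" using uv by auto
    have bd: "norm (f y - f x) \<le> (M + \<epsilon>) * \<bar>y - x\<bar>" if "y \<in> {u..v}" for y
    proof -
      have "norm (y - x) < \<rho> x" using uv(4) that by (auto simp: dist_norm norm_minus_commute)
      then have 1: "norm (f y - f x - (y - x) *\<^sub>R vector_derivative f (at x)) \<le> \<epsilon> * norm (y - x)"
        using \<rho>(2)[of x] xK(2) xab by auto
      have 2: "norm ((y - x) *\<^sub>R vector_derivative f (at x)) \<le> M * \<bar>y - x\<bar>"
        using mult_right_mono[OF good(2)[of x], of "\<bar>y - x\<bar>"] xab xK(2) by (simp add: mult.commute)
      have "norm (f y - f x) \<le> norm (f y - f x - (y - x) *\<^sub>R vector_derivative f (at x)) + norm ((y - x) *\<^sub>R vector_derivative f (at x))"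
        by (metis diff_add_cancel norm_triangle_ineq)
      then show ?thesis using 1 2 by (simp add: algebra_simps)
    qed
    have "norm (f v - f u) \<le> norm (f v - f x) + norm (f u - f x)"
      using norm_triangle_ineq4[of "f v - f x" "f u - f x"] by simp
    also have "\<dots> \<le> (M + \<epsilon>) * \<bar>v - x\<bar> + (M + \<epsilon>) * \<bar>u - x\<bar>"
      by (intro add_mono bd) (use uv in auto)
    also have "\<dots> = (M + \<epsilon>) * (v - u)" using uv by (simp add: algebra_simps abs_if)
    finally show "norm (incr f K) \<le> (M + \<epsilon>) * (Sup K - Inf K)" using uv by auto
  qed
  also have "\<dots> \<le> (\<Sum>(x,K)\<in>p. (M + \<epsilon>) * (Sup K - Inf K))"
  proof (rule sum_mono2[OF finp])
    show "p2 \<subseteq> p" using pun by auto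
    fix z assume "z \<in> p - p2"
    then show "0 \<le> (case z of (x, K) \<Rightarrow> (M + \<epsilon>) * (Sup K - Inf K))"
      using pK[of "fst z" "snd z"] M \<epsilon>(1) by (auto simp: case_prod_unfold intro!: mult_nonneg_nonneg)
  qed
  also have "\<dots> = (M + \<epsilon>) * (\<Sum>(x,K)\<in>p. Sup K - Inf K)"
    by (simp add: sum_distrib_left case_prod_unfold)
  also have "(\<Sum>(x,K)\<in>p. Sup K - Inf K) = b - a"
    using additive_tagged_division_1[OF ab p(1), of "\<lambda>x. x"] by simp
  finally have b2: "(\<Sum>(x,K)\<in>p2. norm (incr f K)) \<le> (M + \<epsilon>) * (b - a)" .
  show "norm (f b - f a) \<le> M * (b - a) + e"
    using split b1 b2 \<epsilon>(2) by (simp add: algebra_simps)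
qed

section \<open>Plancherel inequality and Fourier inversion\<close>

lemma borel_measurable_cis [measurable]: "cis \<in> borel_measurable borel"
  by (intro borel_measurable_continuous_onI continuous_intros)

abbreviation gauss :: "real \<Rightarrow> real \<Rightarrow> real" where
  "gauss r x \<equiv> exp (- (r * x)\<^sup>2 / 2)"

abbreviation nn_L2 :: "(real \<Rightarrow> complex) \<Rightarrow> ennreal" where
  "nn_L2 u \<equiv> (\<integral>\<^sup>+t. ennreal ((norm (u t))\<^sup>2) \<partial>lborel)"

lemma gaussian_eq_normal_density:
  assumes "r > 0"
  shows "gauss r x = sqrt (2 * pi) / r * normal_density 0 (1 / r) x"
  using assms by (simp add: normal_density_def real_sqrt_divide real_sqrt_mult field_simps)

lemma integrable_gaussian: "r > 0 \<Longrightarrow> integrable lborel (\<lambda>x::real. gauss r x)"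
  unfolding gaussian_eq_normal_density by (intro integrable_mult_right integrable_normal_density) simp

text \<open>The characteristic function of the standard normal law, rescaled by
  \<open>z = r * x\<close>. A wide Gaussian cutoff in frequency (small \<open>r\<close>) corresponds
  to a narrow density of mass one, that is, to an approximate identity.\<close>

lemma gaussian_Fourier:
  assumes "r > 0"
  shows "(LINT x|lborel. of_real (gauss r x) * cis (v * x))
    = complex_of_real (2 * pi * normal_density 0 r v)"
proof -
  define F where "F z = std_normal_density z *\<^sub>R cis (v / r * z)" for z
  have "complex_of_real (exp (- (v/r)\<^sup>2 / 2)) = char std_normal_distribution (v/r)"
    by (simp add: char_std_normal_distribution)
  also have "\<dots> = (LINT z|lborel. F z)"
    unfolding char_def F_def by (subst integral_density) (auto simp: cis_conv_exp)
  also have "\<dots> = \<bar>r\<bar> *\<^sub>R (LINT x|lborel. F (0 + r * x))"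
    by (rule lborel_integral_real_affine) (use assms in simp)
  also have "(\<lambda>x. F (0 + r * x)) = (\<lambda>x. complex_of_real (1 / sqrt (2 * pi)) * (of_real (gauss r x) * cis (v * x)))"
    using assms by (intro ext) (simp add: F_def std_normal_density_def scaleR_conv_of_real)
  finally have "complex_of_real (exp (- (v/r)\<^sup>2 / 2)) = complex_of_real (r / sqrt (2 * pi)) *
     (LINT x|lborel. of_real (gauss r x) * cis (v * x))"
    using assms by (simp add: scaleR_conv_of_real)
  then have "complex_of_real (sqrt (2 * pi) / r) * complex_of_real (exp (- (v/r)\<^sup>2 / 2)) =
     (LINT x|lborel. of_real (gauss r x) * cis (v * x))"
    using assms by (simp add: field_simps)
  moreover have "sqrt (2 * pi) / r * exp (- (v/r)\<^sup>2 / 2) = 2 * pi * normal_density 0 r v"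
  proof -
    have "2 * pi / sqrt (2 * pi) = sqrt (2 * pi)" by (rule real_div_sqrt) simp
    then show ?thesis using assms
      by (simp add: normal_density_def real_sqrt_mult power_divide field_simps)
  qed
  ultimately show ?thesis by (simp only: of_real_mult[symmetric])
qed

text \<open>\<open>k\<close> has modulus 1, so the double integral of norms is the product of the L1
  norms of \<open>a\<close> and \<open>b\<close>, and Fubini's theorem applies.\<close>

lemma Fubini_kernel:
  fixes a b :: "real \<Rightarrow> complex"
  assumes a: "integrable lborel a" and b: "integrable lborel b"
    and k [measurable]: "(\<lambda>(x,s). k x s) \<in> borel_measurable (lborel \<Otimes>\<^sub>M lborel)"
    and k1: "\<And>x s. norm (k x s) = 1"
  shows "(LINT x|lborel. b x * (LINT s|lborel. a s * k x s)) = (LINT s|lborel. a s * (LINT x|lborel. b x * k x s))"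
proof -
  have [measurable]: "a \<in> borel_measurable lborel" "b \<in> borel_measurable lborel" using a b by auto
  have ks: "k x \<in> borel_measurable lborel" for x
    using measurable_Pair2[OF k, of x] by simp
  have 1: "integrable (lborel \<Otimes>\<^sub>M lborel) (\<lambda>(x,s). b x * (a s * k x s))"
  proof (rule lborel_pair.Fubini_integrable)
    show "integrable lborel (\<lambda>x. LINT y|lborel. cmod (case (x, y) of (x, s) \<Rightarrow> b x * (a s * k x s)))"
      using b by (simp add: norm_mult k1 integrable_mult_left)
    show "AE x in lborel. integrable lborel (\<lambda>y. case (x, y) of (x, s) \<Rightarrow> b x * (a s * k x s))"
    proof (intro AE_I2)
      fix x
      have "integrable lborel (\<lambda>s. a s * k x s)"
        by (rule Bochner_Integration.integrable_bound[OF a]) (use ks[of x] in \<open>auto simp: norm_mult k1\<close>)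
      then show "integrable lborel (\<lambda>y. case (x, y) of (x, s) \<Rightarrow> b x * (a s * k x s))" by simp
    qed
  qed measurable
  have "(LINT s|lborel. (LINT x|lborel. b x * (a s * k x s))) = (LINT x|lborel. (LINT s|lborel. b x * (a s * k x s)))"
    by (rule lborel_pair.Fubini_integral[OF 1])
  moreover have "(LINT x|lborel. b x * (a s * k x s)) = a s * (LINT x|lborel. b x * k x s)" for s
    by (simp only: mult.left_commute[of _ "a s"] integral_mult_right_zero)
  ultimately show ?thesis by simp
qed

text \<open>The sign in the exponent is opposite to that in \<open>is_fourier_integral\<close> and
  there is no normalising factor, so inversion produces the density \<open>ft u\<close> divided by
  \<open>2 * pi\<close>.\<close>

definition ft :: "(real \<Rightarrow> complex) \<Rightarrow> real \<Rightarrow> complex" where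
  "ft u x = (LINT s|lborel. u s * cis (- (x * s)))"

lemma borel_measurable_ft [measurable]:
  assumes [measurable]: "u \<in> borel_measurable borel"
  shows "ft u \<in> borel_measurable borel"
  unfolding ft_def by measurable

lemma integrable_mult_cis:
  assumes "integrable lborel u" and [measurable]: "h \<in> borel_measurable borel"
  shows "integrable lborel (\<lambda>s. u s * cis (h s))"
  by (rule Bochner_Integration.integrable_bound[OF assms(1)]) (use assms in \<open>auto simp: norm_mult\<close>)

lemma norm_ft_le: "norm (ft u x) \<le> (LINT s|lborel. norm (u s))"
  unfolding ft_def by (rule order_trans[OF integral_norm_bound]) (simp add: norm_mult)

lemma integrable_ft_gaussian:
  assumes "integrable lborel u" "r > 0"
  shows "integrable lborel (\<lambda>x. ft u x * of_real (gauss r x))"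
proof (rule Bochner_Integration.integrable_bound)
  show "integrable lborel (\<lambda>x. (LINT s|lborel. norm (u s)) * gauss r x)"
    using integrable_gaussian[OF assms(2)] by simp
  have "u \<in> borel_measurable borel" using assms by auto
  note [measurable] = borel_measurable_ft[OF this]
  show "(\<lambda>x. ft u x * of_real (gauss r x)) \<in> borel_measurable lborel" by measurable
  have "0 \<le> (LINT s|lborel. norm (u s))" by simp
  then show "AE x in lborel. norm (ft u x * of_real (gauss r x))
      \<le> norm ((LINT s|lborel. norm (u s)) * gauss r x)"
    by (intro AE_I2) (simp add: norm_mult mult_right_mono norm_ft_le)
qed

text \<open>The Gaussian makes the inversion integral absolutely convergent even when
  \<open>ft u\<close> is not integrable; exchanging the integrals leaves the convolution of
  \<open>u\<close> with a normal density.\<close>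

lemma regularized_inversion:
  assumes u: "integrable lborel u" and r: "r > 0"
  shows "(LINT x|lborel. ft u x * of_real (gauss r x) * cis (x * y))
    = 2 * pi * (LINT s|lborel. u s * complex_of_real (normal_density 0 r (y - s)))"
proof -
  define b where "b x = of_real (gauss r x) * cis (x * y)" for x
  have b: "integrable lborel b" unfolding b_def
    by (intro integrable_mult_cis integrable_of_real integrable_gaussian r) auto
  have "(LINT x|lborel. ft u x * of_real (gauss r x) * cis (x * y))
     = (LINT x|lborel. b x * (LINT s|lborel. u s * cis (- (x * s))))"
    by (simp add: ft_def b_def mult_ac)
  also have "\<dots> = (LINT s|lborel. u s * (LINT x|lborel. b x * cis (- (x * s))))"
    by (rule Fubini_kernel[OF u b]) (auto simp: split_beta')
  also have "(\<lambda>s. LINT x|lborel. b x * cis (- (x * s))) = (\<lambda>s. complex_of_real (2 * pi * normal_density 0 r (y - s)))"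
  proof
    fix s
    have "(\<lambda>x. b x * cis (- (x * s))) = (\<lambda>x. of_real (gauss r x) * cis ((y - s) * x))"
      by (auto simp: b_def mult.assoc cis_mult algebra_simps)
    then show "(LINT x|lborel. b x * cis (- (x * s))) = complex_of_real (2 * pi * normal_density 0 r (y - s))"
      using gaussian_Fourier[OF r, of "y - s"] by simp
  qed
  then have "(LINT s|lborel. u s * (LINT x|lborel. b x * cis (- (x * s))))
     = (LINT s|lborel. u s * complex_of_real (2 * pi * normal_density 0 r (y - s)))"
    by (metis (no_types, lifting))
  also have "\<dots> = (LINT s|lborel. complex_of_real (2 * pi) * (u s * complex_of_real (normal_density 0 r (y - s))))"
    by (simp add: mult_ac)
  finally show ?thesis by simp
qed

lemma nn_integral_normal_density_shift:
  assumes "r > 0"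
  shows "(\<integral>\<^sup>+t. ennreal (normal_density 0 r (s - t)) \<partial>lborel) = 1"
    and "(\<integral>\<^sup>+s. ennreal (normal_density 0 r (s - t)) \<partial>lborel) = 1"
proof -
  have eq: "normal_density 0 r (s - t) = normal_density s r t" "normal_density 0 r (s - t) = normal_density t r s" for s t
    by (auto simp: normal_density_def power2_commute)
  have *: "(\<integral>\<^sup>+t. ennreal (normal_density s r t) \<partial>lborel) = 1" for s
    using assms by (subst nn_integral_eq_integral) auto
  show "(\<integral>\<^sup>+t. ennreal (normal_density 0 r (s - t)) \<partial>lborel) = 1" unfolding eq(1) by (rule *)
  show "(\<integral>\<^sup>+s. ennreal (normal_density 0 r (s - t)) \<partial>lborel) = 1" unfolding eq(2) by (rule *)
qed

text \<open>Inserting the definition of one factor of the squared modulus and exchanging integrals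
  gives \<open>2 * pi\<close> times the double integral of \<open>u s\<close>, the conjugate of
  \<open>u t\<close> and the normal density at \<open>s - t\<close>. The inequality between
  arithmetic and geometric mean separates \<open>s\<close> from \<open>t\<close>, and the density
  has mass one in each variable. From there on only integrals of nonnegative functions occur, so an
  infinite right-hand side does no harm.\<close>

lemma regularized_Plancherel:
  assumes u: "integrable lborel u" and r: "r > 0"
  shows "(\<integral>\<^sup>+x. ennreal ((norm (ft u x))\<^sup>2 * gauss r x) \<partial>lborel)
     \<le> ennreal (2 * pi) * nn_L2 u"
proof -
  let ?N = "\<lambda>v. normal_density 0 r v"
  have [measurable]: "u \<in> borel_measurable borel" using u by auto
  define w where "w x = gauss r x" for x
  define b where "b x = cnj (ft u x * complex_of_real (w x))" for x
  define P where "P = (LINT x|lborel. (norm (ft u x))\<^sup>2 * w x)"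
  define A where "A = nn_L2 u"
  have b: "integrable lborel b"
    unfolding b_def w_def by (intro integrable_cnj integrable_ft_gaussian u r)
  have P0: "P \<ge> 0" unfolding P_def by (intro Bochner_Integration.integral_nonneg) (auto simp: w_def)
  have intP: "integrable lborel (\<lambda>x. (norm (ft u x))\<^sup>2 * w x)"
  proof (rule Bochner_Integration.integrable_bound)
    show "integrable lborel (\<lambda>x. (LINT s|lborel. norm (u s))\<^sup>2 * w x)"
      using integrable_gaussian[OF r] by (simp add: w_def)
    show "AE x in lborel. norm ((norm (ft u x))\<^sup>2 * w x) \<le> norm ((LINT s|lborel. norm (u s))\<^sup>2 * w x)"
      by (intro AE_I2) (auto simp: w_def norm_ft_le intro!: mult_right_mono power_mono)
  qed (simp add: w_def)
  have "complex_of_real P = (LINT x|lborel. complex_of_real ((norm (ft u x))\<^sup>2 * w x))"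
    unfolding P_def by (rule integral_complex_of_real[symmetric])
  also have "\<dots> = (LINT x|lborel. b x * (LINT s|lborel. u s * cis (- (x * s))))"
  proof (intro Bochner_Integration.integral_cong refl)
    fix x
    show "complex_of_real ((norm (ft u x))\<^sup>2 * w x) = b x * (LINT s|lborel. u s * cis (- (x * s)))"
      unfolding ft_def[symmetric] b_def using complex_norm_square[of "ft u x"] by (simp add: mult_ac)
  qed
  also have "\<dots> = (LINT s|lborel. u s * (LINT x|lborel. b x * cis (- (x * s))))"
    by (rule Fubini_kernel[OF u b]) (auto simp: split_beta')
  also have "\<dots> = (LINT s|lborel. u s * cnj (2 * pi * (LINT t|lborel. u t * complex_of_real (?N (s - t)))))"
  proof (intro Bochner_Integration.integral_cong refl)
    fix s
    have "(LINT x|lborel. b x * cis (- (x * s))) = (LINT x|lborel. cnj (ft u x * complex_of_real (w x) * cis (x * s)))"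
      by (intro Bochner_Integration.integral_cong refl) (simp add: b_def cis_cnj)
    also have "\<dots> = cnj (LINT x|lborel. ft u x * complex_of_real (w x) * cis (x * s))"
      by (rule Bochner_Integration.integral_cnj)
    finally have "(LINT x|lborel. b x * cis (- (x * s))) = cnj (LINT x|lborel. ft u x * complex_of_real (w x) * cis (x * s))" .
    then show "u s * (LINT x|lborel. b x * cis (- (x * s))) = u s * cnj (2 * pi * (LINT t|lborel. u t * complex_of_real (?N (s - t))))"
      using regularized_inversion[OF u r, of s] by (simp add: w_def)
  qed
  finally have P: "complex_of_real P = (LINT s|lborel. u s * cnj (2 * pi * (LINT t|lborel. u t * complex_of_real (?N (s - t)))))" .
  \<comment> \<open>A function that is not integrable has Bochner integral 0, so the bound holds for
    every \<open>F\<close>.\<close>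
  have lenn: "ennreal (norm (LINT x|lborel. F x)) \<le> (\<integral>\<^sup>+x. ennreal (norm (F x)) \<partial>lborel)" for F :: "real \<Rightarrow> complex"
    by (cases "integrable lborel F") (auto simp: integral_norm_bound_ennreal not_integrable_integral_eq)
  have "ennreal P = ennreal (norm (complex_of_real P))" using P0 by simp
  also have "\<dots> \<le> (\<integral>\<^sup>+s. ennreal (norm (u s * cnj (2 * pi * (LINT t|lborel. u t * complex_of_real (?N (s - t)))))) \<partial>lborel)"
    unfolding P by (rule lenn)
  also have "\<dots> = (\<integral>\<^sup>+s. ennreal (2 * pi * norm (u s)) * ennreal (norm (LINT t|lborel. u t * complex_of_real (?N (s - t)))) \<partial>lborel)"
    by (intro nn_integral_cong) (simp add: norm_mult ennreal_mult'[symmetric] mult_ac)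
  also have "\<dots> \<le> (\<integral>\<^sup>+s. ennreal (2 * pi * norm (u s)) * (\<integral>\<^sup>+t. ennreal (norm (u t) * ?N (s - t)) \<partial>lborel) \<partial>lborel)"
    by (intro nn_integral_mono mult_left_mono order_trans[OF lenn]) (simp_all add: norm_mult)
  also have "\<dots> = (\<integral>\<^sup>+s. \<integral>\<^sup>+t. ennreal (2 * pi * norm (u s)) * ennreal (norm (u t) * ?N (s - t)) \<partial>lborel \<partial>lborel)"
    by (simp add: nn_integral_cmult)
  also have "\<dots> \<le> (\<integral>\<^sup>+s. \<integral>\<^sup>+t. ennreal (pi * (norm (u s))\<^sup>2) * ennreal (?N (s - t))
       + ennreal (pi * (norm (u t))\<^sup>2) * ennreal (?N (s - t)) \<partial>lborel \<partial>lborel)"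
  proof (intro nn_integral_mono)
    fix s t
    have am: "2 * (norm (u s) * norm (u t)) \<le> (norm (u s))\<^sup>2 + (norm (u t))\<^sup>2"
      using sum_squares_bound[of "norm (u s)" "norm (u t)"] by (simp add: mult_ac)
    have "2 * pi * norm (u s) * (norm (u t) * ?N (s - t)) = pi * ?N (s - t) * (2 * (norm (u s) * norm (u t)))"
      by (simp add: mult_ac)
    also have "\<dots> \<le> pi * ?N (s - t) * ((norm (u s))\<^sup>2 + (norm (u t))\<^sup>2)"
      using am by (intro mult_left_mono) auto
    finally have "2 * pi * norm (u s) * (norm (u t) * ?N (s - t)) \<le> pi * (norm (u s))\<^sup>2 * ?N (s - t) + pi * (norm (u t))\<^sup>2 * ?N (s - t)"
      by (simp add: algebra_simps)
    then show "ennreal (2 * pi * norm (u s)) * ennreal (norm (u t) * ?N (s - t))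
      \<le> ennreal (pi * (norm (u s))\<^sup>2) * ennreal (?N (s - t)) + ennreal (pi * (norm (u t))\<^sup>2) * ennreal (?N (s - t))"
      by (simp add: ennreal_mult'[symmetric] ennreal_plus[symmetric] del: ennreal_plus)
  qed
  also have "\<dots> = (\<integral>\<^sup>+s. \<integral>\<^sup>+t. ennreal (pi * (norm (u s))\<^sup>2) * ennreal (?N (s - t)) \<partial>lborel \<partial>lborel)
       + (\<integral>\<^sup>+s. \<integral>\<^sup>+t. ennreal (pi * (norm (u t))\<^sup>2) * ennreal (?N (s - t)) \<partial>lborel \<partial>lborel)"
    by (simp add: nn_integral_add)
  also have "(\<integral>\<^sup>+s. \<integral>\<^sup>+t. ennreal (pi * (norm (u t))\<^sup>2) * ennreal (?N (s - t)) \<partial>lborel \<partial>lborel)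
      = (\<integral>\<^sup>+t. \<integral>\<^sup>+s. ennreal (pi * (norm (u t))\<^sup>2) * ennreal (?N (s - t)) \<partial>lborel \<partial>lborel)"
    by (rule lborel_pair.Fubini'[symmetric]) measurable
  also have "\<dots> = (\<integral>\<^sup>+t. ennreal (pi * (norm (u t))\<^sup>2) \<partial>lborel)"
    using nn_integral_normal_density_shift[OF r] by (simp add: nn_integral_cmult)
  also have "(\<integral>\<^sup>+s. \<integral>\<^sup>+t. ennreal (pi * (norm (u s))\<^sup>2) * ennreal (?N (s - t)) \<partial>lborel \<partial>lborel)
      = (\<integral>\<^sup>+t. ennreal (pi * (norm (u t))\<^sup>2) \<partial>lborel)"
    using nn_integral_normal_density_shift[OF r] by (simp add: nn_integral_cmult)
  also have "(\<integral>\<^sup>+t. ennreal (pi * (norm (u t))\<^sup>2) \<partial>lborel) = ennreal pi * A"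
    unfolding A_def by (subst nn_integral_cmult[symmetric]) (auto simp: ennreal_mult')
  also have "ennreal pi * A + ennreal pi * A = ennreal (2 * pi) * A"
    by (simp add: distrib_right[symmetric] ennreal_plus[symmetric] del: ennreal_plus)
  finally have "ennreal P \<le> ennreal (2 * pi) * A" .
  moreover have "(\<integral>\<^sup>+x. ennreal ((norm (ft u x))\<^sup>2 * w x) \<partial>lborel) = ennreal P"
    unfolding P_def by (rule nn_integral_eq_integral[OF intP]) (auto simp: w_def)
  ultimately show ?thesis by (simp add: w_def A_def)
qed

lemma gaussian_tendsto_1: "(\<lambda>n. gauss (inverse (real (Suc n))) x) \<longlonglongrightarrow> 1"
proof -
  have "(\<lambda>n. gauss (inverse (real (Suc n))) x) \<longlonglongrightarrow> exp (- (0 * x)\<^sup>2 / 2)"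
    by (intro tendsto_intros LIMSEQ_inverse_real_of_nat) auto
  then show ?thesis by simp
qed

text \<open>The regularised bound does not depend on \<open>r\<close>, so Fatou's lemma removes the
  Gaussian.\<close>

lemma Plancherel_le:
  assumes u: "integrable lborel u"
  shows "nn_L2 (ft u) \<le> ennreal (2 * pi) * nn_L2 u"
proof -
  have [measurable]: "u \<in> borel_measurable borel" using u by auto
  let ?w = "\<lambda>n x. gauss (inverse (real (Suc n))) x"
  have "nn_L2 (ft u) = (\<integral>\<^sup>+x. liminf (\<lambda>n. ennreal ((norm (ft u x))\<^sup>2 * ?w n x)) \<partial>lborel)"
  proof (intro nn_integral_cong)
    fix x
    have "(\<lambda>n. ennreal ((norm (ft u x))\<^sup>2 * ?w n x)) \<longlonglongrightarrow> ennreal ((norm (ft u x))\<^sup>2 * 1)"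
      by (intro tendsto_ennrealI tendsto_intros gaussian_tendsto_1)
    then show "ennreal ((norm (ft u x))\<^sup>2) = liminf (\<lambda>n. ennreal ((norm (ft u x))\<^sup>2 * ?w n x))"
      using lim_imp_Liminf[OF trivial_limit_sequentially] by fastforce
  qed
  also have "\<dots> \<le> liminf (\<lambda>n. \<integral>\<^sup>+x. ennreal ((norm (ft u x))\<^sup>2 * ?w n x) \<partial>lborel)"
    by (rule nn_integral_liminf) measurable
  also have "\<dots> \<le> liminf (\<lambda>n::nat. ennreal (2 * pi) * nn_L2 u)"
    by (intro Liminf_mono always_eventually allI regularized_Plancherel u) simp
  finally show ?thesis by (simp add: Liminf_const)
qed

text \<open>\<open>regularized_inversion\<close> along \<open>r\<close> tending to 0: the frequency
  side converges by dominated convergence because \<open>ft u\<close> is integrable, the other side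
  because the normal densities form an approximate identity and \<open>u\<close> is continuous and
  bounded.\<close>

lemma Fourier_inversion:
  assumes u: "integrable lborel u" and cont: "continuous_on UNIV u" and bd: "\<And>s. norm (u s) \<le> B"
    and fi: "integrable lborel (ft u)"
  shows "u y = (LINT x|lborel. ft u x / (2 * pi) * cis (x * y))"
proof -
  have [measurable]: "u \<in> borel_measurable borel" using u by auto
  let ?r = "\<lambda>n. inverse (real (Suc n))"
  let ?w = "\<lambda>n x. gauss (?r n) x"
  have L: "(\<lambda>n. LINT x|lborel. ft u x * complex_of_real (?w n x) * cis (x * y)) \<longlonglongrightarrow> (LINT x|lborel. ft u x * cis (x * y))"
  proof (rule integral_dominated_convergence)
    show "integrable lborel (\<lambda>x. norm (ft u x))" using fi by simp
    show "AE x in lborel. (\<lambda>n. ft u x * complex_of_real (?w n x) * cis (x * y)) \<longlonglongrightarrow> ft u x * cis (x * y)"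
    proof (intro AE_I2)
      fix x
      have "(\<lambda>n. ft u x * complex_of_real (?w n x) * cis (x * y)) \<longlonglongrightarrow> ft u x * complex_of_real 1 * cis (x * y)"
        by (intro tendsto_intros gaussian_tendsto_1)
      then show "(\<lambda>n. ft u x * complex_of_real (?w n x) * cis (x * y)) \<longlonglongrightarrow> ft u x * cis (x * y)" by simp
    qed
    show "AE x in lborel. norm (ft u x * complex_of_real (?w n x) * cis (x * y)) \<le> norm (ft u x)" for n
      by (intro AE_I2) (simp add: norm_mult mult_left_le)
  qed measurable
  \<comment> \<open>The substitution \<open>s = y - r * z\<close> moves the parameter from the
    density into the argument of \<open>u\<close>, so that one integrable function dominates all
    terms.\<close>
  have eq: "(LINT s|lborel. u s * complex_of_real (normal_density 0 (?r n) (y - s)))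
      = (LINT z|lborel. u (y + - ?r n * z) * complex_of_real (std_normal_density z))" for n
  proof -
    define e where "e = ?r n"
    have e: "e > 0" by (simp add: e_def)
    have nd: "e * normal_density 0 e (e * z) = std_normal_density z" for z
      using e by (simp add: normal_density_def real_sqrt_mult power_mult_distrib field_simps)
    have "(LINT s|lborel. u s * complex_of_real (normal_density 0 e (y - s)))
      = \<bar>-e\<bar> *\<^sub>R (LINT z|lborel. u (y + - e * z) * complex_of_real (normal_density 0 e (y - (y + - e * z))))"
      by (rule lborel_integral_real_affine) (use e in simp)
    also have "\<dots> = (LINT z|lborel. \<bar>-e\<bar> *\<^sub>R (u (y + - e * z) * complex_of_real (normal_density 0 e (y - (y + - e * z)))))"
      by simp
    also have "\<dots> = (LINT z|lborel. u (y + - e * z) * complex_of_real (std_normal_density z))"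
    proof (intro Bochner_Integration.integral_cong refl)
      fix z
      show "\<bar>-e\<bar> *\<^sub>R (u (y + - e * z) * complex_of_real (normal_density 0 e (y - (y + - e * z))))
        = u (y + - e * z) * complex_of_real (std_normal_density z)"
        unfolding nd[of z, symmetric] using e by (simp add: scaleR_conv_of_real mult_ac)
    qed
    finally show ?thesis by (simp add: e_def)
  qed
  have R: "(\<lambda>n. LINT z|lborel. u (y + - ?r n * z) * complex_of_real (std_normal_density z)) \<longlonglongrightarrow>
      (LINT z|lborel. u y * complex_of_real (std_normal_density z))"
  proof (rule integral_dominated_convergence)
    show "integrable lborel (\<lambda>z. B * std_normal_density z)" by simp
    show "AE z in lborel. (\<lambda>n. u (y + - ?r n * z) * complex_of_real (std_normal_density z)) \<longlonglongrightarrow> u y * complex_of_real (std_normal_density z)"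
    proof (intro AE_I2)
      fix z
      have "(\<lambda>n. y + - ?r n * z) \<longlonglongrightarrow> y + - 0 * z"
        by (intro tendsto_intros LIMSEQ_inverse_real_of_nat)
      then have "(\<lambda>n. y + - ?r n * z) \<longlonglongrightarrow> y" by simp
      moreover have "isCont u y" using cont by (simp add: continuous_on_eq_continuous_at)
      ultimately have "(\<lambda>n. u (y + - ?r n * z)) \<longlonglongrightarrow> u y" by (rule isCont_tendsto_compose[rotated])
      then show "(\<lambda>n. u (y + - ?r n * z) * complex_of_real (std_normal_density z)) \<longlonglongrightarrow> u y * complex_of_real (std_normal_density z)"
        by (intro tendsto_intros)
    qed
    show "AE z in lborel. norm (u (y + - ?r n * z) * complex_of_real (std_normal_density z)) \<le> B * std_normal_density z" for n
      by (intro AE_I2) (simp add: norm_mult mult_right_mono bd)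
  qed measurable
  have "(LINT z|lborel. u y * complex_of_real (std_normal_density z)) = u y"
    by (simp del: of_real_mult)
  with R have R': "(\<lambda>n. 2 * pi * (LINT z|lborel. u (y + - ?r n * z) * complex_of_real (std_normal_density z))) \<longlonglongrightarrow> 2 * pi * u y"
    by (intro tendsto_intros) simp
  have "(LINT x|lborel. ft u x * cis (x * y)) = 2 * pi * u y"
  proof (rule LIMSEQ_unique[OF L])
    show "(\<lambda>n. LINT x|lborel. ft u x * complex_of_real (?w n x) * cis (x * y)) \<longlonglongrightarrow> 2 * pi * u y"
      using R' regularized_inversion[OF u, of "?r _" y] eq by simp
  qed
  then show ?thesis by simp
qed

section \<open>Bernstein's inequality and the Wiener algebra\<close>

text \<open>The pointwise inequality \<open>h x \<le> c / 2 + (h x)\<^sup>2 / (2 * c)\<close>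
  integrated over \<open>S\<close>; the best \<open>c\<close> is the L2 bound divided by
  \<open>sqrt L\<close>. Since \<open>V\<close> may be 0 while \<open>c\<close> has to be positive,
  an arbitrary \<open>e\<close> is added.\<close>

lemma nn_integral_Cauchy_Schwarz_set:
  fixes h :: "real \<Rightarrow> real"
  assumes [measurable]: "h \<in> borel_measurable borel" "S \<in> sets borel" and h0: "\<And>x. h x \<ge> 0"
    and S: "emeasure lborel S \<le> ennreal L" "L > 0" and V0: "V \<ge> 0"
    and V: "(\<integral>\<^sup>+x\<in>S. ennreal ((h x)\<^sup>2) \<partial>lborel) \<le> ennreal (V\<^sup>2)"
  shows "(\<integral>\<^sup>+x\<in>S. ennreal (h x) \<partial>lborel) \<le> ennreal (sqrt L * V)"
proof (rule ennreal_le_epsilon)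
  fix e :: real assume e: "e > 0"
  define W where "W = V + e / sqrt L"
  have W: "W > 0" "V \<le> W" using e S V0 by (auto simp: W_def add_nonneg_pos)
  define c where "c = W / sqrt L"
  have c: "c > 0" using W S by (simp add: c_def)
  have "(\<integral>\<^sup>+x\<in>S. ennreal (h x) \<partial>lborel) \<le> (\<integral>\<^sup>+x. ennreal (c/2) * indicator S x + ennreal (1/(2*c)) * (ennreal ((h x)\<^sup>2) * indicator S x) \<partial>lborel)"
  proof (intro nn_integral_mono)
    fix x
    have "2 * h x * c \<le> (h x)\<^sup>2 + c\<^sup>2" by (rule sum_squares_bound)
    then have "h x \<le> c/2 + 1/(2*c) * (h x)\<^sup>2" using c by (simp add: field_simps power2_eq_square)
    then show "ennreal (h x) * indicator S x \<le> ennreal (c/2) * indicator S x + ennreal (1/(2*c)) * (ennreal ((h x)\<^sup>2) * indicator S x)"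
      using c by (auto simp: indicator_def ennreal_mult'[symmetric] ennreal_plus[symmetric] simp del: ennreal_plus)
  qed
  also have "\<dots> = ennreal (c/2) * emeasure lborel S + ennreal (1/(2*c)) * (\<integral>\<^sup>+x\<in>S. ennreal ((h x)\<^sup>2) \<partial>lborel)"
    by (subst nn_integral_add) (auto simp: nn_integral_cmult)
  also have "\<dots> \<le> ennreal (c/2) * ennreal L + ennreal (1/(2*c)) * ennreal (W\<^sup>2)"
    using W V0 by (intro add_mono mult_left_mono S order_trans[OF V] ennreal_leI power_mono) auto
  also have "\<dots> = ennreal (c/2 * L + 1/(2*c) * W\<^sup>2)"
    using c S W by (simp add: ennreal_mult'[symmetric] ennreal_plus[symmetric] del: ennreal_plus)
  also have "c/2 * L + 1/(2*c) * W\<^sup>2 = sqrt L * V + e"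
  proof -
    have sL: "sqrt L > 0" "L = sqrt L * sqrt L" using S by auto
    have "c/2 * L = W * sqrt L / 2" using sL by (simp add: c_def field_simps)
    moreover have "1/(2*c) * W\<^sup>2 = W * sqrt L / 2" using sL W by (simp add: c_def field_simps power2_eq_square)
    moreover have "W * sqrt L = sqrt L * V + e" using sL by (simp add: W_def field_simps)
    ultimately show ?thesis by linarith
  qed
  finally show "(\<integral>\<^sup>+x\<in>S. ennreal (h x) \<partial>lborel) \<le> ennreal (sqrt L * V) + ennreal e"
    using e S V0 by (simp add: ennreal_plus)
qed

section \<open>Fourier transforms on frequency bands\<close>

lemma ft_difference:
  assumes u: "integrable lborel u"
  shows "integrable lborel (\<lambda>t. u (t + h) - u t)" "ft (\<lambda>t. u (t + h) - u t) x = (cis (x * h) - 1) * ft u x"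
proof -
  have uh: "integrable lborel (\<lambda>t. u (t + h))"
    using lborel_integrable_real_affine[OF u, of 1 h] by (simp add: add.commute)
  show "integrable lborel (\<lambda>t. u (t + h) - u t)" using u uh by simp
  have "(LINT s|lborel. u s * cis (- (x * s))) = \<bar>1\<bar> *\<^sub>R (LINT s|lborel. u (h + 1 * s) * cis (- (x * (h + 1 * s))))"
    by (rule lborel_integral_real_affine) simp
  also have "\<dots> = (LINT s|lborel. cis (- (x * h)) * (u (s + h) * cis (- (x * s))))"
    by (simp add: mult_ac cis_mult algebra_simps)
  finally have "ft u x = cis (- (x * h)) * (LINT s|lborel. u (s + h) * cis (- (x * s)))"
    by (simp add: ft_def)
  then have 1: "cis (x * h) * ft u x = (LINT s|lborel. u (s + h) * cis (- (x * s)))"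
    by (simp add: mult.assoc[symmetric] cis_mult)
  have "ft (\<lambda>t. u (t + h) - u t) x = (LINT s|lborel. u (s + h) * cis (- (x * s)) - u s * cis (- (x * s)))"
    by (simp add: ft_def algebra_simps)
  also have "\<dots> = (LINT s|lborel. u (s + h) * cis (- (x * s))) - (LINT s|lborel. u s * cis (- (x * s)))"
    by (intro Bochner_Integration.integral_diff integrable_mult_cis u uh) auto
  finally show "ft (\<lambda>t. u (t + h) - u t) x = (cis (x * h) - 1) * ft u x"
    using 1 by (simp add: ft_def algebra_simps)
qed

text \<open>Used with \<open>u = x * h\<close> on a band, where it bounds from below the factor by
  which differencing multiplies the transform. The range ends at \<open>2 < pi\<close>, so the
  cosine is still decreasing.\<close>

lemma norm_cis_minus_1_ge:
  assumes "1 \<le> \<bar>u\<bar>" "\<bar>u\<bar> \<le> 2"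
  shows "1 - cos 1 \<le> norm (cis u - 1)"
proof -
  have "\<bar>Re (cis u - 1)\<bar> \<le> norm (cis u - 1)" by (rule abs_Re_le_cmod)
  moreover have "cos \<bar>u\<bar> \<le> cos 1" using assms pi_gt3 by (intro cos_monotone_0_pi_le) auto
  ultimately show ?thesis by simp
qed

lemma cos_1_less_1: "cos 1 < (1::real)"
  using cos_monotone_0_pi[of 0 1] pi_gt3 by simp

lemma ft_band_bound:
  assumes u: "integrable lborel u" and h: "h > 0" and D: "D \<ge> 0"
    and diff: "nn_L2 (\<lambda>t. u (t + h) - u t) \<le> ennreal (D\<^sup>2)"
  shows "(\<integral>\<^sup>+x\<in>{x. 1 / h \<le> \<bar>x\<bar> \<and> \<bar>x\<bar> \<le> 2 / h}. ennreal (norm (ft u x)) \<partial>lborel)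
    \<le> ennreal (2 * sqrt pi / (1 - cos 1) * (D / sqrt h))"
proof -
  let ?S = "{x. 1 / h \<le> \<bar>x\<bar> \<and> \<bar>x\<bar> \<le> 2 / h}" and ?k = "1 - cos 1 :: real"
  have [measurable]: "u \<in> borel_measurable borel" using u by auto
  have k: "?k > 0" using cos_1_less_1 by simp
  have S: "?S = {1/h..2/h} \<union> {-(2/h)..-(1/h)}" using h by (auto simp: abs_if split: if_splits)
  have Sm: "?S \<in> sets borel" unfolding S by auto
  have "emeasure lborel ?S \<le> emeasure lborel {1/h..2/h} + emeasure lborel {-(2/h)..-(1/h)}"
    unfolding S by (rule emeasure_subadditive) auto
  also have "\<dots> = ennreal (2 / h)"
    using h by (simp add: divide_right_mono ennreal_plus[symmetric] diff_divide_distrib[symmetric] del: ennreal_plus)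
  finally have eS: "emeasure lborel ?S \<le> ennreal (2 / h)" .
  \<comment> \<open>\<open>2 / h\<close> is the total length of the two sides of the band,
    \<open>2 * pi\<close> is the Plancherel constant, and \<open>?k\<close> is the lower bound for
    the modulus of \<open>cis (x * h) - 1\<close>.\<close>
  have "(\<integral>\<^sup>+x\<in>?S. ennreal (norm (ft u x)) \<partial>lborel) \<le> ennreal (sqrt (2 / h) * (sqrt (2 * pi) * D / ?k))"
  proof (rule nn_integral_Cauchy_Schwarz_set[OF _ Sm _ eS])
    have "(\<integral>\<^sup>+x\<in>?S. ennreal ((norm (ft u x))\<^sup>2) \<partial>lborel)
       \<le> (\<integral>\<^sup>+x. ennreal (1 / ?k\<^sup>2) * ennreal ((norm (ft (\<lambda>t. u (t + h) - u t) x))\<^sup>2) \<partial>lborel)"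
    proof (intro nn_integral_mono)
      fix x
      show "ennreal ((norm (ft u x))\<^sup>2) * indicator ?S x \<le> ennreal (1 / ?k\<^sup>2) * ennreal ((norm (ft (\<lambda>t. u (t + h) - u t) x))\<^sup>2)"
      proof (cases "x \<in> ?S")
        case True
        then have "1 \<le> \<bar>x * h\<bar>" "\<bar>x * h\<bar> \<le> 2" using h by (auto simp: abs_mult field_simps)
        then have "?k \<le> norm (cis (x * h) - 1)" by (rule norm_cis_minus_1_ge)
        then have "?k\<^sup>2 * (norm (ft u x))\<^sup>2 \<le> (norm (cis (x * h) - 1))\<^sup>2 * (norm (ft u x))\<^sup>2"
          using k by (intro mult_right_mono power_mono) auto
        then have "(norm (ft u x))\<^sup>2 \<le> 1 / ?k\<^sup>2 * (norm (ft (\<lambda>t. u (t + h) - u t) x))\<^sup>2"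
          unfolding ft_difference(2)[OF u] norm_mult power_mult_distrib
          using k by (simp add: divide_simps mult_ac)
        then show ?thesis using True by (simp add: ennreal_mult'[symmetric] ennreal_leI)
      qed auto
    qed
    also have "\<dots> = ennreal (1 / ?k\<^sup>2) * (\<integral>\<^sup>+x. ennreal ((norm (ft (\<lambda>t. u (t + h) - u t) x))\<^sup>2) \<partial>lborel)"
      by (rule nn_integral_cmult) measurable
    also have "\<dots> \<le> ennreal (1 / ?k\<^sup>2) * (ennreal (2 * pi) * ennreal (D\<^sup>2))"
      by (intro mult_left_mono order_trans[OF Plancherel_le[OF ft_difference(1)[OF u]]] diff) auto
    also have "\<dots> = ennreal ((sqrt (2 * pi) * D / ?k)\<^sup>2)"
      by (simp add: ennreal_mult'[symmetric] power_mult_distrib power_divide)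
    finally show "(\<integral>\<^sup>+x\<in>?S. ennreal ((norm (ft u x))\<^sup>2) \<partial>lborel) \<le> ennreal ((sqrt (2 * pi) * D / ?k)\<^sup>2)" .
  qed (use h D k in auto)
  also have "sqrt (2 / h) * (sqrt (2 * pi) * D / ?k) = 2 * sqrt pi / ?k * (D / sqrt h)"
  proof -
    have "sqrt 2 * sqrt 2 = (2::real)" by simp
    then show ?thesis
      by (simp add: real_sqrt_mult real_sqrt_divide mult_ac mult.assoc[symmetric, of "sqrt 2"])
  qed
  finally show ?thesis .
qed

lemma ft_low_bound:
  assumes u: "integrable lborel u" and R: "R > 0" and N: "N \<ge> 0"
    and L2: "nn_L2 u \<le> ennreal (N\<^sup>2)"
  shows "(\<integral>\<^sup>+x\<in>{-R..R}. ennreal (norm (ft u x)) \<partial>lborel) \<le> ennreal (2 * sqrt pi * (sqrt R * N))"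
proof -
  have [measurable]: "u \<in> borel_measurable borel" using u by auto
  have "(\<integral>\<^sup>+x\<in>{-R..R}. ennreal (norm (ft u x)) \<partial>lborel) \<le> ennreal (sqrt (2 * R) * (sqrt (2 * pi) * N))"
  proof (rule nn_integral_Cauchy_Schwarz_set)
    show "emeasure lborel {-R..R} \<le> ennreal (2 * R)" using R by simp
    have "(\<integral>\<^sup>+x\<in>{-R..R}. ennreal ((norm (ft u x))\<^sup>2) \<partial>lborel) \<le> nn_L2 (ft u)"
      by (intro nn_integral_mono) (auto simp: indicator_def)
    also have "\<dots> \<le> ennreal (2 * pi) * ennreal (N\<^sup>2)"
      by (rule order_trans[OF Plancherel_le[OF u]]) (intro mult_left_mono L2, simp)
    also have "\<dots> = ennreal ((sqrt (2 * pi) * N)\<^sup>2)"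
      by (simp add: ennreal_mult'[symmetric] power_mult_distrib)
    finally show "(\<integral>\<^sup>+x\<in>{-R..R}. ennreal ((norm (ft u x))\<^sup>2) \<partial>lborel) \<le> ennreal ((sqrt (2 * pi) * N)\<^sup>2)" .
  qed (use R N in auto)
  also have "sqrt (2 * R) * (sqrt (2 * pi) * N) = 2 * sqrt pi * (sqrt R * N)"
    by (simp add: real_sqrt_mult)
  finally show ?thesis .
qed

text \<open>A bound together with a witness. \<open>wiener_norm\<close> is a definite description,
  usable only after uniqueness of the density, whereas witnesses can be added and summed
  directly.\<close>

definition wiener_le :: "(real \<Rightarrow> complex) \<Rightarrow> real \<Rightarrow> bool" where
  "wiener_le f B \<longleftrightarrow> (\<exists>g. is_fourier_integral f g \<and> (LINT x|lebesgue. norm (g x)) \<le> B)"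

lemma wiener_leI_lborel:
  assumes g: "integrable lborel g" and f: "\<And>y. f y = (LINT x|lborel. g x * cis (x * y))"
    and B: "(LINT x|lborel. norm (g x)) \<le> B"
  shows "wiener_le f B"
  unfolding wiener_le_def is_fourier_integral_def
proof (intro exI[of _ g] conjI allI)
  have [measurable]: "g \<in> borel_measurable borel" using g by auto
  show "integrable lebesgue g" using g by (subst integrable_completion) auto
  show "(LINT x|lebesgue. norm (g x)) \<le> B" using B by (subst integral_completion) auto
  fix y
  have "(LINT x|lebesgue. g x * cis (x * y)) = (LINT x|lborel. g x * cis (x * y))"
    by (rule integral_completion) measurable
  then show "f y = (LINT x|lebesgue. g x * exp (\<i> * complex_of_real (x * y)))"
    using f[of y] by (simp add: cis_conv_exp)
qed

lemma wiener_le_mono: "wiener_le f B \<Longrightarrow> B \<le> C \<Longrightarrow> wiener_le f C"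
  unfolding wiener_le_def by fastforce

text \<open>Frequencies up to \<open>R\<close> are paid for by the L2 norm. The band from
  \<open>R * 2 ^ j\<close> to \<open>R * 2 ^ Suc j\<close> is tested with \<open>h j\<close>, the
  reciprocal of its lower end, and costs a constant times \<open>E * q ^ j\<close> with
  \<open>q < 1\<close>. \<open>R\<close> is left free so that the two terms can be balanced in each
  application.\<close>

lemma Bernstein_bound:
  assumes u: "integrable lborel u" and cont: "continuous_on UNIV u" and bd: "\<And>s. norm (u s) \<le> B"
    and R: "R > 0" and N: "N \<ge> 0" and D: "D \<ge> 0" and \<alpha>: "\<alpha> > 1/2"
    and L2: "nn_L2 u \<le> ennreal (N\<^sup>2)"
    and diff: "\<And>h. 0 < h \<Longrightarrow> h \<le> 1 / R \<Longrightarrow>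
       nn_L2 (\<lambda>t. u (t + h) - u t) \<le> ennreal ((D * h powr \<alpha>)\<^sup>2)"
  shows "wiener_le u (2 * sqrt pi / ((1 - cos 1) * (1 - 2 powr (1/2 - \<alpha>))) * (sqrt R * N + D * R powr (1/2 - \<alpha>)))"
proof -
  have [measurable]: "u \<in> borel_measurable borel" using u by auto
  define q where "q = (2::real) powr (1/2 - \<alpha>)"
  define k where "k = 1 - cos (1::real)"
  have q: "0 < q" "q < 1" using \<alpha> by (auto simp: q_def intro: powr_less_one)
  have k: "0 < k" "k \<le> 1" using cos_1_less_1 cos_ge_zero[of 1] pi_gt3 by (auto simp: k_def)
  define h where "h j = 1 / (R * 2 ^ j)" for j :: nat
  have h: "h j > 0" "h j \<le> 1 / R" for j using R by (auto simp: h_def field_simps)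
  define Bd where "Bd j = {x. 1 / h j \<le> \<bar>x\<bar> \<and> \<bar>x\<bar> \<le> 2 / h j}" for j
  have Bdm [measurable]: "Bd j \<in> sets borel" for j unfolding Bd_def by measurable
  define E where "E = D * R powr (1/2 - \<alpha>)"
  have E: "E \<ge> 0" using D by (simp add: E_def)
  have hq: "D * h j powr \<alpha> / sqrt (h j) = E * q ^ j" for j
  proof -
    have "h j powr \<alpha> / sqrt (h j) = h j powr (\<alpha> - 1/2)"
      using h(1)[of j] by (simp add: powr_diff powr_half_sqrt)
    also have "\<dots> = (R * 2 ^ j) powr (1/2 - \<alpha>)"
      using R by (simp add: h_def powr_divide powr_minus_divide[symmetric])
    also have "\<dots> = R powr (1/2 - \<alpha>) * (2 ^ j) powr (1/2 - \<alpha>)"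
      using R by (simp add: powr_mult)
    also have "(2 ^ j) powr (1/2 - \<alpha>) = q ^ j"
      by (simp add: q_def powr_realpow[symmetric] powr_powr mult.commute)
    finally have "h j powr \<alpha> / sqrt (h j) = R powr (1 / 2 - \<alpha>) * q ^ j" .
    then show ?thesis by (simp only: E_def mult.assoc times_divide_eq_right[symmetric])
  qed
  have band: "(\<integral>\<^sup>+x\<in>Bd j. ennreal (norm (ft u x)) \<partial>lborel) \<le> ennreal (2 * sqrt pi / k * (E * q ^ j))" for j
    using ft_band_bound[OF u h(1)[of j] _ diff[OF h(1)[of j] h(2)[of j]]] D
    unfolding Bd_def k_def hq[of j, symmetric] by simp
  have low: "(\<integral>\<^sup>+x\<in>{-R..R}. ennreal (norm (ft u x)) \<partial>lborel) \<le> ennreal (2 * sqrt pi * (sqrt R * N))"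
    by (rule ft_low_bound[OF u R N L2])
  have cover: "x \<in> {-R..R} \<or> (\<exists>j. x \<in> Bd j)" for x
  proof (cases "\<bar>x\<bar> \<le> R")
    case False
    define P where "P n \<longleftrightarrow> \<bar>x\<bar> \<le> R * 2 ^ n" for n :: nat
    obtain n where "\<bar>x\<bar> / R < 2 ^ n" using real_arch_pow[of 2 "\<bar>x\<bar> / R"] by auto
    then have "P n" using R by (simp add: P_def field_simps)
    define m where "m = (LEAST n. P n)"
    have Pm: "P m" unfolding m_def by (rule LeastI[of P, OF \<open>P n\<close>])
    have "m \<noteq> 0" using Pm False unfolding P_def by (intro notI) simp
    then obtain j where j: "m = Suc j" using not0_implies_Suc by blast
    have "\<not> P j" using not_less_Least[of j P] j by (simp add: m_def)
    then have "x \<in> Bd j" using Pm R by (simp add: P_def j Bd_def h_def)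
    then show ?thesis by blast
  qed auto
  have "(\<integral>\<^sup>+x. ennreal (norm (ft u x)) \<partial>lborel) \<le>
     (\<integral>\<^sup>+x. ennreal (norm (ft u x)) * indicator {-R..R} x + (\<Sum>j. ennreal (norm (ft u x)) * indicator (Bd j) x) \<partial>lborel)"
  proof (intro nn_integral_mono)
    fix x
    show "ennreal (norm (ft u x)) \<le> ennreal (norm (ft u x)) * indicator {-R..R} x + (\<Sum>j. ennreal (norm (ft u x)) * indicator (Bd j) x)"
    proof (cases "x \<in> {-R..R}")
      case False
      then obtain j where j: "x \<in> Bd j" using cover by blast
      have "(\<Sum>i\<in>{j}. ennreal (norm (ft u x)) * indicator (Bd i) x) \<le> (\<Sum>j. ennreal (norm (ft u x)) * indicator (Bd j) x)"
        by (rule sum_le_suminf) auto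
      with j False show ?thesis by simp
    qed simp
  qed
  also have "\<dots> = (\<integral>\<^sup>+x\<in>{-R..R}. ennreal (norm (ft u x)) \<partial>lborel)
      + (\<integral>\<^sup>+x. (\<Sum>j. ennreal (norm (ft u x)) * indicator (Bd j) x) \<partial>lborel)"
    by (rule nn_integral_add) measurable
  also have "(\<integral>\<^sup>+x. (\<Sum>j. ennreal (norm (ft u x)) * indicator (Bd j) x) \<partial>lborel)
      = (\<Sum>j. \<integral>\<^sup>+x\<in>Bd j. ennreal (norm (ft u x)) \<partial>lborel)"
    by (rule nn_integral_suminf) measurable
  also have "(\<integral>\<^sup>+x\<in>{-R..R}. ennreal (norm (ft u x)) \<partial>lborel) + (\<Sum>j. \<integral>\<^sup>+x\<in>Bd j. ennreal (norm (ft u x)) \<partial>lborel)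
      \<le> ennreal (2 * sqrt pi * (sqrt R * N)) + (\<Sum>j. ennreal (2 * sqrt pi / k * (E * q ^ j)))"
    by (intro add_mono low suminf_le band) auto
  also have "(\<Sum>j. ennreal (2 * sqrt pi / k * (E * q ^ j))) = ennreal (2 * sqrt pi / k * (E * (1 / (1 - q))))"
  proof (rule suminf_ennreal_eq)
    show "(\<lambda>j. 2 * sqrt pi / k * (E * q ^ j)) sums (2 * sqrt pi / k * (E * (1 / (1 - q))))"
      using q by (intro sums_mult geometric_sums) auto
  qed (use k E q in auto)
  also have "ennreal (2 * sqrt pi * (sqrt R * N)) + ennreal (2 * sqrt pi / k * (E * (1 / (1 - q))))
      = ennreal (2 * sqrt pi * (sqrt R * N) + 2 * sqrt pi / k * (E * (1 / (1 - q))))"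
    using R N E k q by (subst ennreal_plus) auto
  also have "\<dots> \<le> ennreal (2 * sqrt pi / (k * (1 - q)) * (sqrt R * N + E))"
  proof (rule ennreal_leI)
    \<comment> \<open>The low-frequency term carries the smaller constant; this lets one constant
      stand in front of both terms.\<close>
    have "k * (1 - q) \<le> 1" using k q by (intro mult_le_one) auto
    then have "1 \<le> 1 / (k * (1 - q))" using k q by simp
    then have "2 * sqrt pi * (sqrt R * N) * 1 \<le> 2 * sqrt pi * (sqrt R * N) * (1 / (k * (1 - q)))"
      using R N by (intro mult_left_mono) auto
    then show "2 * sqrt pi * (sqrt R * N) + 2 * sqrt pi / k * (E * (1 / (1 - q))) \<le> 2 * sqrt pi / (k * (1 - q)) * (sqrt R * N + E)"
      by (simp add: distrib_left mult_ac add_divide_distrib)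
  qed
  finally have bound: "(\<integral>\<^sup>+x. ennreal (norm (ft u x)) \<partial>lborel) \<le> ennreal (2 * sqrt pi / (k * (1 - q)) * (sqrt R * N + E))" .
  define C where "C = 2 * sqrt pi / (k * (1 - q)) * (sqrt R * N + E)"
  have C0: "C \<ge> 0" using k q R N E by (auto simp: C_def)
  have fi: "integrable lborel (ft u)"
    by (rule integrableI_bounded) (use bound in \<open>auto simp: less_top[symmetric] top_unique\<close>)
  have intC: "(LINT x|lborel. norm (ft u x)) \<le> C"
  proof -
    have "ennreal (LINT x|lborel. norm (ft u x)) \<le> ennreal C"
      using bound nn_integral_eq_integral[of lborel "\<lambda>x. norm (ft u x)"] fi by (simp add: C_def)
    then show ?thesis using C0 by (simp add: ennreal_le_iff)
  qed
  have "wiener_le u C"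
  proof (rule wiener_leI_lborel)
    show "integrable lborel (\<lambda>x. ft u x / (2 * pi))" using fi by simp
    show "u y = (LINT x|lborel. ft u x / (2 * pi) * cis (x * y))" for y
      by (rule Fourier_inversion[OF u cont bd fi])
    have "(LINT x|lborel. norm (ft u x / (2 * pi))) = (LINT x|lborel. norm (ft u x)) / (2 * pi)"
      by (simp add: norm_divide)
    also have "\<dots> \<le> (LINT x|lborel. norm (ft u x)) / 1"
      using pi_gt3 by (intro divide_left_mono) auto
    finally show "(LINT x|lborel. norm (ft u x / (2 * pi))) \<le> C" using intC by simp
  qed
  then show ?thesis by (simp add: C_def k_def q_def E_def)
qed

lemma integrable_mult_iexp:
  assumes k: "integrable lebesgue k"
  shows "integrable lebesgue (\<lambda>x. k x * exp (\<i> * complex_of_real (x * y)))"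
proof (rule Bochner_Integration.integrable_bound[OF k])
  have "(\<lambda>x. cis (x * y)) \<in> borel_measurable lebesgue" by (rule measurable_completion) measurable
  then show "(\<lambda>x. k x * exp (\<i> * complex_of_real (x * y))) \<in> borel_measurable lebesgue"
    unfolding cis_conv_exp by (rule borel_measurable_times[OF borel_measurable_integrable[OF k]])
  show "AE x in lebesgue. norm (k x * exp (\<i> * complex_of_real (x * y))) \<le> norm (k x)"
    by (simp add: norm_mult cis_conv_exp[symmetric] del: of_real_mult)
qed

text \<open>The L1 norms of the densities are summable, so the densities have an almost everywhere
  convergent and integrable sum, whose transform may be computed termwise; pointwise convergence of
  the \<open>f n\<close> identifies it with \<open>F\<close>. Part a) assembles \<open>f\<close>
  from infinitely many pieces in this way.\<close>

lemma wiener_le_suminf: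
  assumes f: "\<And>n. wiener_le (f n) (B n)" and B: "summable B" and F: "\<And>y. (\<lambda>n. f n y) sums F y"
  shows "wiener_le F (suminf B)"
proof -
  from f obtain g where g: "\<And>n. is_fourier_integral (f n) (g n)" "\<And>n. (LINT x|lebesgue. norm (g n x)) \<le> B n"
    unfolding wiener_le_def by metis
  have gi: "integrable lebesgue (g n)" for n using g(1) by (simp add: is_fourier_integral_def)
  have gf: "f n y = (LINT x|lebesgue. g n x * exp (\<i> * complex_of_real (x * y)))" for n y
    using g(1) by (simp add: is_fourier_integral_def)
  have g0: "0 \<le> (LINT x|lebesgue. norm (g n x))" for n by simp
  have B0: "B n \<ge> 0" for n using g0[of n] g(2)[of n] by linarith
  have sg: "summable (\<lambda>n. LINT x|lebesgue. norm (g n x))"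
    by (rule summable_comparison_test'[OF B, of 0]) (use g g0 in simp)
  have "(\<integral>\<^sup>+x. (\<Sum>n. ennreal (norm (g n x))) \<partial>lebesgue) = (\<Sum>n. \<integral>\<^sup>+x. ennreal (norm (g n x)) \<partial>lebesgue)"
    using gi by (intro nn_integral_suminf) auto
  also have "\<dots> = (\<Sum>n. ennreal (LINT x|lebesgue. norm (g n x)))"
    using gi by (subst nn_integral_eq_integral) auto
  also have "\<dots> < \<infinity>" using sg g0 by (simp add: suminf_ennreal_eq[OF _ summable_sums] less_top[symmetric])
  finally have "AE x in lebesgue. (\<Sum>n. ennreal (norm (g n x))) \<noteq> \<infinity>"
    using gi by (intro nn_integral_noteq_infinite) auto
  then have ae: "AE x in lebesgue. summable (\<lambda>n. norm (g n x))"
    by (auto elim!: eventually_mono intro: summable_suminf_not_top)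
  have cisn: "norm (exp (\<i> * complex_of_real t)) = 1" for t by (simp flip: cis_conv_exp)
  let ?G = "\<lambda>x. \<Sum>n. g n x"
  have GI: "integrable lebesgue ?G"
    by (rule integrable_suminf[OF gi ae sg])
  have Fy: "F y = (LINT x|lebesgue. ?G x * exp (\<i> * complex_of_real (x * y)))" for y
  proof -
    let ?e = "\<lambda>x. exp (\<i> * complex_of_real (x * y))"
    note gie = integrable_mult_iexp[OF gi]
    have "(\<lambda>n. LINT x|lebesgue. g n x * ?e x) sums (LINT x|lebesgue. (\<Sum>n. g n x * ?e x))"
      by (rule sums_integral[OF gie])
        (use ae sg cisn[of "_ * y"] in \<open>auto simp: norm_mult simp del: of_real_mult\<close>)
    then have "(\<lambda>n. f n y) sums (LINT x|lebesgue. (\<Sum>n. g n x * ?e x))" by (simp add: gf)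
    with F[of y] have "F y = (LINT x|lebesgue. (\<Sum>n. g n x * ?e x))" by (rule sums_unique2)
    also have "\<dots> = (LINT x|lebesgue. ?G x * ?e x)"
    proof (rule integral_cong_AE)
      show "AE x in lebesgue. (\<Sum>n. g n x * ?e x) = ?G x * ?e x"
        using ae by eventually_elim (metis suminf_mult2 summable_norm_cancel)
      show "(\<lambda>x. \<Sum>n. g n x * ?e x) \<in> borel_measurable lebesgue"
        using gie by (intro borel_measurable_suminf) auto
      show "(\<lambda>x. ?G x * ?e x) \<in> borel_measurable lebesgue"
        by (rule borel_measurable_integrable[OF integrable_mult_iexp[OF GI]])
    qed
    finally show ?thesis .
  qed
  have "(LINT x|lebesgue. norm (?G x)) \<le> (LINT x|lebesgue. (\<Sum>n. norm (g n x)))"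
  proof (rule integral_mono_AE)
    show "integrable lebesgue (\<lambda>x. norm (?G x))" using GI by simp
    show "integrable lebesgue (\<lambda>x. \<Sum>n. norm (g n x))"
      by (rule integrable_suminf) (use gi ae sg in auto)
    show "AE x in lebesgue. norm (?G x) \<le> (\<Sum>n. norm (g n x))"
      using ae by eventually_elim (rule summable_norm)
  qed
  also have "\<dots> = (\<Sum>n. LINT x|lebesgue. norm (g n x))"
    by (rule integral_suminf) (use gi ae sg in auto)
  also have "\<dots> \<le> suminf B"
    by (rule suminf_le[OF g(2) sg B])
  finally show ?thesis
    using GI Fy unfolding wiener_le_def is_fourier_integral_def by blast
qed

text \<open>Treated as a series with two nonzero terms.\<close>

lemma wiener_le_add:
  assumes "wiener_le f B" "wiener_le g C"
  shows "wiener_le (\<lambda>x. f x + g x) (B + C)"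
proof -
  have z: "wiener_le (\<lambda>x. 0) 0"
    by (rule wiener_leI_lborel[of "\<lambda>x. 0"]) auto
  define H where "H n = (if n = 0 then f else if n = Suc 0 then g else (\<lambda>x. 0))" for n :: nat
  define K where "K n = (if n = 0 then B else if n = Suc 0 then C else 0)" for n :: nat
  have "K sums (\<Sum>n\<in>{0,Suc 0}. K n)" by (rule sums_finite) (auto simp: K_def)
  then have K: "K sums (B + C)" by (simp add: K_def)
  have H: "(\<lambda>n. H n y) sums (f y + g y)" for y
    using sums_finite[of "{0,Suc 0}" "\<lambda>n. H n y"] by (simp add: H_def)
  have "wiener_le (\<lambda>x. f x + g x) (suminf K)"
    by (rule wiener_le_suminf[OF _ _ H]) (use K assms z in \<open>auto simp: H_def K_def sums_iff\<close>)
  then show ?thesis using K by (simp add: sums_iff)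
qed

text \<open>The positive and negative parts of \<open>r\<close> have the same transform, hence, at
  frequency 0, the same mass \<open>m\<close>. Divided by a nonzero \<open>m\<close> they become
  probability densities with equal characteristic functions, so Levy's uniqueness theorem
  applies.\<close>

lemma real_Fourier_unique:
  fixes r :: "real \<Rightarrow> real"
  assumes r: "integrable lborel r" and z: "\<And>y. (LINT x|lborel. complex_of_real (r x) * cis (x * y)) = 0"
  shows "AE x in lborel. r x = 0"
proof -
  have [measurable]: "r \<in> borel_measurable borel" using r by auto
  define p where "p x = max 0 (r x)" for x
  define n where "n x = max 0 (- r x)" for x
  have pn: "r x = p x - n x" "p x \<ge> 0" "n x \<ge> 0" "r x = 0 \<longleftrightarrow> p x = n x" for x by (auto simp: p_def n_def)
  have [measurable]: "p \<in> borel_measurable borel" "n \<in> borel_measurable borel" unfolding p_def n_def by measurable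
  have ip: "integrable lborel p" unfolding p_def by (intro integrable_max integrable_zero r)
  have in': "integrable lborel n" unfolding n_def by (intro integrable_max integrable_zero integrable_minus r)
  have eq: "(LINT x|lborel. complex_of_real (p x) * cis (x * y)) = (LINT x|lborel. complex_of_real (n x) * cis (x * y))" for y
  proof -
    have "(LINT x|lborel. complex_of_real (r x) * cis (x * y))
      = (LINT x|lborel. complex_of_real (p x) * cis (x * y) - complex_of_real (n x) * cis (x * y))"
      by (simp add: pn(1) algebra_simps)
    also have "\<dots> = (LINT x|lborel. complex_of_real (p x) * cis (x * y)) - (LINT x|lborel. complex_of_real (n x) * cis (x * y))"
      by (intro Bochner_Integration.integral_diff integrable_mult_cis integrable_of_real ip in') auto
    finally show ?thesis using z[of y] by simp
  qed
  define m where "m = (LINT x|lborel. p x)"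
  have mn: "m = (LINT x|lborel. n x)" using eq[of 0] by (simp add: m_def)
  have m0: "m \<ge> 0" unfolding m_def by (intro Bochner_Integration.integral_nonneg pn)
  show ?thesis
  proof (cases "m = 0")
    case True
    have "AE x in lborel. p x = 0" "AE x in lborel. n x = 0"
      using True mn ip in' pn integral_nonneg_eq_0_iff_AE[of lborel p] integral_nonneg_eq_0_iff_AE[of lborel n]
      by (auto simp: m_def)
    then show ?thesis by eventually_elim (simp add: pn)
  next
    case False
    with m0 have m: "m > 0" by simp
    define M where "M f = density lborel (\<lambda>x. ennreal (f x / m))" for f :: "real \<Rightarrow> real"
    have rd: "real_distribution (M f)" if [measurable]: "f \<in> borel_measurable borel" and f: "integrable lborel f" "\<And>x. f x \<ge> 0" "(LINT x|lborel. f x) = m" for f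
    proof -
      have "emeasure (M f) (space (M f)) = (\<integral>\<^sup>+x. ennreal (f x / m) \<partial>lborel)"
        by (simp add: M_def emeasure_density)
      also have "\<dots> = ennreal (LINT x|lborel. f x / m)"
        using f m by (intro nn_integral_eq_integral) auto
      also have "\<dots> = 1" using f m by simp
      finally have "prob_space (M f)" by (rule prob_spaceI)
      then show ?thesis
        unfolding real_distribution_def real_distribution_axioms_def by (simp add: M_def)
    qed
    have ch: "char (M f) y = (LINT x|lborel. complex_of_real (f x) * cis (x * y)) / m" if [measurable]: "f \<in> borel_measurable borel" and f: "\<And>x. f x \<ge> 0" for f y
    proof -
      have "char (M f) y = (LINT x|lborel. (f x / m) *\<^sub>R cis (y * x))"
        unfolding char_def M_def using f m by (subst integral_density) (auto simp: cis_conv_exp)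
      also have "\<dots> = (LINT x|lborel. complex_of_real (f x) * cis (x * y) / m)"
        by (simp add: scaleR_conv_of_real mult_ac)
      finally show ?thesis by simp
    qed
    have "M p = M n"
    proof (rule Levy_uniqueness)
      show "real_distribution (M p)" by (rule rd) (use ip pn in \<open>auto simp: m_def\<close>)
      show "real_distribution (M n)" by (rule rd) (use in' pn mn in auto)
      show "char (M p) = char (M n)" using ch[of p] ch[of n] pn eq by (intro ext) simp
    qed
    then have "AE x in lborel. ennreal (p x / m) = ennreal (n x / m)"
      unfolding M_def by (intro sigma_finite_measure.density_unique[OF sigma_finite_lborel]) auto
    then show ?thesis
      by eventually_elim (use m pn in \<open>simp add: ennreal_inj\<close>)
  qed
qed

text \<open>Reduction to real functions: the transform of \<open>cnj h\<close> at \<open>y\<close>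
  is the conjugate of that of \<open>h\<close> at \<open>- y\<close>, hence also 0. The factors
  \<open>1\<close> and \<open>- \<i>\<close> extract the real and the imaginary part.\<close>

lemma Fourier_unique:
  assumes h: "integrable lborel h" and z: "\<And>y. (LINT x|lborel. h x * cis (x * y)) = 0"
  shows "AE x in lborel. h x = 0"
proof -
  have zc: "(LINT x|lborel. cnj (h x) * cis (x * y)) = 0" for y
  proof -
    have "(LINT x|lborel. cnj (h x) * cis (x * y)) = (LINT x|lborel. cnj (h x * cis (x * (- y))))"
      by (intro Bochner_Integration.integral_cong refl) (simp add: cis_cnj)
    also have "\<dots> = cnj (LINT x|lborel. h x * cis (x * (- y)))" by (rule Bochner_Integration.integral_cnj)
    finally show ?thesis using z[of "- y"] by simp
  qed
  have i: "integrable lborel (\<lambda>x. h x * cis (x * y))" "integrable lborel (\<lambda>x. cnj (h x) * cis (x * y))" for y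
    by (intro integrable_mult_cis integrable_cnj h; simp)+
  have *: "AE x in lborel. Re (c * h x) = 0" for c
  proof (rule real_Fourier_unique)
    fix y
    have "(LINT x|lborel. complex_of_real (Re (c * h x)) * cis (x * y))
        = (LINT x|lborel. c / 2 * (h x * cis (x * y)) + cnj c / 2 * (cnj (h x) * cis (x * y)))"
    proof (intro Bochner_Integration.integral_cong refl)
      fix x
      have "complex_of_real (Re (c * h x)) = c / 2 * h x + cnj c / 2 * cnj (h x)"
        by (simp add: complex_eq_iff field_simps)
      then show "complex_of_real (Re (c * h x)) * cis (x * y) = c / 2 * (h x * cis (x * y)) + cnj c / 2 * (cnj (h x) * cis (x * y))"
        by (simp only: distrib_right mult.assoc)
    qed
    also have "\<dots> = 0" using i z zc by simp
    finally show "(LINT x|lborel. complex_of_real (Re (c * h x)) * cis (x * y)) = 0" .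
  qed (use h in simp)
  from *[of 1] *[of "- \<i>"] show ?thesis by eventually_elim (simp add: complex_eq_iff)
qed

text \<open>This gives the definite description in \<open>wiener_norm\<close> a value. Densities are
  only Lebesgue measurable, while the uniqueness result above concerns Borel functions; the
  difference \<open>d\<close> is therefore replaced by a Borel function \<open>h\<close> equal to it
  almost everywhere.\<close>

lemma is_fourier_integral_unique:
  assumes "is_fourier_integral f g" "is_fourier_integral f g'"
  shows "(LINT x|lebesgue. norm (g x)) = (LINT x|lebesgue. norm (g' x))"
proof -
  have i: "integrable lebesgue g" "integrable lebesgue g'" using assms by (auto simp: is_fourier_integral_def)
  define d where "d x = g x - g' x" for x
  have d: "integrable lebesgue d" unfolding d_def using i by simp
  note ie = integrable_mult_iexp
  have dz: "(LINT x|lebesgue. d x * exp (\<i> * complex_of_real (x * y))) = 0" for y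
  proof -
    have "(LINT x|lebesgue. g x * exp (\<i> * complex_of_real (x * y))) = (LINT x|lebesgue. g' x * exp (\<i> * complex_of_real (x * y)))"
      using assms unfolding is_fourier_integral_def by metis
    then show ?thesis using ie[OF i(1), of y] ie[OF i(2), of y] by (simp add: d_def left_diff_distrib)
  qed
  have "d \<in> borel_measurable lebesgue" using d by auto
  then have "(\<lambda>x. Re (d x)) \<in> borel_measurable lebesgue" "(\<lambda>x. Im (d x)) \<in> borel_measurable lebesgue" by measurable
  then obtain h1 h2 where h12: "h1 \<in> borel_measurable lborel" "AE x in lborel. Re (d x) = h1 x"
      "h2 \<in> borel_measurable lborel" "AE x in lborel. Im (d x) = h2 x"
    using completion_ex_borel_measurable_real[of "\<lambda>x. Re (d x)"] completion_ex_borel_measurable_real[of "\<lambda>x. Im (d x)"] by blast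
  define h where "h x = Complex (h1 x) (h2 x)" for x
  have "AE x in lborel. d x = h x"
    using h12(2,4) by eventually_elim (simp add: h_def complex_eq_iff)
  moreover have "h \<in> borel_measurable lborel" unfolding h_def Complex_eq using h12(1,3) by measurable
  ultimately have h: "h \<in> borel_measurable lborel" "AE x in lborel. d x = h x" by auto
  have [measurable]: "h \<in> borel_measurable borel" using h by simp
  have ael: "AE x in lebesgue. d x = h x" using h(2) by (rule AE_completion)
  have "integrable lebesgue h"
    using d h ael by (subst integrable_cong_AE[symmetric, of d _ h]) (auto intro: measurable_completion)
  then have hi: "integrable lborel h" by (subst (asm) integrable_completion) auto
  have "AE x in lborel. h x = 0"
  proof (rule Fourier_unique[OF hi])
    fix y
    have "(LINT x|lborel. h x * cis (x * y)) = (LINT x|lebesgue. h x * cis (x * y))"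
      by (rule integral_completion[symmetric]) measurable
    also have "\<dots> = (LINT x|lebesgue. d x * exp (\<i> * complex_of_real (x * y)))"
    proof (rule integral_cong_AE)
      show "(\<lambda>x. h x * cis (x * y)) \<in> borel_measurable lebesgue" by (rule measurable_completion) measurable
      show "(\<lambda>x. d x * exp (\<i> * complex_of_real (x * y))) \<in> borel_measurable lebesgue" using ie[OF d] by (rule borel_measurable_integrable)
      show "AE x in lebesgue. h x * cis (x * y) = d x * exp (\<i> * complex_of_real (x * y))"
        using ael by eventually_elim (simp add: cis_conv_exp)
    qed
    finally show "(LINT x|lborel. h x * cis (x * y)) = 0" using dz by simp
  qed
  then have "AE x in lebesgue. h x = 0" by (rule AE_completion)
  with ael have "AE x in lebesgue. norm (g x) = norm (g' x)" by eventually_elim (simp add: d_def)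
  then show ?thesis using i by (intro integral_cong_AE) auto
qed

lemma wiener_leD:
  assumes "wiener_le f B"
  shows "f \<in> wiener_algebra" "wiener_norm f \<le> B"
proof -
  obtain g where g: "is_fourier_integral f g" "(LINT x|lebesgue. norm (g x)) \<le> B"
    using assms by (auto simp: wiener_le_def)
  then show "f \<in> wiener_algebra" by (auto simp: wiener_algebra_def)
  have "wiener_norm f = (LINT x|lebesgue. norm (g x))"
    unfolding wiener_norm_def
    by (rule the_equality) (use g is_fourier_integral_unique in blast)+
  then show "wiener_norm f \<le> B" using g by simp
qed

section \<open>Dyadic pieces and series bounds\<close>

lemma C0_D:
  assumes "f \<in> C0"
  shows "continuous_on UNIV f" "bdd_above (range (\<lambda>s. norm (f s)))"
proof -
  show cont: "continuous_on UNIV f" using assms by (simp add: C0_def)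
  have "(f \<longlongrightarrow> 0) at_infinity" using assms by (simp add: C0_def)
  then have "\<forall>\<^sub>F x in at_infinity. dist (f x) 0 < 1" by (rule tendstoD) simp
  then obtain b where b: "\<And>x. b \<le> norm x \<Longrightarrow> norm (f x) < 1" by (auto simp: eventually_at_infinity)
  have "compact (f ` {-\<bar>b\<bar>..\<bar>b\<bar>})"
    by (intro compact_continuous_image continuous_on_subset[OF cont]) auto
  then obtain c where c: "\<And>x. x \<in> {-\<bar>b\<bar>..\<bar>b\<bar>} \<Longrightarrow> norm (f x) \<le> c"
    by (meson bounded_iff compact_imp_bounded imageI)
  show "bdd_above (range (\<lambda>s. norm (f s)))"
  proof (rule bdd_aboveI2)
    fix x
    show "norm (f x) \<le> max 1 c"
    proof (cases "b \<le> norm x")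
      case True then show ?thesis using b[of x] by simp
    next
      case False
      then have "x \<in> {-\<bar>b\<bar>..\<bar>b\<bar>}" by auto
      from c[OF this] show ?thesis by simp
    qed
  qed
qed

lemma norm_le_f_zero:
  assumes "f \<in> C0" "\<bar>t\<bar> \<le> \<bar>s\<bar>" shows "norm (f s) \<le> f_zero f t"
  unfolding f_zero_def
proof (rule cSUP_upper)
  show "bdd_above ((\<lambda>s. norm (f s)) ` {s. \<bar>t\<bar> \<le> \<bar>s\<bar>})"
    using C0_D(2)[OF assms(1)] by (rule bdd_above_mono) auto
qed (use assms in auto)

lemma f_zero_least:
  assumes "\<And>s. \<bar>t\<bar> \<le> \<bar>s\<bar> \<Longrightarrow> norm (f s) \<le> c" shows "f_zero f t \<le> c"
  unfolding f_zero_def by (rule cSUP_least) (use assms in auto)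

lemma f_zero_nonneg: "f \<in> C0 \<Longrightarrow> 0 \<le> f_zero f t"
  using norm_le_f_zero[of f t t] norm_ge_zero[of "f t"] by linarith

lemma f_zero_antimono: "f \<in> C0 \<Longrightarrow> \<bar>t\<bar> \<le> \<bar>t'\<bar> \<Longrightarrow> f_zero f t' \<le> f_zero f t"
  by (rule f_zero_least, rule norm_le_f_zero) auto

text \<open>\<open>esssup\<close> of a non-measurable function is \<open>top\<close>, so measurability of the derivative never
  has to be proved.\<close>
lemma esssup_restrict_AE:
  fixes h :: "real \<Rightarrow> real"
  assumes S: "S \<in> sets lebesgue" and fin: "esssup (restrict_space lebesgue S) (\<lambda>s. ennreal (h s)) < \<infinity>"
  shows "AE s in lebesgue. s \<in> S \<longrightarrow> h s \<le> enn2real (esssup (restrict_space lebesgue S) (\<lambda>s. ennreal (h s)))"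
proof -
  let ?e = "esssup (restrict_space lebesgue S) (\<lambda>s. ennreal (h s))"
  have "AE s in restrict_space lebesgue S. ennreal (h s) \<le> ?e" by (rule esssup_AE)
  then have "AE s in lebesgue. s \<in> S \<longrightarrow> ennreal (h s) \<le> ?e"
    using S by (subst (asm) AE_restrict_space_iff) auto
  then show ?thesis
  proof eventually_elim
    case (elim s)
    have "?e = ennreal (enn2real ?e)" using fin by (simp add: less_top)
    then show ?case using elim by (metis enn2real_nonneg ennreal_le_iff)
  qed
qed

text \<open>Measurability on \<open>S'\<close> passes to \<open>S\<close>; where it fails, the
  right-hand side is \<open>top\<close>.\<close>

lemma esssup_restrict_mono:
  fixes h :: "real \<Rightarrow> real"
  assumes S: "S \<in> sets lebesgue" "S' \<in> sets lebesgue" "S \<subseteq> S'"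
  shows "esssup (restrict_space lebesgue S) (\<lambda>s. ennreal (h s)) \<le> esssup (restrict_space lebesgue S') (\<lambda>s. ennreal (h s))"
proof (cases "(\<lambda>s. ennreal (h s)) \<in> borel_measurable (restrict_space lebesgue S')")
  case True
  let ?e = "esssup (restrict_space lebesgue S') (\<lambda>s. ennreal (h s))"
  have "AE s in restrict_space lebesgue S'. ennreal (h s) \<le> ?e" by (rule esssup_AE)
  then have "AE s in lebesgue. s \<in> S' \<longrightarrow> ennreal (h s) \<le> ?e"
    using S by (subst (asm) AE_restrict_space_iff) auto
  then have "AE s in lebesgue. s \<in> S \<longrightarrow> ennreal (h s) \<le> ?e"
    by eventually_elim (use S(3) in auto)
  then have "AE s in restrict_space lebesgue S. ennreal (h s) \<le> ?e"
    using S by (subst AE_restrict_space_iff) auto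
  moreover have "(\<lambda>s. ennreal (h s)) \<in> borel_measurable (restrict_space lebesgue S)"
    using True S(3) by (rule measurable_restrict_mono)
  ultimately show ?thesis by (intro esssup_I)
qed (simp add: esssup_non_measurable)

lemma outer_sets [simp]: "{s::real. c \<le> \<bar>s\<bar>} \<in> sets lebesgue" "{s::real. 0 < \<bar>s\<bar> \<and> \<bar>s\<bar> \<le> c} \<in> sets lebesgue"
  by (intro sets_completionI_sets, simp add: borel_measurable_le borel_measurable_less)+

lemma f_one_antimono: "\<bar>t\<bar> \<le> \<bar>t'\<bar> \<Longrightarrow> f_one f t' \<le> f_one f t"
  unfolding f_one_def by (rule esssup_restrict_mono) auto

lemma f_infty_mono: "\<bar>t\<bar> \<le> \<bar>t'\<bar> \<Longrightarrow> f_infty f t \<le> f_infty f t'"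
  unfolding f_infty_def by (rule esssup_restrict_mono) auto

lemma locally_absolutely_continuous_increment_bound:
  assumes f: "f \<in> C0" "locally_absolutely_continuous_on (- {0}) f"
    and ae: "AE x in lebesgue. x \<in> S \<longrightarrow> deriv_norm f x \<le> M" and M: "M \<ge> 0"
    and s: "0 < s \<and> 0 < s' \<or> s < 0 \<and> s' < 0" "{min s s'<..<max s s'} \<subseteq> S"
  shows "norm (f s' - f s) \<le> M * \<bar>s' - s\<bar>"
proof -
  have *: "norm (f b - f a) \<le> M * (b - a)" if ab: "a \<le> b" "0 < a \<or> b < 0" "{a<..<b} \<subseteq> S" for a b
  proof (rule absolutely_continuous_on_increment_bound[OF _ C0_D(1)[OF f(1)] _ ab(1) M])
    show "absolutely_continuous_on {a..b} f"
      using f(2) ab unfolding locally_absolutely_continuous_on_def by auto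
    show "AE s in lebesgue. s \<in> {a<..<b} \<longrightarrow> deriv_norm f s \<le> M"
      using ae by eventually_elim (use ab in auto)
  qed
  show ?thesis
  proof (cases "s \<le> s'")
    case True
    then show ?thesis using *[of s s'] s by (auto simp: min_def max_def split: if_splits)
  next
    case False
    then show ?thesis using *[of s' s] s by (auto simp: min_def max_def norm_minus_commute split: if_splits)
  qed
qed

text \<open>The step function on the left is measurable and lies below \<open>F\<close>, and
  monotonicity of the nonnegative integral holds for arbitrary integrands; so measurability of the
  integrands of \<open>A_0\<close>, \<open>A_1\<close> and \<open>A_01\<close> never has to be
  established.\<close>

lemma nn_integral_ge_suminf:
  assumes dis: "disjoint_family S" and S: "\<And>i. S i \<in> sets M"
    and c: "\<And>i x. x \<in> S i \<Longrightarrow> c i \<le> F x"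
  shows "(\<Sum>i. c i * emeasure M (S i)) \<le> (\<integral>\<^sup>+x. F x \<partial>M)"
proof -
  have "(\<Sum>i. c i * emeasure M (S i)) = (\<Sum>i. \<integral>\<^sup>+x. c i * indicator (S i) x \<partial>M)"
    using S by (simp add: nn_integral_cmult_indicator)
  also have "\<dots> = (\<integral>\<^sup>+x. (\<Sum>i. c i * indicator (S i) x) \<partial>M)"
    by (rule nn_integral_suminf[symmetric]) (use S in auto)
  also have "\<dots> \<le> (\<integral>\<^sup>+x. F x \<partial>M)"
  proof (rule nn_integral_mono)
    fix x
    show "(\<Sum>i. c i * indicator (S i) x) \<le> F x"
    proof (cases "\<exists>j. x \<in> S j")
      case True
      then obtain j where j: "x \<in> S j" by blast
      then have "i = j" if "x \<in> S i" for i using dis that by (auto simp: disjoint_family_on_def)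
      then have "(\<Sum>i. c i * indicator (S i) x) = (\<Sum>i\<in>{j}. c i * indicator (S i) x)"
        by (intro suminf_finite) (auto simp: indicator_def)
      then show ?thesis using j c by simp
    qed simp
  qed
  finally show ?thesis .
qed

lemma suminf_le_nn_integral:
  fixes c m :: "nat \<Rightarrow> real"
  assumes dis: "disjoint_family S" and S: "\<And>i. S i \<in> sets M" "\<And>i. emeasure M (S i) = ennreal (m i)"
    and nn: "\<And>i. 0 \<le> c i" "\<And>i. 0 \<le> m i"
    and c: "\<And>i x. x \<in> S i \<Longrightarrow> ennreal (c i) \<le> F x" and fin: "(\<integral>\<^sup>+x. F x \<partial>M) < \<infinity>"
  shows "summable (\<lambda>i. c i * m i)" "(\<Sum>i. c i * m i) \<le> enn2real (\<integral>\<^sup>+x. F x \<partial>M)"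
proof -
  have "(\<Sum>i. ennreal (c i) * emeasure M (S i)) \<le> (\<integral>\<^sup>+x. F x \<partial>M)"
    by (rule nn_integral_ge_suminf[OF dis S(1) c])
  then have le: "(\<Sum>i. ennreal (c i * m i)) \<le> (\<integral>\<^sup>+x. F x \<partial>M)"
    using nn by (simp add: S(2) ennreal_mult)
  show s: "summable (\<lambda>i. c i * m i)"
    using nn le fin by (intro summable_suminf_not_top) (auto simp: top_unique)
  have "(\<Sum>i. ennreal (c i * m i)) = ennreal (\<Sum>i. c i * m i)"
    by (rule suminf_ennreal2[OF _ s]) (use nn in simp)
  with le have "ennreal (\<Sum>i. c i * m i) \<le> (\<integral>\<^sup>+x. F x \<partial>M)" by (simp only:)
  from enn2real_mono[OF this fin[unfolded infinity_ennreal_def]]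
  have "enn2real (ennreal (\<Sum>i. c i * m i)) \<le> enn2real (\<integral>\<^sup>+x. F x \<partial>M)" .
  moreover have "0 \<le> (\<Sum>i. c i * m i)" by (rule suminf_nonneg[OF s]) (use nn in simp)
  ultimately show "(\<Sum>i. c i * m i) \<le> enn2real (\<integral>\<^sup>+x. F x \<partial>M)" by (simp only: enn2real_ennreal)
qed

text \<open>A cutoff equal to 1 up to modulus 1 and to 0 from modulus 2 on. Differences of its
  dilates at consecutive powers of 2 telescope to a partition of unity.\<close>

definition trapezoid :: "real \<Rightarrow> real" where
  "trapezoid u = max 0 (min 1 (2 - \<bar>u\<bar>))"

lemma trapezoid_simps:
  "0 \<le> trapezoid u" "trapezoid u \<le> 1" "\<bar>u\<bar> \<le> 1 \<Longrightarrow> trapezoid u = 1" "2 \<le> \<bar>u\<bar> \<Longrightarrow> trapezoid u = 0"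
  "\<bar>trapezoid u - trapezoid v\<bar> \<le> \<bar>u - v\<bar>"
  by (auto simp: trapezoid_def max_def min_def abs_if)

text \<open>The constant of \<open>Bernstein_bound\<close> for exponent 1, times 8, which bounds
  \<open>sqrt 8 + sqrt 10\<close> from the two balanced terms.\<close>

definition Lip_const :: real where
  "Lip_const = 8 * (2 * sqrt pi / ((1 - cos 1) * (1 - 2 powr (1/2 - 1))))"

lemma Lip_const_pos: "Lip_const > 0"
proof -
  have "(2::real) powr (1/2 - 1) < 1" by (intro powr_less_one) auto
  then show ?thesis using cos_1_less_1 by (simp add: Lip_const_def)
qed

lemma wiener_le_zero: "wiener_le (\<lambda>x. 0) 0"
  by (rule wiener_leI_lborel[of "\<lambda>x. 0"]) auto

text \<open>Bernstein's inequality with exponent 1. The threshold \<open>R = K / B\<close> makes low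
  and high frequencies contribute equally up to constants, and \<open>B \<le> K * T\<close> ensures
  that steps \<open>h \<le> 1 / R\<close> do not exceed \<open>T\<close>, so that the differences
  are supported in modulus at most \<open>5 * T\<close>.\<close>

lemma wiener_le_Lipschitz:
  fixes \<phi> :: "real \<Rightarrow> complex"
  assumes lip: "\<And>s t. norm (\<phi> s - \<phi> t) \<le> K * \<bar>s - t\<bar>" and bd: "\<And>t. norm (\<phi> t) \<le> B"
    and supp: "\<And>t. 4 * T < \<bar>t\<bar> \<Longrightarrow> \<phi> t = 0" and T: "T > 0" and BK: "B \<le> K * T"
  shows "wiener_le \<phi> (Lip_const * sqrt (T * K * B))"
proof (cases "B = 0")
  case True
  then have "\<phi> = (\<lambda>x. 0)" using bd by auto
  then show ?thesis using wiener_le_zero True by simp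
next
  case False
  have B: "B > 0" using False bd[of 0] norm_ge_zero[of "\<phi> 0"] by linarith
  have K: "K > 0" using B BK T by (metis less_le_trans zero_less_mult_pos2)
  have cont: "continuous_on UNIV \<phi>"
  proof -
    have "K-lipschitz_on UNIV \<phi>" using lip K by (intro lipschitz_onI) (auto simp: dist_norm)
    then show ?thesis by (rule lipschitz_on_continuous_on)
  qed
  have [measurable]: "\<phi> \<in> borel_measurable borel" using cont by (rule borel_measurable_continuous_onI)
  have int: "integrable lborel \<phi>"
  proof -
    have "integrable lborel (\<lambda>x. indicator {-4*T..4*T} x *\<^sub>R \<phi> x)"
      by (rule borel_integrable_compact) (auto intro: continuous_on_subset[OF cont])
    moreover have "(\<lambda>x. indicator {-4*T..4*T} x *\<^sub>R \<phi> x) = \<phi>"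
    proof
      fix x show "indicator {-4*T..4*T} x *\<^sub>R \<phi> x = \<phi> x"
        using supp[of x] by (cases "4 * T < \<bar>x\<bar>") (auto simp: indicator_def)
    qed
    ultimately show ?thesis by simp
  qed
  have I: "nn_L2 u \<le> ennreal ((sqrt (2 * r) * M)\<^sup>2)"
    if "\<And>t. norm (u t) \<le> M" "\<And>t. r < \<bar>t\<bar> \<Longrightarrow> u t = 0" "r > 0" for u :: "real \<Rightarrow> complex" and r M
  proof -
    have "nn_L2 u \<le> (\<integral>\<^sup>+t. ennreal (M\<^sup>2) * indicator {-r..r} t \<partial>lborel)"
    proof (rule nn_integral_mono)
      fix t
      show "ennreal ((norm (u t))\<^sup>2) \<le> ennreal (M\<^sup>2) * indicator {-r..r} t"
        using that(1)[of t] that(2)[of t] by (cases "r < \<bar>t\<bar>") (auto simp: indicator_def intro!: ennreal_leI power_mono)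
    qed
    also have "\<dots> = ennreal (M\<^sup>2) * ennreal (2 * r)"
      using that(3) by (subst nn_integral_cmult_indicator) auto
    also have "\<dots> = ennreal ((sqrt (2 * r) * M)\<^sup>2)"
      using that(3) by (simp add: ennreal_mult'[symmetric] power_mult_distrib mult_ac)
    finally show ?thesis .
  qed
  define R where "R = K / B"
  have R: "R > 0" using K B by (simp add: R_def)
  have "wiener_le \<phi> (2 * sqrt pi / ((1 - cos 1) * (1 - 2 powr (1/2 - 1))) *
      (sqrt R * (sqrt (2 * (4 * T)) * B) + (sqrt (2 * (5 * T)) * K) * R powr (1/2 - 1)))"
  proof (rule Bernstein_bound[OF int cont bd R])
    show "nn_L2 \<phi> \<le> ennreal ((sqrt (2 * (4 * T)) * B)\<^sup>2)"
      by (rule I) (use bd supp T in auto)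
    fix h :: real assume h: "0 < h" "h \<le> 1 / R"
    have "h \<le> B / K" using h by (simp add: R_def)
    also have "\<dots> \<le> T" using BK K by (simp add: field_simps)
    finally have hT: "h \<le> T" .
    have "nn_L2 (\<lambda>t. \<phi> (t + h) - \<phi> t) \<le> ennreal ((sqrt (2 * (5 * T)) * (K * h))\<^sup>2)"
    proof (rule I)
      show "norm (\<phi> (t + h) - \<phi> t) \<le> K * h" for t using lip[of "t+h" t] h by simp
      show "\<phi> (t + h) - \<phi> t = 0" if "5 * T < \<bar>t\<bar>" for t
        using supp[of t] supp[of "t + h"] that h hT T by auto
    qed (use T in auto)
    then show "nn_L2 (\<lambda>t. \<phi> (t + h) - \<phi> t) \<le> ennreal ((sqrt (2 * (5 * T)) * K * h powr 1)\<^sup>2)"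
      using h by (simp add: mult.assoc)
  qed (use B K T in auto)
  moreover have "sqrt R * (sqrt (2 * (4 * T)) * B) + (sqrt (2 * (5 * T)) * K) * R powr (1/2 - 1) \<le> 8 * sqrt (T * K * B)"
  proof -
    have sR: "sqrt R = sqrt K / sqrt B" by (simp add: R_def real_sqrt_divide)
    have p: "R powr (1/2 - 1) = sqrt B / sqrt K"
    proof -
      have "R powr (1/2 - 1) = R powr (1/2) / R" using R by (subst powr_diff) auto
      also have "\<dots> = sqrt R / (sqrt R * sqrt R)" using R by (simp add: powr_half_sqrt)
      also have "\<dots> = 1 / sqrt R" using R by (simp del: real_sqrt_mult_self)
      finally show ?thesis by (simp add: sR)
    qed
    have BB: "sqrt B * sqrt B = B" "sqrt K * sqrt K = K" using B K by auto
    have "sqrt R * (sqrt (2 * (4 * T)) * B) = sqrt 8 * (sqrt T * sqrt K * sqrt B)"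
      unfolding sR using B by (subst BB(1)[symmetric]) (simp add: real_sqrt_mult del: real_sqrt_mult_self)
    moreover have "(sqrt (2 * (5 * T)) * K) * R powr (1/2 - 1) = sqrt 10 * (sqrt T * sqrt K * sqrt B)"
      unfolding p using K by (subst BB(2)[symmetric]) (simp add: real_sqrt_mult del: real_sqrt_mult_self)
    moreover have "sqrt 8 * (sqrt T * sqrt K * sqrt B) \<le> 4 * (sqrt T * sqrt K * sqrt B)"
      "sqrt 10 * (sqrt T * sqrt K * sqrt B) \<le> 4 * (sqrt T * sqrt K * sqrt B)"
      using T K B by (auto intro!: mult_right_mono real_le_lsqrt)
    moreover have "sqrt (T * K * B) = sqrt T * sqrt K * sqrt B" by (simp add: real_sqrt_mult)
    ultimately show ?thesis by linarith
  qed
  then have "Lip_const / 8 * (sqrt R * (sqrt (2 * (4 * T)) * B) + (sqrt (2 * (5 * T)) * K) * R powr (1/2 - 1))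
      \<le> Lip_const / 8 * (8 * sqrt (T * K * B))"
    using Lip_const_pos by (intro mult_left_mono) auto
  ultimately show ?thesis
    by (elim wiener_le_mono) (simp add: Lip_const_def)
qed

text \<open>Through the common endpoint \<open>c\<close> distances add up, so gluing does not
  enlarge the constant.\<close>

lemma Lipschitz_glue:
  fixes \<phi> :: "real \<Rightarrow> complex"
  assumes A: "\<And>s t. s \<in> A \<Longrightarrow> t \<in> A \<Longrightarrow> norm (\<phi> s - \<phi> t) \<le> K * \<bar>s - t\<bar>"
    and B: "\<And>s t. s \<in> B \<Longrightarrow> t \<in> B \<Longrightarrow> norm (\<phi> s - \<phi> t) \<le> K * \<bar>s - t\<bar>"
    and c: "c \<in> A" "c \<in> B" "\<And>s. s \<in> A \<Longrightarrow> s \<le> c" "\<And>s. s \<in> B \<Longrightarrow> c \<le> s"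
    and st: "s \<in> A \<union> B" "t \<in> A \<union> B"
  shows "norm (\<phi> s - \<phi> t) \<le> K * \<bar>s - t\<bar>"
proof -
  have *: "norm (\<phi> s - \<phi> t) \<le> K * \<bar>s - t\<bar>" if "s \<in> A" "t \<in> B" for s t
  proof -
    have "norm (\<phi> s - \<phi> t) \<le> norm (\<phi> s - \<phi> c) + norm (\<phi> c - \<phi> t)"
      using norm_triangle_ineq[of "\<phi> s - \<phi> c" "\<phi> c - \<phi> t"] by simp
    also have "\<dots> \<le> K * \<bar>s - c\<bar> + K * \<bar>c - t\<bar>" using A[OF that(1) c(1)] B[OF c(2) that(2)] by linarith
    also have "\<dots> = K * \<bar>s - t\<bar>" using c(3)[OF that(1)] c(4)[OF that(2)] by (simp add: algebra_simps)
    finally show ?thesis .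
  qed
  show ?thesis
    using st A B *[of s t] *[of t s] by (auto simp: norm_minus_commute abs_minus_commute)
qed

text \<open>Regularity of \<open>g\<close> is assumed on the two half-lines beyond modulus
  \<open>T\<close> separately, because the derivative bounds available later fail to cover a
  neighbourhood of 0. The cutoff contributes slope at most \<open>2 / T\<close>, hence
  \<open>K'\<close>; with it \<open>B \<le> K' * T\<close> holds automatically, and
  \<open>T * K' * B = T * K * B + 2 * B\<^sup>2\<close> explains the summand
  \<open>B\<close>.\<close>

lemma wiener_le_dyadic_piece:
  fixes g :: "real \<Rightarrow> complex"
  assumes T: "T > 0" and B: "B \<ge> 0" and K: "K \<ge> 0"
    and bd: "\<And>t. T \<le> \<bar>t\<bar> \<Longrightarrow> \<bar>t\<bar> \<le> 4 * T \<Longrightarrow> norm (g t) \<le> B"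
    and lip: "\<And>\<sigma> s t. \<sigma> \<in> {1,-1} \<Longrightarrow> T \<le> s \<Longrightarrow> T \<le> t \<Longrightarrow> norm (g (\<sigma> * s) - g (\<sigma> * t)) \<le> K * \<bar>s - t\<bar>"
  shows "wiener_le (\<lambda>t. g t * complex_of_real (trapezoid (t / (2 * T)) - trapezoid (t / T))) (2 * Lip_const * (sqrt (T * K * B) + B))"
proof -
  define \<psi> where "\<psi> t = trapezoid (t / (2 * T)) - trapezoid (t / T)" for t
  define \<phi> where "\<phi> t = g t * complex_of_real (\<psi> t)" for t
  define K' where "K' = K + 2 * B / T"
  have K': "K' \<ge> 0" using K B T by (simp add: K'_def)
  have \<psi>1: "\<bar>\<psi> t\<bar> \<le> 1" for t
    using trapezoid_simps(1,2)[of "t / (2 * T)"] trapezoid_simps(1,2)[of "t / T"] by (auto simp: \<psi>_def)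
  have \<psi>0: "\<psi> t = 0" if "\<bar>t\<bar> \<le> T \<or> 4 * T \<le> \<bar>t\<bar>" for t
    using that
  proof
    assume "\<bar>t\<bar> \<le> T"
    then have "\<bar>t / (2 * T)\<bar> \<le> 1" "\<bar>t / T\<bar> \<le> 1" using T by (auto simp: abs_divide field_simps)
    then show ?thesis by (simp add: \<psi>_def trapezoid_simps)
  next
    assume "4 * T \<le> \<bar>t\<bar>"
    then have "2 \<le> \<bar>t / (2 * T)\<bar>" "2 \<le> \<bar>t / T\<bar>" using T by (auto simp: abs_divide field_simps)
    then show ?thesis by (simp add: \<psi>_def trapezoid_simps)
  qed
  have \<psi>L: "\<bar>\<psi> s - \<psi> t\<bar> \<le> 2 / T * \<bar>s - t\<bar>" for s t
  proof -
    have "\<bar>\<psi> s - \<psi> t\<bar> \<le> \<bar>trapezoid (s / (2 * T)) - trapezoid (t / (2 * T))\<bar> + \<bar>trapezoid (s / T) - trapezoid (t / T)\<bar>"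
      by (simp add: \<psi>_def)
    also have "\<dots> \<le> \<bar>s / (2 * T) - t / (2 * T)\<bar> + \<bar>s / T - t / T\<bar>"
      by (intro add_mono trapezoid_simps)
    also have "\<dots> = \<bar>s - t\<bar> / (2 * T) + \<bar>s - t\<bar> / T"
      using T by (simp add: diff_divide_distrib[symmetric] abs_divide)
    also have "\<dots> \<le> 2 / T * \<bar>s - t\<bar>" using T by (simp add: field_simps)
    finally show ?thesis .
  qed
  have side: "norm (\<phi> s - \<phi> t) \<le> K' * \<bar>s - t\<bar>"
    if st: "s \<in> {T..4*T} \<and> t \<in> {T..4*T} \<or> s \<in> {-4*T..-T} \<and> t \<in> {-4*T..-T}" for s t
  proof -
    have gl: "norm (g s - g t) \<le> K * \<bar>s - t\<bar>"
      using st lip[of 1 s t] lip[of "-1" "-s" "-t"] by (auto simp: abs_minus_commute)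
    have gb: "norm (g t) \<le> B" using st T by (intro bd) auto
    have "\<phi> s - \<phi> t = (g s - g t) * complex_of_real (\<psi> s) + g t * complex_of_real (\<psi> s - \<psi> t)"
      by (simp add: \<phi>_def algebra_simps)
    then have "norm (\<phi> s - \<phi> t) \<le> norm (g s - g t) * \<bar>\<psi> s\<bar> + norm (g t) * \<bar>\<psi> s - \<psi> t\<bar>"
      by (metis norm_mult norm_of_real norm_triangle_ineq)
    also have "\<dots> \<le> K * \<bar>s - t\<bar> * 1 + B * (2 / T * \<bar>s - t\<bar>)"
      using K B by (intro add_mono mult_mono gl gb \<psi>1 \<psi>L) auto
    also have "\<dots> = K' * \<bar>s - t\<bar>" by (simp add: K'_def algebra_simps)
    finally show ?thesis .
  qed
  have zero: "norm (\<phi> s - \<phi> t) \<le> K' * \<bar>s - t\<bar>" if "\<psi> s = 0" "\<psi> t = 0" for s t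
    using that K' by (simp add: \<phi>_def)
  have z1: "\<psi> t = 0" if "t \<in> {..-4*T}" for t using that T by (intro \<psi>0) auto
  have z2: "\<psi> t = 0" if "t \<in> {-T..T}" for t using that T by (intro \<psi>0) auto
  have z3: "\<psi> t = 0" if "t \<in> {4*T..}" for t using that T by (intro \<psi>0) auto
  \<comment> \<open>The cutoff vanishes on three of the five intervals determined by
    \<open>-4*T\<close>, \<open>-T\<close>, \<open>T\<close> and \<open>4*T\<close>; the estimates
    on the five are glued from left to right.\<close>
  have L1: "norm (\<phi> s - \<phi> t) \<le> K' * \<bar>s - t\<bar>" if "s \<in> {..-T}" "t \<in> {..-T}" for s t
    by (rule Lipschitz_glue[of "{..-4*T}" \<phi> K' "{-4*T..-T}" "-4*T"]) (use T that zero z1 side in auto)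
  have L2: "norm (\<phi> s - \<phi> t) \<le> K' * \<bar>s - t\<bar>" if "s \<in> {..T}" "t \<in> {..T}" for s t
    by (rule Lipschitz_glue[of "{..-T}" \<phi> K' "{-T..T}" "-T"]) (use T that zero z2 L1 in auto)
  have L3: "norm (\<phi> s - \<phi> t) \<le> K' * \<bar>s - t\<bar>" if "s \<in> {..4*T}" "t \<in> {..4*T}" for s t
    by (rule Lipschitz_glue[of "{..T}" \<phi> K' "{T..4*T}" "T"]) (use T that side L2 in auto)
  have L4: "norm (\<phi> s - \<phi> t) \<le> K' * \<bar>s - t\<bar>" for s t
    by (rule Lipschitz_glue[of "{..4*T}" \<phi> K' "{4*T..}" "4*T"]) (use T zero z3 L3 in auto)
  have "wiener_le \<phi> (Lip_const * sqrt (T * K' * B))"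
  proof (rule wiener_le_Lipschitz[OF L4])
    show "norm (\<phi> t) \<le> B" for t
    proof (cases "\<psi> t = 0")
      case True then show ?thesis using B by (simp add: \<phi>_def)
    next
      case False
      then have "\<not> (\<bar>t\<bar> \<le> T \<or> 4 * T \<le> \<bar>t\<bar>)" using \<psi>0[of t] by blast
      then have "norm (g t) \<le> B" by (intro bd) auto
      then have "norm (g t) * \<bar>\<psi> t\<bar> \<le> B * 1" using B \<psi>1 by (intro mult_mono) auto
      then show ?thesis by (simp add: \<phi>_def norm_mult)
    qed
    show "\<phi> t = 0" if "4 * T < \<bar>t\<bar>" for t using that \<psi>0[of t] by (simp add: \<phi>_def)
    show "B \<le> K' * T" using T K B by (simp add: K'_def distrib_right)
  qed (rule T)
  moreover have "sqrt (T * K' * B) \<le> 2 * (sqrt (T * K * B) + B)"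
  proof -
    have "T * K' * B = T * K * B + 2 * B\<^sup>2" using T by (simp add: K'_def distrib_left distrib_right power2_eq_square)
    also have "sqrt \<dots> \<le> sqrt (T * K * B) + sqrt (2 * B\<^sup>2)"
      using T K B by (intro sqrt_add_le_add_sqrt) auto
    also have "sqrt (2 * B\<^sup>2) \<le> 2 * B" using B by (intro real_le_lsqrt) (auto simp: power_mult_distrib)
    finally have "sqrt (T * K' * B) \<le> sqrt (T * K * B) + 2 * B" by simp
    also have "\<dots> \<le> 2 * (sqrt (T * K * B) + B)" using T K B by simp
    finally show ?thesis .
  qed
  ultimately have "wiener_le \<phi> (2 * Lip_const * (sqrt (T * K * B) + B))"
    using Lip_const_pos by (elim wiener_le_mono) (simp add: mult_left_mono mult.commute mult.left_commute)
  then show ?thesis by (simp add: \<phi>_def[abs_def] \<psi>_def)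
qed

section \<open>Dyadic sampling of the integrals in part a)\<close>

lemma disjoint_family_monotone:
  fixes S :: "nat \<Rightarrow> 'a set"
  assumes "\<And>i j. i < j \<Longrightarrow> S i \<inter> S j = {}" shows "disjoint_family S"
  using assms by (auto simp: disjoint_family_on_def) (metis disjoint_iff linorder_neqE_nat)

lemma disjoint_family_dyadic:
  "disjoint_family (\<lambda>k::nat. {2 ^ k..<2 ^ Suc k :: real})"
  "disjoint_family (\<lambda>k::nat. {(1/2) ^ Suc k<..(1/2) ^ k :: real})"
proof -
  show "disjoint_family (\<lambda>k::nat. {2 ^ k..<2 ^ Suc k :: real})"
  proof (rule disjoint_family_monotone)
    fix i j :: nat assume "i < j"
    then have "(2::real) ^ Suc i \<le> 2 ^ j" by (intro power_increasing) auto
    then show "{2 ^ i..<2 ^ Suc i :: real} \<inter> {2 ^ j..<2 ^ Suc j} = {}" by auto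
  qed
  show "disjoint_family (\<lambda>k::nat. {(1/2) ^ Suc k<..(1/2) ^ k :: real})"
  proof (rule disjoint_family_monotone)
    fix i j :: nat assume "i < j"
    then have "(1/2::real) ^ j \<le> (1/2) ^ Suc i" by (intro power_decreasing) auto
    then show "{(1/2) ^ Suc i<..(1/2) ^ i :: real} \<inter> {(1/2) ^ Suc j<..(1/2) ^ j} = {}" by auto
  qed
qed

text \<open>\<open>f_one\<close> does not increase with the modulus: an infinite value at
  \<open>m\<close> would make the integrand of \<open>A_1\<close> infinite on all of
  \<open>{m/2<..m}\<close>, where the logarithm is at least \<open>ln 2\<close>. Taking
  \<open>m \<le> 1\<close> keeps this interval inside the domain of integration.\<close>

lemma f_one_finite:
  assumes A1: "A_1 f < \<infinity>" and t: "t > 0"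
  shows "f_one f t < \<infinity>"
proof -
  define m where "m = min t 1"
  have m: "0 < m" "m \<le> 1" "m \<le> t" using t by (auto simp: m_def)
  have "(f_one f m * ennreal (ln 2)) * emeasure lebesgue {m/2<..m} = (\<integral>\<^sup>+x. (f_one f m * ennreal (ln 2)) * indicator {m/2<..m} x \<partial>lebesgue)"
    by (rule nn_integral_cmult_indicator[symmetric]) simp
  also have "\<dots> \<le> A_1 f" unfolding A_1_def
  proof (rule nn_integral_mono)
    fix x
    show "(f_one f m * ennreal (ln 2)) * indicator {m/2<..m} x \<le> f_one f x * ennreal (ln (2 / x)) * indicator {0<..1} x"
    proof (cases "x \<in> {m/2<..m}")
      case True
      then have x: "0 < x" "x \<le> 1" "x \<le> m" using m by auto
      have "f_one f m \<le> f_one f x" using x by (intro f_one_antimono) auto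
      moreover have "ln 2 \<le> ln (2 / x)" using x by (simp add: field_simps)
      ultimately show ?thesis using True x by (auto intro!: mult_mono ennreal_leI)
    qed simp
  qed
  also have "\<dots> < \<infinity>" by (rule A1)
  finally have "(f_one f m * ennreal (ln 2)) * ennreal (m/2) < \<infinity>" using m by simp
  then have "f_one f m < \<infinity>"
    using m by (auto simp: ennreal_mult_less_top ennreal_top_mult top_unique less_top[symmetric] ennreal_mult_eq_top_iff)
  then show ?thesis using f_one_antimono[of m t f] m by (auto intro: le_less_trans)
qed

text \<open>On the dyadic interval ending at \<open>(1/2) ^ i\<close>, \<open>f_one\<close> is at
  least its value at the right end and \<open>ln (2 / x)\<close> is at least
  \<open>Suc i * ln 2\<close>: the logarithm becomes the weight \<open>Suc i\<close>.
  \<open>a i\<close> itself will bound the increment of \<open>f\<close> between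
  \<open>(1/2) ^ i\<close> and twice that point.\<close>

lemma A_1_series:
  assumes A1: "A_1 f < \<infinity>"
  defines "a \<equiv> \<lambda>i::nat. (1/2) ^ i * enn2real (f_one f ((1/2) ^ i))"
  shows "summable (\<lambda>i. real (Suc i) * a i)" "(\<Sum>i. real (Suc i) * a i) \<le> 4 * enn2real (A_1 f)"
proof -
  have a0: "a i \<ge> 0" for i by (simp add: a_def)
  let ?S = "\<lambda>k::nat. {(1/2) ^ Suc k<..(1/2) ^ k :: real}"
  let ?c = "\<lambda>i. enn2real (f_one f ((1/2) ^ i)) * (real (Suc i) * ln 2)"
  have c: "ennreal (?c i) \<le> f_one f x * ennreal (ln (2 / x)) * indicator {0<..1} x" if x: "x \<in> ?S i" for i x
  proof -
    have "(0::real) < (1/2) ^ Suc i" by simp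
    then have x0: "0 < x" using x by (simp only: greaterThanAtMost_iff) linarith
    have xi: "x \<le> (1/2) ^ i" using x by simp
    also have "(1/2) ^ i \<le> (1::real)" by (intro power_le_one) auto
    finally have x1: "x \<le> 1" .
    have "f_one f ((1/2) ^ i) < \<infinity>" by (rule f_one_finite[OF A1]) simp
    then have "ennreal (enn2real (f_one f ((1/2) ^ i))) = f_one f ((1/2) ^ i)" by simp
    also have "\<dots> \<le> f_one f x" using x0 xi by (intro f_one_antimono) auto
    finally have 1: "ennreal (enn2real (f_one f ((1/2) ^ i))) \<le> f_one f x" .
    have "real (Suc i) * ln 2 = ln (2 ^ Suc i)" by (subst ln_realpow) auto
    also have "\<dots> \<le> ln (2 / x)"
    proof -
      have "(2::real) ^ Suc i \<le> 2 / x" using x0 xi by (simp add: field_simps power_divide)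
      then show ?thesis using x0 by simp
    qed
    finally have 2: "real (Suc i) * ln 2 \<le> ln (2 / x)" .
    have "ennreal (?c i) = ennreal (enn2real (f_one f ((1/2) ^ i))) * ennreal (real (Suc i) * ln 2)"
      by (rule ennreal_mult) auto
    also have "\<dots> \<le> f_one f x * ennreal (ln (2 / x))"
      by (intro mult_mono 1 ennreal_leI 2) auto
    finally show ?thesis using x0 x1 by simp
  qed
  have eq: "?c i * ((1/2) ^ i / 2) = real (Suc i) * a i * (ln 2 / 2)" for i
    by (simp only: a_def mult_ac times_divide_eq_right times_divide_eq_left)
  have "summable (\<lambda>i. ?c i * ((1/2) ^ i / 2))" "(\<Sum>i. ?c i * ((1/2) ^ i / 2)) \<le> enn2real (A_1 f)"
    unfolding A_1_def
    by (rule suminf_le_nn_integral[OF disjoint_family_dyadic(2) _ _ _ _ c, where m = "\<lambda>i. (1/2) ^ i / 2"]; use A1 in \<open>simp add: A_1_def\<close>)+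
  note s = this[unfolded eq]
  have "summable (\<lambda>i. real (Suc i) * a i * (ln 2 / 2) * (2 / ln 2))" by (rule summable_mult2[OF s(1)])
  then show sa: "summable (\<lambda>i. real (Suc i) * a i)" by simp
  \<comment> \<open>The interval has length \<open>(1/2) ^ i / 2\<close>, which leaves the factor
    \<open>ln 2 / 2\<close>, at least 1/4.\<close>
  have "(\<Sum>i. real (Suc i) * a i) * (1/4) \<le> (\<Sum>i. real (Suc i) * a i) * (ln 2 / 2)"
    using ln2_ge_two_thirds by (intro mult_left_mono suminf_nonneg[OF sa]) (auto simp: a0)
  also have "\<dots> = (\<Sum>i. real (Suc i) * a i * (ln 2 / 2))" by (rule suminf_mult2[OF sa])
  also have "\<dots> \<le> enn2real (A_1 f)" by (rule s)
  finally show "(\<Sum>i. real (Suc i) * a i) \<le> 4 * enn2real (A_1 f)" by simp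
qed

text \<open>\<open>f_zero\<close> is bounded below on \<open>{2 ^ k..<2 ^ Suc k}\<close> by its
  value at the right end, so the series starts at the argument 2; the value at 1 will be recovered
  with the help of \<open>A_1\<close>.\<close>

lemma A_0_series:
  assumes f: "f \<in> C0" and A0: "A_0 f < \<infinity>"
  shows "summable (\<lambda>k. f_zero f (2 ^ Suc k))" "(\<Sum>k. f_zero f (2 ^ Suc k)) \<le> 2 * enn2real (A_0 f)"
proof -
  let ?S = "\<lambda>k::nat. {2 ^ k..<2 ^ Suc k :: real}"
  let ?c = "\<lambda>k. f_zero f (2 ^ Suc k) / 2 ^ Suc k"
  note nn = f_zero_nonneg[OF f]
  have c: "ennreal (?c k) \<le> ennreal (f_zero f x / x) * indicator {1..} x" if x: "x \<in> ?S k" for k x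
  proof -
    have "(1::real) \<le> 2 ^ k" by simp
    then have x1: "1 \<le> x" "x \<le> 2 ^ Suc k" using x by (auto simp del: one_le_power)
    have "f_zero f (2 ^ Suc k) / 2 ^ Suc k \<le> f_zero f x / x"
      using x1 nn by (intro frac_le f_zero_antimono f) auto
    then show ?thesis using x1 by (simp add: ennreal_leI)
  qed
  have eq: "?c k * 2 ^ k = f_zero f (2 ^ Suc k) * (1/2)" for k by simp
  have "summable (\<lambda>k. ?c k * 2 ^ k)" "(\<Sum>k. ?c k * 2 ^ k) \<le> enn2real (A_0 f)"
    unfolding A_0_def
    by (rule suminf_le_nn_integral[OF disjoint_family_dyadic(1) _ _ _ _ c, where m = "\<lambda>k. 2 ^ k"]; use nn A0 in \<open>simp add: A_0_def\<close>)+
  note s = this[unfolded eq]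
  have "summable (\<lambda>k. f_zero f (2 ^ Suc k) * (1/2) * 2)" by (rule summable_mult2[OF s(1)])
  then show sa: "summable (\<lambda>k. f_zero f (2 ^ Suc k))" by simp
  have "(\<Sum>k. f_zero f (2 ^ Suc k)) * (1/2) = (\<Sum>k. f_zero f (2 ^ Suc k) * (1/2))" by (rule suminf_mult2[OF sa])
  then show "(\<Sum>k. f_zero f (2 ^ Suc k)) \<le> 2 * enn2real (A_0 f)" using s(2) by simp
qed

lemma ennreal_sqrt_ge:
  assumes "ennreal x \<le> y" "x \<ge> 0" shows "ennreal (sqrt x) \<le> ennreal_sqrt y"
proof (cases "y = \<infinity>")
  case False
  then have "ennreal (enn2real y) = y" by (simp add: less_top)
  then have "x \<le> enn2real y" using assms by (metis enn2real_nonneg ennreal_le_iff)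
  then show ?thesis using False by (simp add: ennreal_sqrt_def ennreal_leI)
qed (simp add: ennreal_sqrt_def)

text \<open>\<open>e k\<close> is the cost \<open>sqrt (T * K * B)\<close> at scale
  \<open>T = 2 ^ k\<close>. For \<open>t\<close> below \<open>2 ^ Suc k\<close> the inner integral
  contains the whole next dyadic interval, on which both factors are at least their values at
  \<open>2 ^ (k + 2)\<close>; hence the shift by two, which leaves \<open>e 0\<close> and
  \<open>e 1\<close> to be treated separately.\<close>

lemma A_01_series:
  assumes f: "f \<in> C0" and A1: "A_1 f < \<infinity>" and A01: "A_01 f < \<infinity>"
  defines "e \<equiv> \<lambda>k::nat. sqrt (2 ^ k * enn2real (f_one f (2 ^ k)) * f_zero f (2 ^ k))"
  shows "summable (\<lambda>k. e (k + 2))" "(\<Sum>k. e (k + 2)) \<le> 4 * enn2real (A_01 f)"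
proof -
  let ?S = "\<lambda>k::nat. {2 ^ k..<2 ^ Suc k :: real}"
  define w where "w k = f_zero f (2 ^ (k+2)) * enn2real (f_one f (2 ^ (k+2))) * 2 ^ Suc k" for k :: nat
  note nn = f_zero_nonneg[OF f]
  have w0: "w k \<ge> 0" for k using nn by (simp add: w_def)
  have e0: "e k \<ge> 0" for k using nn by (simp add: e_def)
  let ?c = "\<lambda>k. sqrt (w k) * (1 / 2 ^ Suc k)"
  let ?I = "\<lambda>t. \<integral>\<^sup>+s\<in>{t..}. ennreal (f_zero f s) * f_one f s \<partial>lebesgue"
  have c: "ennreal (?c k) \<le> ennreal_sqrt (?I t) * ennreal (1 / t) * indicator {1..} t" if t: "t \<in> ?S k" for k t
  proof -
    have "(1::real) \<le> 2 ^ k" by simp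
    then have t1: "1 \<le> t" "t \<le> 2 ^ Suc k" using t by (auto simp del: one_le_power)
    let ?m = "2 ^ (k+2) :: real"
    have fin: "ennreal (enn2real (f_one f ?m)) = f_one f ?m"
      using f_one_finite[OF A1, of ?m] by simp
    have "ennreal (w k) = ennreal (f_zero f ?m * enn2real (f_one f ?m)) * emeasure lebesgue (?S (Suc k))"
    proof -
      have "emeasure lebesgue (?S (Suc k)) = ennreal (2 ^ Suc k)" by simp
      then show ?thesis unfolding w_def using nn by (simp only:) (intro ennreal_mult, auto)
    qed
    also have "\<dots> = (\<integral>\<^sup>+s. ennreal (f_zero f ?m * enn2real (f_one f ?m)) * indicator (?S (Suc k)) s \<partial>lebesgue)"
      by (rule nn_integral_cmult_indicator[symmetric]) simp
    also have "\<dots> \<le> ?I t"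
    proof (rule nn_integral_mono)
      fix s
      show "ennreal (f_zero f ?m * enn2real (f_one f ?m)) * indicator (?S (Suc k)) s \<le> ennreal (f_zero f s) * f_one f s * indicator {t..} s"
      proof (cases "s \<in> ?S (Suc k)")
        case True
        then have s: "t \<le> s" "0 < s" "s \<le> ?m" using t1 by auto
        have "ennreal (f_zero f ?m * enn2real (f_one f ?m)) = ennreal (f_zero f ?m) * f_one f ?m"
          by (simp only: ennreal_mult[OF nn enn2real_nonneg] fin)
        also have "\<dots> \<le> ennreal (f_zero f s) * f_one f s"
          using s by (intro mult_mono ennreal_leI f_zero_antimono f f_one_antimono) auto
        finally show ?thesis using True s by simp
      qed simp
    qed
    finally have "ennreal (sqrt (w k)) \<le> ennreal_sqrt (?I t)"
      using w0 by (rule ennreal_sqrt_ge)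
    moreover have "1 / 2 ^ Suc k \<le> 1 / t" using t1 by (intro divide_left_mono) auto
    moreover have "ennreal (?c k) = ennreal (sqrt (w k)) * ennreal (1 / 2 ^ Suc k)"
      using w0 by (intro ennreal_mult) auto
    ultimately have "ennreal (?c k) \<le> ennreal_sqrt (?I t) * ennreal (1 / t)"
      by (simp only:) (intro mult_mono ennreal_leI, auto)
    then show ?thesis using t1 by simp
  qed
  have eq: "?c k * 2 ^ k = sqrt (w k) * (1/2)" for k by simp
  have "summable (\<lambda>k. ?c k * 2 ^ k)" "(\<Sum>k. ?c k * 2 ^ k) \<le> enn2real (A_01 f)"
    unfolding A_01_def
    by (rule suminf_le_nn_integral[OF disjoint_family_dyadic(1) _ _ _ _ c, where m = "\<lambda>k. 2 ^ k"]; use w0 A01 in \<open>simp add: A_01_def\<close>)+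
  note s = this[unfolded eq]
  have s4: "summable (\<lambda>k. 4 * (sqrt (w k) * (1/2)))" by (rule summable_mult[OF s(1)])
  have ew: "e (k + 2) \<le> 4 * (sqrt (w k) * (1/2))" for k
  proof -
    have "2 ^ (k+2) * enn2real (f_one f (2 ^ (k+2))) * f_zero f (2 ^ (k+2)) = 2 * w k"
      by (simp add: w_def)
    then have "e (k + 2) = sqrt 2 * sqrt (w k)" unfolding e_def by (simp only: real_sqrt_mult[of 2 "w k", symmetric])
    also have "\<dots> \<le> 2 * sqrt (w k)" using w0 by (intro mult_right_mono real_le_lsqrt) auto
    finally show ?thesis by simp
  qed
  show se: "summable (\<lambda>k. e (k + 2))"
    by (rule summable_comparison_test'[OF s4, of 0]) (use ew e0 in simp)
  have "(\<Sum>k. e (k + 2)) \<le> (\<Sum>k. 4 * (sqrt (w k) * (1/2)))" by (rule suminf_le[OF ew se s4])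
  also have "\<dots> = 4 * (\<Sum>k. sqrt (w k) * (1/2))" by (rule suminf_mult[OF s(1)])
  finally show "(\<Sum>k. e (k + 2)) \<le> 4 * enn2real (A_01 f)" using s(2) by linarith
qed

text \<open>\<open>a j\<close> lies in the tails with \<open>n \<le> j\<close>, that is, in
  \<open>Suc j\<close> of them. For finitely many tails this is a summation by parts whose remainder
  \<open>N * S N\<close> is bounded by the remaining part of the weighted series.\<close>

lemma sum_tails_le:
  fixes a :: "nat \<Rightarrow> real"
  assumes a: "\<And>i. a i \<ge> 0" and s: "summable (\<lambda>i. real (Suc i) * a i)"
  shows "summable a" "summable (\<lambda>n. \<Sum>i. a (i + n))" "(\<Sum>n. \<Sum>i. a (i + n)) \<le> (\<Sum>i. real (Suc i) * a i)"
proof -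
  show sa: "summable a"
    by (rule summable_comparison_test'[OF s, of 0]) (use a in \<open>simp add: distrib_right\<close>)
  define S where "S n = (\<Sum>i. a (i + n))" for n
  have sn: "summable (\<lambda>i. a (i + n))" for n using sa by (simp add: summable_iff_shift)
  have S0: "S n \<ge> 0" for n unfolding S_def using sn a by (intro suminf_nonneg) auto
  have SS: "S n = a n + S (Suc n)" for n
    unfolding S_def using suminf_split_head[OF sn[of n]] by simp
  have eq: "(\<Sum>n<N. S n) = (\<Sum>j<N. real (Suc j) * a j) + real N * S N" for N
  proof (induction N)
    case (Suc N)
    then show ?case by (simp add: SS[of N] algebra_simps)
  qed simp
  have bound: "(\<Sum>n<N. S n) \<le> (\<Sum>i. real (Suc i) * a i)" for N
  proof -
    have sN: "summable (\<lambda>i. real (Suc (i + N)) * a (i + N))"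
      using s summable_iff_shift[of "\<lambda>i. real (Suc i) * a i" N] by simp
    have "real N * S N = (\<Sum>i. real N * a (i + N))" unfolding S_def by (rule suminf_mult[OF sn, symmetric])
    also have "\<dots> \<le> (\<Sum>i. real (Suc (i + N)) * a (i + N))"
      by (rule suminf_le[OF _ summable_mult[OF sn] sN]) (use a in \<open>auto intro!: mult_right_mono\<close>)
    finally show ?thesis unfolding eq using suminf_split_initial_segment[OF s, of N] by simp
  qed
  show "summable (\<lambda>n. \<Sum>i. a (i + n))" unfolding S_def[symmetric]
    by (rule summableI_nonneg_bounded[OF S0 bound])
  then show "(\<Sum>n. \<Sum>i. a (i + n)) \<le> (\<Sum>i. real (Suc i) * a i)"
    unfolding S_def[symmetric] by (rule suminf_le_const[OF _ bound])
qed

section \<open>Representation as an absolutely convergent Fourier integral\<close>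

text \<open>\<open>f\<close> is split into \<open>f 0\<close> times a cutoff, \<open>f - f 0\<close>
  times the same cutoff, and \<open>f\<close> times its complement. The second part is cut into
  pieces at scales below 1, bounded by the tails \<open>S n\<close>; the third into pieces at scales
  from 1 on, bounded by \<open>b k\<close> and costing \<open>e k + b k\<close>.\<close>

lemma wiener_le_of_A_integrals:
  assumes f: "f \<in> C0" "locally_absolutely_continuous_on (- {0}) f"
    and A0: "A_0 f < \<infinity>" and A1: "A_1 f < \<infinity>" and A01: "A_01 f < \<infinity>"
  shows "wiener_le f (80 * Lip_const * (enn2real (A_0 f) + enn2real (A_1 f) + enn2real (A_01 f)))"
proof -
  define d where "d t = enn2real (f_one f t)" for t
  have d0: "d t \<ge> 0" for t by (simp add: d_def)
  have dmono: "d t' \<le> d t" if "0 < t" "t \<le> t'" for t t'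
    unfolding d_def using f_one_finite[OF A1 that(1)] that by (intro enn2real_mono f_one_antimono) auto
  have lipA: "norm (f (\<sigma> * s) - f (\<sigma> * s')) \<le> d t * \<bar>s - s'\<bar>"
    if t: "0 < t" and \<sigma>: "\<sigma> \<in> {1,-1}" and s: "t \<le> s" "t \<le> s'" for t \<sigma> s s'
  proof -
    have ae: "AE x in lebesgue. x \<in> {x. \<bar>t\<bar> \<le> \<bar>x\<bar>} \<longrightarrow> deriv_norm f x \<le> d t"
      unfolding d_def f_one_def using f_one_finite[OF A1 t]
      by (intro esssup_restrict_AE) (auto simp: f_one_def)
    have "norm (f (\<sigma> * s) - f (\<sigma> * s')) \<le> d t * \<bar>\<sigma> * s - \<sigma> * s'\<bar>"
      by (rule locally_absolutely_continuous_increment_bound[OF f ae d0]) (use t \<sigma> s in auto)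
    also have "\<bar>\<sigma> * s - \<sigma> * s'\<bar> = \<bar>s - s'\<bar>" using \<sigma> by auto
    finally show ?thesis .
  qed
  define p where "p i = (1/2::real) ^ i" for i
  have p0: "p i > 0" and pS: "p (Suc i) = p i / 2" for i by (auto simp: p_def)
  define a where "a i = p i * d (p i)" for i
  have a0: "a i \<ge> 0" for i using p0[of i] d0 by (simp add: a_def less_imp_le)
  define X where "X = (\<Sum>i. real (Suc i) * a i)"
  have X: "summable (\<lambda>i. real (Suc i) * a i)" "X \<le> 4 * enn2real (A_1 f)"
    using A_1_series[OF A1] by (simp_all add: X_def a_def p_def d_def)
  note tails = sum_tails_le[of a, OF a0 X(1)]
  define S where "S n = (\<Sum>i. a (i + n))" for n
  have sn: "summable (\<lambda>i. a (i + n))" for n using tails(1) by (simp add: summable_iff_shift)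
  have S0: "S n \<ge> 0" for n unfolding S_def using sn a0 by (intro suminf_nonneg) auto
  have sumS: "summable S" "suminf S \<le> X" using tails(2,3) by (simp_all add: S_def[abs_def] X_def)
  have aS: "a (i + n) \<le> S n" for i n
    using sum_le_suminf[OF sn[of n], of "{i}"] a0 by (simp add: S_def)
  have S0X: "S 0 \<le> X"
    using sum_le_suminf[OF sumS(1), of "{0}"] S0 sumS(2) by simp
  have a0X: "a 0 \<le> X" using aS[of 0 0] S0X by simp
  \<comment> \<open>Local absolute continuity gives no control across 0, so \<open>f t\<close> is
    compared with values at dyadic points approaching 0 from the side of \<open>t\<close>, each step
    costing one \<open>a i\<close>; continuity of \<open>f\<close> at 0 closes the estimate.\<close>
  have near: "norm (f t - f 0) \<le> S n" if tn: "\<bar>t\<bar> \<le> 2 * p n" for t n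
  proof (cases "t = 0")
    case True then show ?thesis using S0 by simp
  next
    case False
    define \<sigma> where "\<sigma> = sgn t"
    have \<sigma>: "\<sigma> \<in> {1,-1}" using False by (auto simp: \<sigma>_def sgn_if)
    define u where "u = \<bar>t\<bar>"
    have u: "u > 0" "u \<le> 2 * p n" "t = \<sigma> * u" using False tn by (auto simp: u_def \<sigma>_def sgn_if)
    have ind: "p (n + j) \<le> v \<Longrightarrow> v \<le> 2 * p n \<Longrightarrow> norm (f (\<sigma> * v) - f (\<sigma> * p (n + j))) \<le> (\<Sum>i<Suc j. a (i + n))" for v j
    proof (induction j arbitrary: v)
      case 0
      have "norm (f (\<sigma> * v) - f (\<sigma> * p n)) \<le> d (p n) * \<bar>v - p n\<bar>"
        using 0 by (intro lipA p0 \<sigma>) auto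
      also have "\<dots> \<le> d (p n) * p n" using 0 by (intro mult_left_mono d0) auto
      finally show ?case by (simp add: a_def mult.commute)
    next
      case (Suc j)
      have step: "norm (f (\<sigma> * v) - f (\<sigma> * p (n + Suc j))) \<le> a (Suc j + n)"
        if "p (n + Suc j) \<le> v" "v \<le> p (n + j)" for v
      proof -
        have "norm (f (\<sigma> * v) - f (\<sigma> * p (n + Suc j))) \<le> d (p (n + Suc j)) * \<bar>v - p (n + Suc j)\<bar>"
          using that by (intro lipA p0 \<sigma>) auto
        also have "\<dots> \<le> d (p (n + Suc j)) * p (n + Suc j)"
          using that pS[of "n + j"] by (intro mult_left_mono d0) auto
        finally show ?thesis by (simp add: a_def mult.commute add.commute)
      qed
      show ?case
      proof (cases "p (n + j) \<le> v")
        case True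
        have "norm (f (\<sigma> * v) - f (\<sigma> * p (n + Suc j)))
          \<le> norm (f (\<sigma> * v) - f (\<sigma> * p (n + j))) + norm (f (\<sigma> * p (n + j)) - f (\<sigma> * p (n + Suc j)))"
          using norm_triangle_ineq[of "f (\<sigma> * v) - f (\<sigma> * p (n + j))" "f (\<sigma> * p (n + j)) - f (\<sigma> * p (n + Suc j))"] by simp
        also have "\<dots> \<le> (\<Sum>i<Suc j. a (i + n)) + a (Suc j + n)"
          using pS[of "n + j"] p0[of "n+j"] by (intro add_mono Suc.IH True Suc.prems step) auto
        finally show ?thesis by simp
      next
        case False
        then have "norm (f (\<sigma> * v) - f (\<sigma> * p (n + Suc j))) \<le> a (Suc j + n)"
          using Suc.prems by (intro step) auto
        also have "\<dots> \<le> (\<Sum>i<Suc (Suc j). a (i + n))" using a0 by (simp add: sum_nonneg)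
        finally show ?thesis .
      qed
    qed
    have p_lim: "(\<lambda>j. p (n + j)) \<longlonglongrightarrow> 0"
    proof -
      have "p \<longlonglongrightarrow> 0" unfolding p_def by (rule LIMSEQ_power_zero) simp
      from LIMSEQ_ignore_initial_segment[OF this, of n] show ?thesis by (simp add: add.commute)
    qed
    have "(\<lambda>j. \<sigma> * p (n + j)) \<longlonglongrightarrow> \<sigma> * 0" by (intro tendsto_intros p_lim)
    moreover have "isCont f 0" using C0_D(1)[OF f(1)] by (simp add: continuous_on_eq_continuous_at)
    ultimately have "(\<lambda>j. f (\<sigma> * p (n + j))) \<longlonglongrightarrow> f 0" by (intro isCont_tendsto_compose[of 0 f]) auto
    then have lim: "(\<lambda>j. norm (f t - f (\<sigma> * p (n + j)))) \<longlonglongrightarrow> norm (f t - f 0)" by (intro tendsto_intros)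
    have "\<forall>\<^sub>F j in sequentially. p (n + j) < u" using p_lim u(1) by (rule order_tendstoD)
    then have "\<forall>\<^sub>F j in sequentially. norm (f t - f (\<sigma> * p (n + j))) \<le> S n"
    proof eventually_elim
      case (elim j)
      have "norm (f t - f (\<sigma> * p (n + j))) \<le> (\<Sum>i<Suc j. a (i + n))"
        unfolding u(3) using elim u(2) by (intro ind) auto
      also have "\<dots> \<le> S n" unfolding S_def using sn a0 by (intro sum_le_suminf) auto
      finally show ?case .
    qed
    with lim show ?thesis by (rule tendsto_upperbound) simp
  qed

  have Q: "wiener_le (\<lambda>t. (f t - f 0) * complex_of_real (trapezoid t)) (4 * Lip_const * X)"
  proof -
    define F where "F n t = (f t - f 0) * complex_of_real (trapezoid (t / (2 * p (Suc n))) - trapezoid (t / p (Suc n)))" for n t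
    have F: "wiener_le (F n) (4 * Lip_const * S n)" for n
    proof -
      have "wiener_le (F n) (2 * Lip_const * (sqrt (p (Suc n) * d (p (Suc n)) * S n) + S n))"
        unfolding F_def
      proof (rule wiener_le_dyadic_piece)
        show "norm (f t - f 0) \<le> S n" if "\<bar>t\<bar> \<le> 4 * p (Suc n)" for t
          using that by (intro near) (simp add: pS)
        show "norm (f (\<sigma> * s) - f 0 - (f (\<sigma> * t) - f 0)) \<le> d (p (Suc n)) * \<bar>s - t\<bar>"
          if "\<sigma> \<in> {1,-1}" "p (Suc n) \<le> s" "p (Suc n) \<le> t" for \<sigma> s t
          using lipA[OF p0 that] by simp
      qed (use p0 S0 d0 in auto)
      \<comment> \<open>With \<open>T = p (Suc n)\<close>, \<open>K = d T\<close> and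
        \<open>B = S n\<close>, the product \<open>T * K\<close> is \<open>a (Suc n)\<close>, a term
        of the tail \<open>S n\<close>; so the square root is absorbed.\<close>
      moreover have "sqrt (p (Suc n) * d (p (Suc n)) * S n) \<le> S n"
      proof (rule real_le_lsqrt[OF S0])
        have "a (Suc n) \<le> S n" using aS[of 1 n] by simp
        then show "p (Suc n) * d (p (Suc n)) * S n \<le> (S n)\<^sup>2"
          using S0[of n] unfolding a_def[symmetric] power2_eq_square by (intro mult_right_mono) auto
      qed
      then have "2 * Lip_const * (sqrt (p (Suc n) * d (p (Suc n)) * S n) + S n) \<le> 2 * Lip_const * (S n + S n)"
        using Lip_const_pos by (intro mult_left_mono) auto
      ultimately show ?thesis by (elim wiener_le_mono) simp
    qed
    have "(\<lambda>n. F n t) sums ((f t - f 0) * complex_of_real (trapezoid t))" for t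
    proof (cases "t = 0")
      case False
      define c where "c n = trapezoid (t / p n)" for n
      have "c \<longlonglongrightarrow> 0"
      proof (rule tendsto_eventually)
        have "p \<longlonglongrightarrow> 0" unfolding p_def by (rule LIMSEQ_power_zero) simp
        then have "\<forall>\<^sub>F n in sequentially. p n < \<bar>t\<bar> / 2" using False by (intro order_tendstoD) auto
        then show "\<forall>\<^sub>F n in sequentially. c n = 0"
        proof eventually_elim
          case (elim n)
          then have "2 \<le> \<bar>t / p n\<bar>" using p0[of n] by (simp add: abs_divide field_simps)
          then show ?case unfolding c_def by (rule trapezoid_simps)
        qed
      qed
      from telescope_sums'[OF this] have "(\<lambda>n. c n - c (Suc n)) sums trapezoid t" by (simp add: c_def p_def)
      then have "(\<lambda>n. (f t - f 0) * complex_of_real (c n - c (Suc n))) sums ((f t - f 0) * complex_of_real (trapezoid t))"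
        by (intro sums_mult) (simp only: sums_of_real_iff)
      then show ?thesis by (simp add: F_def c_def pS)
    qed (simp add: F_def)
    from wiener_le_suminf[OF F summable_mult[OF sumS(1)] this]
    have "wiener_le (\<lambda>t. (f t - f 0) * complex_of_real (trapezoid t)) (4 * Lip_const * suminf S)"
      by (simp add: suminf_mult[OF sumS(1)])
    then show ?thesis by (rule wiener_le_mono) (use sumS(2) Lip_const_pos in simp)
  qed

  define b where "b k = f_zero f (2 ^ k)" for k :: nat
  have b0: "b k \<ge> 0" for k unfolding b_def by (rule f_zero_nonneg[OF f(1)])
  define e where "e k = sqrt (2 ^ k * d (2 ^ k) * b k)" for k :: nat
  have e0: "e k \<ge> 0" for k using b0 d0 by (simp add: e_def)
  define Y where "Y = (\<Sum>k. b (Suc k))"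
  define Z where "Z = (\<Sum>k. e (k + 2))"
  have Y: "summable (\<lambda>k. b (Suc k))" "Y \<le> 2 * enn2real (A_0 f)"
    using A_0_series[OF f(1) A0] by (simp_all add: Y_def b_def)
  have Z: "summable (\<lambda>k. e (k + 2))" "Z \<le> 4 * enn2real (A_01 f)"
    using A_01_series[OF f(1) A1 A01] by (simp_all add: Z_def e_def d_def b_def)
  have sb: "summable b" using Y(1) by (simp only: summable_Suc_iff)
  have se: "summable e" using Z(1) by (simp only: summable_iff_shift)
  have b_eq: "suminf b = b 0 + Y" unfolding Y_def using suminf_split_head[OF sb] by simp
  have e_eq: "suminf e = e 0 + e 1 + Z"
    unfolding Z_def using suminf_split_initial_segment[OF se, of 2] by (simp add: numeral_2_eq_2)
  have b1Y: "b 1 \<le> Y"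
    using sum_le_suminf[OF Y(1), of "{0}"] b0 by (simp add: Y_def)
  \<comment> \<open>For modulus between 1 and 2, \<open>f\<close> is compared with its value at the
    point of modulus 2 on the same side; the slope there is at most \<open>d 1\<close>, which equals
    \<open>a 0\<close>.\<close>
  have b0le: "b 0 \<le> Y + X"
  proof -
    have "norm (f s) \<le> b 1 + a 0" if s1: "1 \<le> \<bar>s\<bar>" for s
    proof (cases "\<bar>s\<bar> \<le> 2")
      case True
      define \<sigma> where "\<sigma> = sgn s"
      have \<sigma>: "\<sigma> \<in> {1,-1}" "s = \<sigma> * \<bar>s\<bar>" "\<bar>\<sigma> * 2\<bar> = 2" using s1 by (auto simp: \<sigma>_def sgn_if)
      have "norm (f (\<sigma> * \<bar>s\<bar>) - f (\<sigma> * 2)) \<le> d 1 * \<bar>\<bar>s\<bar> - 2\<bar>" by (rule lipA) (use \<sigma> s1 in auto)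
      also have "\<dots> \<le> d 1 * 1" using True s1 by (intro mult_left_mono d0) auto
      finally have "norm (f s - f (\<sigma> * 2)) \<le> a 0" using \<sigma>(2) by (simp add: a_def p_def)
      moreover have "norm (f (\<sigma> * 2)) \<le> b 1" unfolding b_def by (rule norm_le_f_zero[OF f(1)]) (use \<sigma> in simp)
      ultimately show ?thesis using norm_triangle_sub[of "f s" "f (\<sigma> * 2)"] by linarith
    next
      case False
      then have "norm (f s) \<le> b 1" unfolding b_def by (intro norm_le_f_zero[OF f(1)]) auto
      then show ?thesis using a0[of 0] by linarith
    qed
    then have "b 0 \<le> b 1 + a 0" unfolding b_def[of 0] by (intro f_zero_least) auto
    then show ?thesis using b1Y a0X by linarith
  qed
  \<comment> \<open>The two costs missed by \<open>A_01_series\<close> are reduced by the mean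
    inequality to quantities already bounded by \<open>X\<close> and \<open>Y\<close>.\<close>
  have am: "sqrt (x * y) \<le> x + y" if "x \<ge> 0" "y \<ge> 0" for x y :: real
  proof -
    have "sqrt (x * y) \<le> (x + y) / 2" by (rule arith_geo_mean_sqrt[OF that])
    also have "\<dots> \<le> x + y" using that by simp
    finally show ?thesis .
  qed
  have e0le: "e 0 \<le> Y + 2 * X"
    using am[OF d0[of 1] b0[of 0]] b0le a0X by (simp add: e_def a_def p_def)
  have e1le: "e 1 \<le> 2 * X + Y"
  proof -
    have "d 2 \<le> X" using dmono[of 1 2] a0X by (simp add: a_def p_def)
    moreover have "e 1 \<le> 2 * d 2 + b 1" using am[of "2 * d 2" "b 1"] d0[of 2] b0[of 1] by (simp add: e_def)
    ultimately show ?thesis using b1Y by linarith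
  qed

  have W: "wiener_le (\<lambda>t. f t * complex_of_real (1 - trapezoid t)) (2 * Lip_const * (suminf e + suminf b))"
  proof -
    define F where "F k t = f t * complex_of_real (trapezoid (t / (2 * 2 ^ k)) - trapezoid (t / 2 ^ k))" for k :: nat and t
    have F: "wiener_le (F k) (2 * Lip_const * (e k + b k))" for k
      unfolding F_def e_def
    proof (rule wiener_le_dyadic_piece)
      show "norm (f t) \<le> b k" if "2 ^ k \<le> \<bar>t\<bar>" for t
        unfolding b_def by (rule norm_le_f_zero[OF f(1)]) (use that in simp)
      show "norm (f (\<sigma> * s) - f (\<sigma> * t)) \<le> d (2 ^ k) * \<bar>s - t\<bar>"
        if "\<sigma> \<in> {1,-1}" "2 ^ k \<le> s" "2 ^ k \<le> t" for \<sigma> s t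
        by (rule lipA) (use that in auto)
    qed (use b0 d0 in auto)
    have "(\<lambda>k. F k t) sums (f t * complex_of_real (1 - trapezoid t))" for t
    proof -
      define c where "c k = trapezoid (t / 2 ^ k)" for k :: nat
      have "c \<longlonglongrightarrow> 1"
      proof (rule tendsto_eventually)
        obtain m where m: "\<bar>t\<bar> < 2 ^ m" using real_arch_pow[of 2 "\<bar>t\<bar>"] by auto
        show "\<forall>\<^sub>F k in sequentially. c k = 1"
        proof (rule eventually_sequentiallyI)
          fix k assume "m \<le> k"
          then have "(2::real) ^ m \<le> 2 ^ k" by (intro power_increasing) auto
          then have "\<bar>t\<bar> \<le> 2 ^ k" using m by linarith
          then have "\<bar>t / 2 ^ k\<bar> \<le> 1" by (simp add: abs_divide field_simps)
          then show "c k = 1" unfolding c_def by (rule trapezoid_simps)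
        qed
      qed
      from telescope_sums[OF this] have "(\<lambda>k. c (Suc k) - c k) sums (1 - trapezoid t)" by (simp add: c_def)
      then have "(\<lambda>k. f t * complex_of_real (c (Suc k) - c k)) sums (f t * complex_of_real (1 - trapezoid t))"
        by (intro sums_mult) (simp only: sums_of_real_iff)
      then show ?thesis by (simp add: F_def c_def)
    qed
    from wiener_le_suminf[OF F summable_mult[OF summable_add[OF se sb]] this]
    show ?thesis by (simp add: suminf_mult[OF summable_add[OF se sb]] suminf_add[OF se sb])
  qed

  have P: "wiener_le (\<lambda>t. f 0 * complex_of_real (trapezoid t)) (Lip_const * norm (f 0))"
  proof -
    have "wiener_le (\<lambda>t. f 0 * complex_of_real (trapezoid t)) (Lip_const * sqrt (1 * norm (f 0) * norm (f 0)))"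
    proof (rule wiener_le_Lipschitz)
      show "norm (f 0 * complex_of_real (trapezoid s) - f 0 * complex_of_real (trapezoid t)) \<le> norm (f 0) * \<bar>s - t\<bar>" for s t
      proof -
        have "norm (f 0 * complex_of_real (trapezoid s) - f 0 * complex_of_real (trapezoid t)) = norm (f 0) * \<bar>trapezoid s - trapezoid t\<bar>"
          by (simp only: right_diff_distrib[symmetric] of_real_diff[symmetric] norm_mult norm_of_real)
        also have "\<dots> \<le> norm (f 0) * \<bar>s - t\<bar>" by (intro mult_left_mono trapezoid_simps) auto
        finally show ?thesis .
      qed
      show "norm (f 0 * complex_of_real (trapezoid t)) \<le> norm (f 0)" for t
        using trapezoid_simps(1,2)[of t] by (simp add: norm_mult mult_left_le)
      show "f 0 * complex_of_real (trapezoid t) = 0" if "4 * 1 < \<bar>t\<bar>" for t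
        using that trapezoid_simps(4)[of t] by simp
    qed auto
    then show ?thesis by simp
  qed
  have f0: "norm (f 0) \<le> Y + 2 * X"
  proof -
    have "norm (f 1 - f 0) \<le> S 0" by (rule near) (simp add: p_def)
    moreover have "norm (f 1) \<le> b 0" unfolding b_def by (rule norm_le_f_zero[OF f(1)]) simp
    ultimately show ?thesis
      using norm_triangle_sub[of "f 0" "f 1"] b0le S0X by (simp add: norm_minus_commute)
  qed
  have "wiener_le (\<lambda>t. f 0 * complex_of_real (trapezoid t) + (f t - f 0) * complex_of_real (trapezoid t) + f t * complex_of_real (1 - trapezoid t))
     (Lip_const * norm (f 0) + 4 * Lip_const * X + 2 * Lip_const * (suminf e + suminf b))"
    by (intro wiener_le_add P Q W)
  moreover have "(\<lambda>t. f 0 * complex_of_real (trapezoid t) + (f t - f 0) * complex_of_real (trapezoid t) + f t * complex_of_real (1 - trapezoid t)) = f"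
    by (intro ext) (simp add: algebra_simps)
  moreover have "Lip_const * norm (f 0) + 4 * Lip_const * X + 2 * Lip_const * (suminf e + suminf b)
      \<le> 80 * Lip_const * (enn2real (A_0 f) + enn2real (A_1 f) + enn2real (A_01 f))"
  proof -
    \<comment> \<open>The left side is at most \<open>9 * Y + 16 * X + 2 * Z\<close>, hence at most
      18, 64 and 8 times \<open>A_0\<close>, \<open>A_1\<close> and \<open>A_01\<close>; 80 is a
      common majorant.\<close>
    have "norm (f 0) + 4 * X + (2 * suminf e + 2 * suminf b)
        \<le> 80 * enn2real (A_0 f) + 80 * enn2real (A_1 f) + 80 * enn2real (A_01 f)"
      using f0 b_eq e_eq b0le e0le e1le X(2) Y(2) Z(2)
        enn2real_nonneg[of "A_0 f"] enn2real_nonneg[of "A_1 f"] enn2real_nonneg[of "A_01 f"]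
      by linarith
    from mult_left_mono[OF this, of Lip_const] show ?thesis
      using Lip_const_pos by (simp add: algebra_simps)
  qed
  ultimately show ?thesis by (simp only:) (rule wiener_le_mono)
qed

section \<open>Decay and smoothness from the supremum in part b)\<close>

lemma nn_integral_powr_finite:
  fixes p :: real
  assumes p: "p > 1"
  shows "(\<integral>\<^sup>+t. ennreal ((1 + \<bar>t\<bar>) powr - p) \<partial>lborel) < \<infinity>"
proof -
  let ?h = "\<lambda>t::real. (1 + \<bar>t\<bar>) powr - p"
  have half: "(\<integral>\<^sup>+t. ennreal (?h t) * indicator {0..} t \<partial>lborel) = ennreal (0 - (- ((1 + 0) powr (1 - p) / (p - 1))))"
  proof (rule nn_integral_FTC_atLeast)
    show "?h \<in> borel_measurable borel" by measurable
    show "((\<lambda>t. - ((1 + t) powr (1 - p) / (p - 1))) has_real_derivative ?h x) (at x)" if "0 \<le> x" for x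
    proof -
      have "((\<lambda>t. - ((1 + t) powr (1 - p) / (p - 1))) has_real_derivative - ((1 - p) * (1 + x) powr (1 - p - 1) / (p - 1))) (at x)"
        using that p by (auto intro!: derivative_eq_intros)
      moreover have "- ((1 - p) * (1 + x) powr (1 - p - 1) / (p - 1)) = ?h x"
        using that p by (simp add: field_simps)
      ultimately show ?thesis by simp
    qed
    have "((\<lambda>t. (1 + t) powr (1 - p)) \<longlongrightarrow> 0) at_top"
      by (rule tendsto_neg_powr) (use p in \<open>auto intro: filterlim_tendsto_add_at_top filterlim_ident\<close>)
    then have "((\<lambda>t. - ((1 + t) powr (1 - p) / (p - 1))) \<longlongrightarrow> - (0 / (p - 1))) at_top"
      using p by (intro tendsto_intros) auto
    then show "((\<lambda>t. - ((1 + t) powr (1 - p) / (p - 1))) \<longlongrightarrow> 0) at_top" by simp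
  qed simp
  have refl: "(\<integral>\<^sup>+t. ennreal (?h t) * indicator {..0} t \<partial>lborel) = (\<integral>\<^sup>+t. ennreal (?h t) * indicator {0..} t \<partial>lborel)"
    by (subst nn_integral_real_affine[of _ "-1" 0]) (auto simp: indicator_def intro!: nn_integral_cong)
  have "(\<integral>\<^sup>+t. ennreal (?h t) \<partial>lborel) \<le> (\<integral>\<^sup>+t. ennreal (?h t) * indicator {0..} t + ennreal (?h t) * indicator {..0} t \<partial>lborel)"
    by (intro nn_integral_mono) (auto simp: indicator_def)
  also have "\<dots> = (\<integral>\<^sup>+t. ennreal (?h t) * indicator {0..} t \<partial>lborel) + (\<integral>\<^sup>+t. ennreal (?h t) * indicator {..0} t \<partial>lborel)"
    by (rule nn_integral_add) measurable
  also have "\<dots> < \<infinity>" unfolding refl half by simp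
  finally show ?thesis .
qed

text \<open>A zero of \<open>f_zero\<close> would make \<open>f\<close> vanish beyond some modulus,
  and its derivative with it. Positivity is what lets a finite \<open>A_sup\<close> force
  \<open>f_infty\<close> to be finite, by division.\<close>

lemma f_zero_pos:
  assumes f: "f \<in> C0" and nb: "\<not> deriv_bounded_near_infinity f"
  shows "f_zero f t > 0"
proof (rule ccontr)
  assume "\<not> f_zero f t > 0"
  then have z: "f s = 0" if "\<bar>t\<bar> \<le> \<bar>s\<bar>" for s
  proof -
    have "norm (f s) \<le> 0" using norm_le_f_zero[OF f that] \<open>\<not> f_zero f t > 0\<close> by linarith
    then show ?thesis by simp
  qed
  have "deriv_norm f s \<le> 0" if s: "\<bar>t\<bar> + 1 \<le> \<bar>s\<bar>" for s
  proof -
    have "(f has_vector_derivative 0) (at s)"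
    proof (rule has_vector_derivative_transform_within_open)
      show "((\<lambda>x. 0) has_vector_derivative (0::complex)) (at s)" by simp
      show "open {x. \<bar>t\<bar> < \<bar>x\<bar>}" by (intro open_Collect_less continuous_intros)
      show "s \<in> {x. \<bar>t\<bar> < \<bar>x\<bar>}" using s by simp
      show "\<And>x. x \<in> {x. \<bar>t\<bar> < \<bar>x\<bar>} \<Longrightarrow> 0 = f x" using z by simp
    qed
    then show ?thesis by (simp add: vector_derivative_at)
  qed
  then have "AE s in lebesgue. \<bar>t\<bar> + 1 \<le> \<bar>s\<bar> \<longrightarrow> deriv_norm f s \<le> 0" by (intro AE_I2) simp
  then show False using nb unfolding deriv_bounded_near_infinity_def by blast
qed

text \<open>Since \<open>f_infty\<close> is at least \<open>F\<close> from \<open>4 * pi\<close> on,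
  a finite supremum forces \<open>f\<close> to decay like the power \<open>- 1/\<delta>\<close>,
  which gives integrability and the L2 bound. The interpolated bound for differences carries the
  weight \<open>(1 + \<bar>t\<bar>) powr - \<alpha>\<close>, square integrable because
  \<open>\<alpha> > 1/2\<close>. Bernstein's inequality is applied with threshold 1, so only steps
  \<open>h \<le> 1\<close> occur.\<close>

lemma wiener_le_of_A_sup:
  assumes f: "f \<in> C0" "locally_absolutely_continuous_on (- {0}) f"
    and nb: "\<not> deriv_bounded_near_infinity f"
    and z: "\<And>t. \<bar>t\<bar> \<le> 2 * pi \<Longrightarrow> f t = 0"
    and pos: "f_infty f (4 * pi) > 0" and fin: "A_sup \<delta> f < \<infinity>" and \<delta>: "0 < \<delta>" "\<delta> < 1"
  defines "A \<equiv> A_delta \<delta> f" and "F \<equiv> enn2real (f_infty f (4 * pi))"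
    and "J \<equiv> \<lambda>p. enn2real (\<integral>\<^sup>+t. ennreal ((1 + \<bar>t\<bar>) powr - p) \<partial>lborel)" and "\<alpha> \<equiv> 1 / (1 + \<delta>)"
  shows "wiener_le f (2 * sqrt pi / ((1 - cos 1) * (1 - 2 powr (1/2 - \<alpha>))) *
      (2 powr (1/\<delta>) * sqrt (J (2/\<delta>)) * (A * A powr (1/\<delta>) * F powr (-1/\<delta>)) + 4 powr \<alpha> * sqrt (J (2 * \<alpha>)) * A))"
proof -
  define S where "S = enn2real (A_sup \<delta> f)"
  have \<alpha>: "\<alpha> > 1/2" "\<alpha> > 0" using \<delta> by (auto simp: \<alpha>_def field_simps)
  note f0pos = f_zero_pos[OF f(1) nb]
  have le: "ennreal (t * f_zero f t powr \<delta>) * f_infty f (t + 2 * pi) \<le> A_sup \<delta> f" if "2 * pi \<le> t" for t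
    unfolding A_sup_def using that by (intro SUP_upper) auto
  have finf: "f_infty f u < \<infinity>" if u: "u \<ge> 4 * pi" for u
  proof -
    have "2 * pi \<le> u - 2 * pi" "0 < u - 2 * pi" using u pi_gt_zero by linarith+
    define c where "c = (u - 2 * pi) * f_zero f (u - 2 * pi) powr \<delta>"
    have "ennreal c * f_infty f u < \<infinity>"
      using le[OF \<open>2 * pi \<le> u - 2 * pi\<close>] fin by (simp add: c_def le_less_trans)
    moreover have "c > 0"
      using \<open>0 < u - 2 * pi\<close> f0pos[of "u - 2 * pi"] by (simp add: c_def)
    ultimately show ?thesis
      by (cases "f_infty f u = top") (auto simp: ennreal_mult_top less_top[symmetric])
  qed
  define \<Phi> where "\<Phi> u = enn2real (f_infty f u)" for u
  have \<Phi>0: "\<Phi> u \<ge> 0" for u by (simp add: \<Phi>_def)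
  have F: "F > 0" "F = \<Phi> (4 * pi)"
    using pos finf[of "4 * pi"] by (auto simp: F_def \<Phi>_def enn2real_positive_iff)
  have \<Phi>F: "F \<le> \<Phi> u" if "u \<ge> 4 * pi" for u
    unfolding F(2) \<Phi>_def using that finf[OF that] pi_gt_zero by (intro enn2real_mono f_infty_mono) auto
  have key: "t * f_zero f t powr \<delta> * \<Phi> (t + 2 * pi) \<le> S" if t: "2 * pi \<le> t" for t
  proof -
    have "t \<ge> 0" using t pi_gt_zero by linarith
    have "ennreal (t * f_zero f t powr \<delta> * \<Phi> (t + 2 * pi)) = ennreal (t * f_zero f t powr \<delta>) * ennreal (\<Phi> (t + 2 * pi))"
      by (intro ennreal_mult) (use \<open>t \<ge> 0\<close> \<Phi>0 in auto)
    also have "ennreal (\<Phi> (t + 2 * pi)) = f_infty f (t + 2 * pi)"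
      using finf[of "t + 2 * pi"] t by (simp add: \<Phi>_def)
    also have "ennreal (t * f_zero f t powr \<delta>) * f_infty f (t + 2 * pi) \<le> ennreal S"
      using le[OF t] fin by (simp add: S_def)
    finally show ?thesis by (simp add: S_def ennreal_le_iff)
  qed
  have S: "S > 0"
  proof -
    have "0 < 2 * pi * f_zero f (2 * pi) powr \<delta> * \<Phi> (2 * pi + 2 * pi)"
      using f0pos[of "2 * pi"] F by simp
    also have "\<dots> \<le> S" by (rule key) simp
    finally show ?thesis .
  qed
  have A_eq: "A = S powr \<alpha>" by (simp add: A_def A_delta_def S_def \<alpha>_def)
  have A: "A > 0" using S by (simp add: A_eq)
  define G where "G = (2 * S / F) powr (1/\<delta>)"
  have G0: "G \<ge> 0" by (simp add: G_def)
  have decay: "norm (f t) \<le> G * (1 + \<bar>t\<bar>) powr - (1/\<delta>)" for t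
  proof (cases "\<bar>t\<bar> \<le> 2 * pi")
    case True then show ?thesis using z[OF True] G0 by simp
  next
    case False
    then have t: "2 * pi \<le> \<bar>t\<bar>" "1 \<le> \<bar>t\<bar>" using pi_gt3 by auto
    define n where "n = norm (f t)"
    have n: "0 \<le> n" "n \<le> f_zero f \<bar>t\<bar>" unfolding n_def by (auto intro: norm_le_f_zero[OF f(1)])
    \<comment> \<open>Here \<open>\<bar>t\<bar> \<ge> 1\<close>, so the weight
      \<open>\<bar>t\<bar>\<close> may be replaced by half of \<open>1 + \<bar>t\<bar>\<close>;
      \<open>\<Phi>\<close> is replaced by its lower bound \<open>F\<close>.\<close>
    have "(1 + \<bar>t\<bar>) / 2 * n powr \<delta> * F \<le> \<bar>t\<bar> * f_zero f \<bar>t\<bar> powr \<delta> * \<Phi> (\<bar>t\<bar> + 2 * pi)"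
      using t n F(1) \<delta> by (intro mult_mono powr_mono2 \<Phi>F) auto
    also have "\<dots> \<le> S" by (rule key[OF t(1)])
    finally have "(1 + \<bar>t\<bar>) / 2 * n powr \<delta> * F \<le> S" .
    then have "n powr \<delta> * (F * (1 + \<bar>t\<bar>)) \<le> 2 * S" by (simp add: algebra_simps)
    then have "n powr \<delta> \<le> 2 * S / (F * (1 + \<bar>t\<bar>))"
      using F(1) by (subst pos_le_divide_eq) (auto intro: mult_pos_pos)
    then have "n powr \<delta> \<le> (2 * S / F) / (1 + \<bar>t\<bar>)" by (simp only: divide_divide_eq_left)
    then have "(n powr \<delta>) powr (1/\<delta>) \<le> ((2 * S / F) / (1 + \<bar>t\<bar>)) powr (1/\<delta>)"
      using \<delta> by (intro powr_mono2) auto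
    also have "(n powr \<delta>) powr (1/\<delta>) = n" using n \<delta> by (simp add: powr_powr)
    also have "((2 * S / F) / (1 + \<bar>t\<bar>)) powr (1/\<delta>) = G * (1 + \<bar>t\<bar>) powr - (1/\<delta>)"
      using S F(1) by (subst powr_divide) (auto simp: G_def powr_minus divide_inverse)
    finally show ?thesis by (simp add: n_def)
  qed
  have diff: "norm (f (t + h) - f t) \<le> (4 * S * h) powr \<alpha> * (1 + \<bar>t\<bar>) powr - \<alpha>" if h: "0 < h" "h \<le> 1" for t h
  proof (cases "f (t + h) = 0 \<and> f t = 0")
    case True then show ?thesis by simp
  next
    case False
    then have big: "2 * pi < \<bar>t + h\<bar> \<or> 2 * pi < \<bar>t\<bar>" using z by force
    \<comment> \<open>\<open>u\<close> is the smaller of the two moduli, raised to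
      \<open>2 * pi\<close> where the supremum in \<open>A_sup\<close> begins. Points of modulus up
      to \<open>2 * pi\<close> are zeros of \<open>f\<close>, so \<open>f_zero f u\<close> still
      dominates both values, and \<open>h \<le> 1\<close> keeps the segment within modulus
      \<open>u + 2 * pi\<close>.\<close>
    define u where "u = max (2 * pi) (min \<bar>t\<bar> \<bar>t + h\<bar>)"
    have u: "2 * pi \<le> u" "u > 0" using pi_gt_zero by (auto simp: u_def less_max_iff_disj)
    have ut: "(1 + \<bar>t\<bar>) / 2 \<le> u" using h pi_gt3 big by (auto simp: u_def max_def min_def abs_if split: if_splits)
    \<comment> \<open>One of the two points has modulus above \<open>2 * pi\<close> and their
      distance is at most 1, so 0 does not lie between them.\<close>
    have sgn: "0 < t \<and> 0 < t + h \<or> t < 0 \<and> t + h < 0" using big h pi_gt3 by (auto simp: abs_if split: if_splits)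
    have sub: "{min t (t + h)<..<max t (t + h)} \<subseteq> {s. 0 < \<bar>s\<bar> \<and> \<bar>s\<bar> \<le> \<bar>u + 2 * pi\<bar>}"
      using sgn h pi_gt3 by (auto simp: u_def max_def min_def abs_if split: if_splits)
    have fz: "norm (f s) \<le> f_zero f u" if "s = t \<or> s = t + h" for s
    proof (cases "\<bar>s\<bar> \<le> 2 * pi")
      case True then show ?thesis using z f_zero_nonneg[OF f(1)] by simp
    next
      case False
      then have "\<bar>u\<bar> \<le> \<bar>s\<bar>" using that pi_gt_zero by (auto simp: u_def)
      then show ?thesis by (rule norm_le_f_zero[OF f(1)])
    qed
    define D where "D = norm (f (t + h) - f t)"
    have D0: "D \<ge> 0" by (simp add: D_def)
    have D1: "D \<le> 2 * f_zero f u"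
      using norm_triangle_ineq4[of "f (t + h)" "f t"] fz[of t] fz[of "t + h"] unfolding D_def by linarith
    have D2: "D \<le> \<Phi> (u + 2 * pi) * h"
    proof -
      have ae: "AE x in lebesgue. x \<in> {s. 0 < \<bar>s\<bar> \<and> \<bar>s\<bar> \<le> \<bar>u + 2 * pi\<bar>} \<longrightarrow> deriv_norm f x \<le> \<Phi> (u + 2 * pi)"
        unfolding \<Phi>_def f_infty_def using finf[of "u + 2 * pi"] u
        by (intro esssup_restrict_AE) (auto simp: f_infty_def)
      have "D \<le> \<Phi> (u + 2 * pi) * \<bar>t + h - t\<bar>" unfolding D_def
        by (rule locally_absolutely_continuous_increment_bound[OF f ae \<Phi>0 sgn sub])
      then show ?thesis using h by simp
    qed
    \<comment> \<open>The interpolation: the power \<open>\<delta>\<close> of \<open>D\<close> is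
      estimated by the size of \<open>f\<close>, the remaining factor by its derivative.\<close>
    have "D powr (1 + \<delta>) = D powr \<delta> * D"
      using D0 \<delta> by (cases "D = 0") (auto simp: powr_add mult.commute)
    also have "\<dots> \<le> (2 * f_zero f u) powr \<delta> * (\<Phi> (u + 2 * pi) * h)"
      using D0 D1 D2 \<delta> by (intro mult_mono powr_mono2) auto
    also have "\<dots> = 2 powr \<delta> * h * (f_zero f u powr \<delta> * \<Phi> (u + 2 * pi))"
      using f_zero_nonneg[OF f(1), of u] by (simp add: powr_mult mult_ac)
    also have "\<dots> \<le> 2 * h * (S / u)"
    proof (intro mult_mono)
      show "2 powr \<delta> \<le> 2" using \<delta> powr_mono[of \<delta> 1 2] by simp
      show "f_zero f u powr \<delta> * \<Phi> (u + 2 * pi) \<le> S / u" using key[OF u(1)] u(2) by (simp add: field_simps)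
    qed (use h \<Phi>0 in auto)
    also have "\<dots> \<le> 2 * h * (S / ((1 + \<bar>t\<bar>) / 2))"
      using ut h S u(2) by (intro mult_left_mono divide_left_mono) auto
    also have "\<dots> = 4 * S * h / (1 + \<bar>t\<bar>)" by simp
    finally have "(D powr (1 + \<delta>)) powr \<alpha> \<le> (4 * S * h / (1 + \<bar>t\<bar>)) powr \<alpha>"
      using \<alpha> by (intro powr_mono2) auto
    also have "(D powr (1 + \<delta>)) powr \<alpha> = D" using D0 \<delta> by (simp add: powr_powr \<alpha>_def)
    also have "(4 * S * h / (1 + \<bar>t\<bar>)) powr \<alpha> = (4 * S * h) powr \<alpha> * (1 + \<bar>t\<bar>) powr - \<alpha>"
      using S h by (subst powr_divide) (auto simp: powr_minus divide_inverse)
    finally show ?thesis by (simp add: D_def)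
  qed
  have L2: "nn_L2 v \<le> ennreal ((M * sqrt (J (2 * q)))\<^sup>2)"
    if v: "\<And>t. norm (v t) \<le> M * (1 + \<bar>t\<bar>) powr - q" and q: "2 * q > 1" for v :: "real \<Rightarrow> complex" and M q
  proof -
    have "nn_L2 v \<le> (\<integral>\<^sup>+t. ennreal (M\<^sup>2) * ennreal ((1 + \<bar>t\<bar>) powr - (2 * q)) \<partial>lborel)"
    proof (rule nn_integral_mono)
      fix t
      have "(norm (v t))\<^sup>2 \<le> (M * (1 + \<bar>t\<bar>) powr - q)\<^sup>2" by (intro power_mono v) auto
      also have "\<dots> = M\<^sup>2 * (1 + \<bar>t\<bar>) powr - (2 * q)"
        by (simp add: power_mult_distrib power2_eq_square[of "_ powr _"] powr_add[symmetric])
      finally show "ennreal ((norm (v t))\<^sup>2) \<le> ennreal (M\<^sup>2) * ennreal ((1 + \<bar>t\<bar>) powr - (2 * q))"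
        by (simp add: ennreal_mult'[symmetric] ennreal_leI)
    qed
    also have "\<dots> = ennreal (M\<^sup>2) * (\<integral>\<^sup>+t. ennreal ((1 + \<bar>t\<bar>) powr - (2 * q)) \<partial>lborel)"
      by (rule nn_integral_cmult) measurable
    also have "(\<integral>\<^sup>+t. ennreal ((1 + \<bar>t\<bar>) powr - (2 * q)) \<partial>lborel) = ennreal (J (2 * q))"
      using nn_integral_powr_finite[OF q] by (simp add: J_def)
    also have "ennreal (M\<^sup>2) * ennreal (J (2 * q)) = ennreal ((M * sqrt (J (2 * q)))\<^sup>2)"
      by (simp add: ennreal_mult'[symmetric] power_mult_distrib J_def)
    finally show ?thesis .
  qed
  have cont: "continuous_on UNIV f" by (rule C0_D(1)[OF f(1)])
  have [measurable]: "f \<in> borel_measurable borel" using cont by (rule borel_measurable_continuous_onI)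
  have int: "integrable lborel f"
  proof (rule Bochner_Integration.integrable_bound)
    have "integrable lborel (\<lambda>t. (1 + \<bar>t\<bar>) powr - (1/\<delta>))"
      using nn_integral_powr_finite[of "1/\<delta>"] \<delta> by (intro integrableI_bounded) auto
    then show "integrable lborel (\<lambda>t. G * (1 + \<bar>t\<bar>) powr - (1/\<delta>))" by simp
    show "AE t in lborel. norm (f t) \<le> norm (G * (1 + \<bar>t\<bar>) powr - (1/\<delta>))"
      using decay G0 by (intro AE_I2) simp
  qed simp
  have "wiener_le f (2 * sqrt pi / ((1 - cos 1) * (1 - 2 powr (1/2 - \<alpha>))) *
     (sqrt 1 * (G * sqrt (J (2 * (1/\<delta>)))) + ((4 * S) powr \<alpha> * sqrt (J (2 * \<alpha>))) * 1 powr (1/2 - \<alpha>)))"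
  proof (rule Bernstein_bound[OF int cont _ _ _ _ \<alpha>(1)])
    show "norm (f s) \<le> f_zero f 0" for s by (rule norm_le_f_zero[OF f(1)]) simp
    show "nn_L2 f \<le> ennreal ((G * sqrt (J (2 * (1/\<delta>))))\<^sup>2)"
      by (rule L2[OF decay]) (use \<delta> in \<open>simp add: field_simps\<close>)
    fix h :: real assume h: "0 < h" "h \<le> 1 / 1"
    have "nn_L2 (\<lambda>t. f (t + h) - f t) \<le> ennreal (((4 * S * h) powr \<alpha> * sqrt (J (2 * \<alpha>)))\<^sup>2)"
      by (rule L2) (use diff h \<alpha> in auto)
    also have "(4 * S * h) powr \<alpha> * sqrt (J (2 * \<alpha>)) = (4 * S) powr \<alpha> * sqrt (J (2 * \<alpha>)) * h powr \<alpha>"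
      using S h by (simp add: powr_mult mult_ac)
    finally show "nn_L2 (\<lambda>t. f (t + h) - f t) \<le> ennreal (((4 * S) powr \<alpha> * sqrt (J (2 * \<alpha>)) * h powr \<alpha>)\<^sup>2)" .
  qed (auto simp: G0 J_def)
  moreover have "(4 * S) powr \<alpha> = 4 powr \<alpha> * A" using S by (simp add: powr_mult A_eq)
  \<comment> \<open>\<open>A\<close> is normalised by \<open>S = A powr (1 + \<delta>)\<close>,
    which splits \<open>S powr (1/\<delta>)\<close> into \<open>A\<close> times
    \<open>A powr (1/\<delta>)\<close>.\<close>
  moreover have "G = 2 powr (1/\<delta>) * (A * A powr (1/\<delta>) * F powr (-1/\<delta>))"
  proof -
    have "A * A powr (1/\<delta>) = A powr (1 + 1/\<delta>)" using A by (simp add: powr_add)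
    also have "\<dots> = S powr (\<alpha> * (1 + 1/\<delta>))" by (simp add: A_eq powr_powr)
    also have "\<alpha> * (1 + 1/\<delta>) = 1/\<delta>" using \<delta> by (simp add: \<alpha>_def field_simps)
    finally have "A * A powr (1/\<delta>) = S powr (1/\<delta>)" .
    moreover have "F powr (-1/\<delta>) = 1 / F powr (1/\<delta>)" by (simp add: powr_minus_divide)
    ultimately show ?thesis using S F(1) by (simp add: G_def powr_divide powr_mult)
  qed
  ultimately show ?thesis by (simp add: mult_ac)
qed

section \<open>Choice of the constants and conclusion\<close>

theorem theorem1p1:
  shows
    "(\<exists>c::real. c > 0 \<and>
       (\<forall>f :: real \<Rightarrow> complex.
          f \<in> C0 \<longrightarrow>
          locally_absolutely_continuous_on (- {0}) f \<longrightarrow>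
          deriv_bounded_away_from_zero f \<longrightarrow>
          A_0 f < \<infinity> \<longrightarrow> A_1 f < \<infinity> \<longrightarrow> A_01 f < \<infinity> \<longrightarrow>
          f \<in> wiener_algebra \<and>
          ennreal (wiener_norm f) \<le> ennreal c * (A_0 f + A_1 f + A_01 f)))
     \<and>
     (\<exists>\<gamma> :: real \<Rightarrow> real. (\<forall>\<delta>\<in>{0<..<1}. \<gamma> \<delta> > 0) \<and>
       (\<forall>f :: real \<Rightarrow> complex. \<forall>\<delta>\<in>{0<..<1}.
          f \<in> C0 \<longrightarrow>
          locally_absolutely_continuous_on (- {0}) f \<longrightarrow>
          \<not> deriv_bounded_near_infinity f \<longrightarrow>
          (\<forall>t. \<bar>t\<bar> \<le> 2 * pi \<longrightarrow> f t = 0) \<longrightarrow>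
          f_infty f (4 * pi) > 0 \<longrightarrow>
          A_sup \<delta> f < \<infinity> \<longrightarrow>
          f \<in> wiener_algebra \<and>
          wiener_norm f \<le> \<gamma> \<delta> * A_delta \<delta> f *
            (1 + A_delta \<delta> f powr (1 / \<delta>) * enn2real (f_infty f (4 * pi)) powr (- 1 / \<delta>))))"
proof -
  define k where "k \<delta> = 2 * sqrt pi / ((1 - cos 1) * (1 - 2 powr (1/2 - 1 / (1 + \<delta>))))" for \<delta> :: real
  define J where "J p = enn2real (\<integral>\<^sup>+t. ennreal ((1 + \<bar>t\<bar>) powr - p) \<partial>lborel)" for p :: real
  define m where "m \<delta> = 2 powr (1/\<delta>) * sqrt (J (2/\<delta>))" for \<delta> :: real
  define n where "n \<delta> = 4 powr (1 / (1 + \<delta>)) * sqrt (J (2 * (1 / (1 + \<delta>))))" for \<delta> :: real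
  have mn: "m \<delta> \<ge> 0" "n \<delta> \<ge> 0" for \<delta> by (auto simp: m_def n_def J_def)
  have k: "k \<delta> > 0" if "\<delta> \<in> {0<..<1}" for \<delta>
  proof -
    have "1/2 - 1 / (1 + \<delta>) < 0" using that by (simp add: field_simps)
    then have "(2::real) powr (1/2 - 1 / (1 + \<delta>)) < 1" by (intro powr_less_one) auto
    then show ?thesis using cos_1_less_1 by (simp add: k_def)
  qed
  show ?thesis
  \<comment> \<open>The summand 1 makes the constant of part b) positive from
    \<open>m \<delta> \<ge> 0\<close> and \<open>n \<delta> \<ge> 0\<close> alone.\<close>
  proof (rule conjI; intro exI[of _ "80 * Lip_const"] exI[of _ "\<lambda>\<delta>. k \<delta> * (m \<delta> + n \<delta> + 1)"] conjI ballI allI impI)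
    show "80 * Lip_const > 0" using Lip_const_pos by simp
  next
    fix f :: "real \<Rightarrow> complex"
    assume f: "f \<in> C0" "locally_absolutely_continuous_on (- {0}) f"
      and A: "A_0 f < \<infinity>" "A_1 f < \<infinity>" "A_01 f < \<infinity>"
    note w = wiener_leD[OF wiener_le_of_A_integrals[OF f A]]
    show "f \<in> wiener_algebra" by (rule w)
    have "ennreal (wiener_norm f) \<le> ennreal (80 * Lip_const * (enn2real (A_0 f) + enn2real (A_1 f) + enn2real (A_01 f)))"
      by (rule ennreal_leI[OF w(2)])
    also have "\<dots> = ennreal (80 * Lip_const) * (A_0 f + A_1 f + A_01 f)"
      using A Lip_const_pos by (subst ennreal_mult) (auto simp: ennreal_plus)
    finally show "ennreal (wiener_norm f) \<le> ennreal (80 * Lip_const) * (A_0 f + A_1 f + A_01 f)" .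
  next
    fix \<delta> :: real assume \<delta>: "\<delta> \<in> {0<..<1}"
    then show "k \<delta> * (m \<delta> + n \<delta> + 1) > 0"
      using k[OF \<delta>] mn[of \<delta>] by (intro mult_pos_pos) auto
  next
    fix f :: "real \<Rightarrow> complex" and \<delta> :: real
    assume \<delta>: "\<delta> \<in> {0<..<1}" and f: "f \<in> C0" "locally_absolutely_continuous_on (- {0}) f"
      and nb: "\<not> deriv_bounded_near_infinity f" and z: "\<forall>t. \<bar>t\<bar> \<le> 2 * pi \<longrightarrow> f t = 0"
      and pos: "f_infty f (4 * pi) > 0" and fin: "A_sup \<delta> f < \<infinity>"
    define A where "A = A_delta \<delta> f"
    define E where "E = A powr (1/\<delta>) * enn2real (f_infty f (4 * pi)) powr (-1/\<delta>)"
    have AE: "A \<ge> 0" "E \<ge> 0" by (auto simp: A_def A_delta_def E_def)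
    have "wiener_le f (k \<delta> * (m \<delta> * (A * A powr (1/\<delta>) * enn2real (f_infty f (4 * pi)) powr (-1/\<delta>)) + n \<delta> * A))"
      unfolding k_def m_def n_def J_def A_def
      by (rule wiener_le_of_A_sup[OF f nb _ pos fin]) (use z \<delta> in auto)
    then have w: "wiener_le f (k \<delta> * (m \<delta> * (A * E) + n \<delta> * A))" by (simp add: E_def mult.assoc)
    show "f \<in> wiener_algebra" by (rule wiener_leD(1)[OF w])
    have "wiener_norm f \<le> k \<delta> * (m \<delta> * (A * E) + n \<delta> * A)" by (rule wiener_leD(2)[OF w])
    also have "\<dots> \<le> k \<delta> * ((m \<delta> + n \<delta> + 1) * (A * (1 + E)))"
    proof (rule mult_left_mono)
      have "m \<delta> * (A * E) \<le> (m \<delta> + n \<delta> + 1) * (A * E)" "n \<delta> * A \<le> (m \<delta> + n \<delta> + 1) * A"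
        using mn[of \<delta>] AE by (auto intro!: mult_right_mono)
      then show "m \<delta> * (A * E) + n \<delta> * A \<le> (m \<delta> + n \<delta> + 1) * (A * (1 + E))"
        by (simp add: algebra_simps)
    qed (use k[OF \<delta>] in simp)
    finally show "wiener_norm f \<le> k \<delta> * (m \<delta> + n \<delta> + 1) * A_delta \<delta> f *
            (1 + A_delta \<delta> f powr (1 / \<delta>) * enn2real (f_infty f (4 * pi)) powr (- 1 / \<delta>))"
      by (simp add: E_def A_def mult.assoc)
  qed
qed

end
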